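(* Uniformly for $(r,z)$ in compact subsets of $\mathbb R_{\ge0}\times\mathbb R$, $$\lim_{t\to0}t^2\,p_t(\sqrt t\,r,\,tz)=2\pi^2\,h_1(r,z).$$
   Context: $\mathbf{SU}(2)$ is the group of $2\times2$ complex unitary matrices of determinant $1$. Let $X,Y,Z$ be the left-invariant vector fields on $\mathbf{SU}(2)$ corresponding to the elements $\begin{pmatrix}0&1\\-1&0\end{pmatrix}$, $\begin{pmatrix}0&i\\i&0\end{pmatrix}$, $\begin{pmatrix}i&0\\0&-i\end{pmatrix}$ of its Lie algebra; they satisfy $[Z,X]=2Y$, $[X,Y]=2Z$, $[Y,Z]=2X$. Put $\mathcal L=X^2+Y^2$ (a subelliptic operator). Cylindric coordinates $(r,\theta,z)$, $0\le r<\pi/2$, $\theta\in[0,2\pi]$, $z\in[-\pi,\pi]$, are given by $$(r,\theta,z)\mapsto \exp(r\cos\theta\,X+r\sin\theta\,Y)\exp(zZ).$$ The normalized bi-invariant Haar measure is $d\mu=\frac{1}{4\pi^2}\sin 2r\,dr\,d\theta\,dz$. The semigroup $P_t=e^{t\mathcal L}$ has a smooth kernel with respect to $\mu$; the heat kernel issued from the identity, i.e. the function $p_t$ with $(P_tf)(\text{identity})=\int p_t f\,d\mu$, depends only on $(r,z)$ and is written $p_t(r,z)$. The heat kernel on the three-dimensional Heisenberg group, with respect to $r\,dr\,d\theta\,dz$, is $$h_t(r,z)=\frac{1}{16\pi^2}\int_{-\infty}^{+\infty}e^{\frac{i\lambda z}{2}}\frac{\lambda}{\sinh\lambda t}\,e^{-\frac{r^2}{4}\lambda\coth(\lambda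 t)}\,d\lambda .$$ *)

theory Defs
  imports "HOL-Analysis.Analysis"
begin

section \<open>The group SU(2)\<close>

definition conj_transpose :: "complex^2^2 \<Rightarrow> complex^2^2" where
  "conj_transpose A = (\<chi> i j. cnj (A $ j $ i))"

typedef su2 = "{A :: complex^2^2.
    A ** conj_transpose A = mat 1 \<and> conj_transpose A ** A = mat 1 \<and> det A = 1}"
proof
  have "conj_transpose (mat 1) = mat 1"
    by (simp add: conj_transpose_def mat_def vec_eq_iff)
  then show "mat 1 \<in> {A :: complex^2^2.
      A ** conj_transpose A = mat 1 \<and> conj_transpose A ** A = mat 1 \<and> det A = 1}"
    by simp
qed

setup_lifting type_definition_su2

text \<open>The topology of \<^typ>\<open>su2\<close> is the one induced from the space of matrices.\<close>

instantiation su2 :: metric_space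
begin

definition dist_su2 :: "su2 \<Rightarrow> su2 \<Rightarrow> real" where
  "dist_su2 g h = dist (Rep_su2 g) (Rep_su2 h)"

definition uniformity_su2 :: "(su2 \<times> su2) filter" where
  "uniformity_su2 = (INF e\<in>{0 <..}. principal {(g, h). dist g h < e})"

definition open_su2 :: "su2 set \<Rightarrow> bool" where
  "open_su2 U = (\<forall>x\<in>U. \<forall>\<^sub>F (x', y) in uniformity. x' = x \<longrightarrow> y \<in> U)"

instance
  by standard
    (auto simp: dist_su2_def uniformity_su2_def open_su2_def Rep_su2_inject
      intro: dist_triangle2)

end

lemma conj_transpose_mult: "conj_transpose (A ** B) = conj_transpose B ** conj_transpose A"
  by (simp add: conj_transpose_def matrix_matrix_mult_def vec_eq_iff mult.commute)

instantiation su2 :: monoid_mult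
begin

lift_definition one_su2 :: su2 is "mat 1"
  by (simp add: conj_transpose_def mat_def vec_eq_iff matrix_matrix_mult_def det_2 if_distrib sum_2 forall_2)

lift_definition times_su2 :: "su2 \<Rightarrow> su2 \<Rightarrow> su2" is "(**)"
proof -
  fix A B :: "complex^2^2"
  assume A: "A ** conj_transpose A = mat 1 \<and> conj_transpose A ** A = mat 1 \<and> det A = 1"
    and B: "B ** conj_transpose B = mat 1 \<and> conj_transpose B ** B = mat 1 \<and> det B = 1"
  have "A ** B ** conj_transpose (A ** B) = A ** (B ** conj_transpose B) ** conj_transpose A"
    by (simp add: conj_transpose_mult matrix_mul_assoc)
  moreover have "conj_transpose (A ** B) ** (A ** B)
      = conj_transpose B ** (conj_transpose A ** A) ** B"
    by (simp add: conj_transpose_mult matrix_mul_assoc)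
  ultimately show "A ** B ** conj_transpose (A ** B) = mat 1
      \<and> conj_transpose (A ** B) ** (A ** B) = mat 1 \<and> det (A ** B) = 1"
    using A B by (simp add: det_mul)
qed

instance
  by standard (transfer; simp add: matrix_mul_assoc)+

end

definition matrix_exp :: "complex^2^2 \<Rightarrow> complex^2^2" where
  "matrix_exp A = (\<Sum>k. (1 / fact k) *\<^sub>R (((**) A ^^ k) (mat 1)))"

text \<open>Only meant for \<open>A\<close> in the Lie algebra (traceless and skew-Hermitian), where
  \<^term>\<open>matrix_exp A\<close> is indeed in the group.\<close>

definition su2_exp :: "complex^2^2 \<Rightarrow> su2" where
  "su2_exp A = Abs_su2 (matrix_exp A)"

definition mX :: "complex^2^2" where "mX = vector [vector [0, 1], vector [-1, 0]]"
definition mY :: "complex^2^2" where "mY = vector [vector [0, \<i>], vector [\<i>, 0]]"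
definition mZ :: "complex^2^2" where "mZ = vector [vector [\<i>, 0], vector [0, -\<i>]]"

section \<open>Left-invariant vector fields and the operator \<open>X\<^sup>2 + Y\<^sup>2\<close>\<close>

definition lie_deriv :: "complex^2^2 \<Rightarrow> (su2 \<Rightarrow> real) \<Rightarrow> su2 \<Rightarrow> real" where
  "lie_deriv A f g = deriv (\<lambda>s. f (g * su2_exp (s *\<^sub>R A))) 0"

text \<open>Since \<open>X, Y, Z\<close> form a global frame of the tangent bundle, a function is of class
  \<open>C\<^sup>k\<close> iff its iterated derivatives along them up to order \<open>k\<close> exist and are continuous.\<close>

primrec su2_Ck :: "nat \<Rightarrow> (su2 \<Rightarrow> real) \<Rightarrow> bool" where
  "su2_Ck 0 f \<longleftrightarrow> continuous_on UNIV f"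
| "su2_Ck (Suc k) f \<longleftrightarrow> continuous_on UNIV f \<and>
     (\<forall>A \<in> {mX, mY, mZ}.
        (\<forall>g. (\<lambda>s::real. f (g * su2_exp (s *\<^sub>R A))) differentiable (at 0)) \<and>
        su2_Ck k (lie_deriv A f))"

definition su2_smooth :: "(su2 \<Rightarrow> real) \<Rightarrow> bool" where
  "su2_smooth f \<longleftrightarrow> (\<forall>k. su2_Ck k f)"

definition sublaplacian :: "(su2 \<Rightarrow> real) \<Rightarrow> su2 \<Rightarrow> real" where
  "sublaplacian f g = lie_deriv mX (lie_deriv mX f) g + lie_deriv mY (lie_deriv mY f) g"

section \<open>The semigroup generated by the operator\<close>

definition C0_semigroup :: "(real \<Rightarrow> 'a::real_normed_vector \<Rightarrow>\<^sub>L 'a) \<Rightarrow> bool" where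
  "C0_semigroup P \<longleftrightarrow>
     P 0 = id_blinfun \<and>
     (\<forall>s\<ge>0. \<forall>t\<ge>0. P (s + t) = P s o\<^sub>L P t) \<and>
     (\<forall>f. continuous_on {0..} (\<lambda>t. blinfun_apply (P t) f))"

text \<open>The infinitesimal generator, as an operator given by its graph.\<close>

definition generator :: "(real \<Rightarrow> 'a::real_normed_vector \<Rightarrow>\<^sub>L 'a) \<Rightarrow> ('a \<times> 'a) set" where
  "generator P =
     {(f, g). ((\<lambda>t. (1 / t) *\<^sub>R (blinfun_apply (P t) f - f)) \<longlongrightarrow> g) (at_right 0)}"

text \<open>The semigroup \<open>P t = exp (t L)\<close> acts on the Banach space of continuous functions on
  SU(2) (which are bounded by compactness) with the supremum norm; its generator is the closure
  of \<open>L\<close> with domain the smooth functions. This determines \<open>P t\<close> for \<open>t \<ge> 0\<close>.\<close>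

definition is_heat_semigroup :: "(real \<Rightarrow> (su2 \<Rightarrow>\<^sub>C real) \<Rightarrow>\<^sub>L (su2 \<Rightarrow>\<^sub>C real)) \<Rightarrow> bool" where
  "is_heat_semigroup P \<longleftrightarrow>
     C0_semigroup P \<and>
     generator P = closure {(f, g). su2_smooth (apply_bcontfun f) \<and>
                                    apply_bcontfun g = sublaplacian (apply_bcontfun f)}"

section \<open>Cylindric coordinates, Haar measure and heat kernel\<close>

definition cyl :: "real \<Rightarrow> real \<Rightarrow> real \<Rightarrow> su2" where
  "cyl r \<theta> z = su2_exp ((r * cos \<theta>) *\<^sub>R mX + (r * sin \<theta>) *\<^sub>R mY) * su2_exp (z *\<^sub>R mZ)"

definition haar_su2 :: "su2 measure" where
  "haar_su2 = distr
     (density lborel (\<lambda>(r, \<theta>, z).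
        indicator ({0..<pi/2} \<times> {0..2*pi} \<times> {-pi..pi}) (r, \<theta>, z) *
        ennreal (sin (2 * r) / (4 * pi\<^sup>2))))
     borel (\<lambda>(r, \<theta>, z). cyl r \<theta> z)"

definition is_heat_kernel :: "(real \<Rightarrow> su2 \<Rightarrow> real) \<Rightarrow> bool" where
  "is_heat_kernel p \<longleftrightarrow>
     (\<exists>P. is_heat_semigroup P \<and>
       (\<forall>t>0. su2_smooth (p t) \<and>
          (\<forall>f. apply_bcontfun (blinfun_apply (P t) f) 1
               = (\<integral>g. p t g * apply_bcontfun f g \<partial>haar_su2))))"

text \<open>The heat kernel of the Heisenberg group. The integrand has a removable singularity at
  \<open>\<xi> = 0\<close>, which is irrelevant for the integral.\<close>

definition heis_kernel :: "real \<Rightarrow> real \<Rightarrow> real \<Rightarrow> complex" where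
  "heis_kernel t r z = 1 / (16 * pi\<^sup>2) *
     (\<integral>\<xi>. exp (\<i> * \<xi> * z / 2) *
         complex_of_real (\<xi> / sinh (\<xi> * t) *
           exp (- (r\<^sup>2 / 4) * \<xi> * (cosh (\<xi> * t) / sinh (\<xi> * t)))) \<partial>lborel)"

end

theory Submission
  imports Defs
begin

text \<open>
  The heat kernel is determined by its spectral expansion, and the limit is taken term by term.

  Let \<open>alpha\<close>, \<open>beta\<close> be the entries of the first row of a matrix in SU(2). The fields \<open>X\<close>, \<open>Y\<close> act
  on them linearly, so polynomials in the entries and their conjugates are smooth, and
  \<open>X\<^sup>2 + Y\<^sup>2\<close> is triangular on the monomials \<open>beta ^ w * alpha ^ i * cnj alpha ^ j\<close>
  (\<open>sublaplacian_monomial\<close>). The definition of the generator therefore turns the values of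
  \<open>P\<^sub>t\<close> on monomials at the identity into a triangular system of linear differential equations,
  whose solution is explicit (\<open>heat_mean_monomial_off_diagonal\<close>, \<open>heat_mean_monomial_diagonal\<close>). The
  series of diagonal matrix coefficients
  \<open>\<phi>\<^bsub>|n|,k\<^esub>(r) exp (i n z)\<close> over all integers \<open>n\<close> and naturals \<open>k\<close>, with coefficients
  \<open>(2 k + |n| + 1) exp (- (4 k (k + |n| + 1) + 2 |n|) t)\<close>,
  has the same integrals against monomials, by orthogonality of Jacobi polynomials. Polynomials are
  dense by Stone and Weierstrass and Haar measure has full support, so the series is the heat kernel
  (\<open>heat_kernel_eq_heat_series\<close>).

  At the point with coordinates \<open>sqrt t * r\<close> and \<open>t * z\<close>, \<open>t\<^sup>2\<close> times the sum over \<open>n\<close> is a Riemann sum with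
  step \<open>t\<close> in the variable \<open>x = n * t\<close>. The functions \<open>\<phi>\<close> are bounded by \<open>1\<close>, being matrix
  coefficients of unitary representations (\<open>abs_disc_poly_le_1\<close>), which gives an integrable majorant,
  and they converge to \<open>exp (- x r\<^sup>2 / 2) L\<^sub>k(x r\<^sup>2)\<close> with the Laguerre polynomial \<open>L\<^sub>k\<close>
  (\<open>disc_poly_tendsto_laguerre\<close>). In the limit the sum over \<open>k\<close> is the Laguerre generating function
  at \<open>exp (- 4 x)\<close>, and this is the integrand of the Heisenberg kernel at frequency \<open>2 x\<close>. The
  domination is uniform, so \<open>r\<close> and \<open>z\<close> may vary with \<open>t\<close>, and convergence on compact sets is uniform.
\<close>

section \<open>The entries of a matrix as coordinates on SU(2)\<close>

text \<open>As functions on the group, these two entries generate, together with their complex conjugates,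
  the algebra of matrix coefficients.\<close>

definition alpha :: "su2 \<Rightarrow> complex" where "alpha g = Rep_su2 g $ 1 $ 1"
definition beta :: "su2 \<Rightarrow> complex" where "beta g = Rep_su2 g $ 1 $ 2"

definition row_matrix :: "complex \<Rightarrow> complex \<Rightarrow> complex^2^2" where
  "row_matrix a b = vector [vector [a, b], vector [- cnj b, cnj a]]"

lemma row_matrix_nth [simp]:
  "row_matrix a b $ 1 $ 1 = a" "row_matrix a b $ 1 $ 2 = b"
  "row_matrix a b $ 2 $ 1 = - cnj b" "row_matrix a b $ 2 $ 2 = cnj a"
  by (simp_all add: row_matrix_def)

lemma row_matrix_in_su2:
  assumes "a * cnj a + b * cnj b = 1"
  shows "row_matrix a b ** conj_transpose (row_matrix a b) = mat 1 \<and>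
    conj_transpose (row_matrix a b) ** row_matrix a b = mat 1 \<and> det (row_matrix a b) = 1"
  using assms
  by (simp add: conj_transpose_def mat_def vec_eq_iff matrix_matrix_mult_def det_2 sum_2 forall_2
      algebra_simps)

lemma row_norm: "alpha g * cnj (alpha g) + beta g * cnj (beta g) = 1"
proof -
  have "(Rep_su2 g ** conj_transpose (Rep_su2 g)) $ 1 $ 1 = 1"
    using Rep_su2[of g] by (simp add: mat_def)
  then show ?thesis
    by (simp add: conj_transpose_def matrix_matrix_mult_def sum_2 alpha_def beta_def)
qed

lemma Rep_su2_row: "Rep_su2 g = row_matrix (alpha g) (beta g)"
proof -
  let ?a = "Rep_su2 g $ 1 $ 1" and ?b = "Rep_su2 g $ 1 $ 2"
  let ?c = "Rep_su2 g $ 2 $ 1" and ?d = "Rep_su2 g $ 2 $ 2"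
  have d: "?a * ?d - ?b * ?c = 1"
    using Rep_su2[of g] by (simp add: det_2)
  have n: "?a * cnj ?a + ?b * cnj ?b = 1"
    using row_norm[of g] by (simp add: alpha_def beta_def)
  have "(Rep_su2 g ** conj_transpose (Rep_su2 g)) $ 2 $ 1 = 0"
    using Rep_su2[of g] by (simp add: mat_def)
  then have o: "?c * cnj ?a + ?d * cnj ?b = 0"
    by (simp add: conj_transpose_def matrix_matrix_mult_def sum_2)
  have "?d = cnj ?a" using d n o by algebra
  moreover have "?c = - cnj ?b" using d n o by algebra
  ultimately show ?thesis
    by (simp add: vec_eq_iff forall_2 alpha_def beta_def)
qed

lemma su2_eqI: "alpha g = alpha h \<Longrightarrow> beta g = beta h \<Longrightarrow> g = h"
  by (metis Rep_su2_inject Rep_su2_row)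

lemma exists_su2_row:
  assumes "a * cnj a + b * cnj b = 1"
  obtains g where "alpha g = a" "beta g = b"
proof
  have "Rep_su2 (Abs_su2 (row_matrix a b)) = row_matrix a b"
    using row_matrix_in_su2[OF assms] by (intro Abs_su2_inverse) simp
  then show "alpha (Abs_su2 (row_matrix a b)) = a" "beta (Abs_su2 (row_matrix a b)) = b"
    by (simp_all add: alpha_def beta_def)
qed

lemma alpha_mult: "alpha (g * h) = alpha g * alpha h - beta g * cnj (beta h)"
  and beta_mult: "beta (g * h) = alpha g * beta h + beta g * cnj (alpha h)"
proof -
  have "alpha (g * h) = alpha g * Rep_su2 h $ 1 $ 1 + beta g * Rep_su2 h $ 2 $ 1"
    unfolding alpha_def beta_def times_su2.rep_eq by (simp add: matrix_matrix_mult_def sum_2)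
  then show "alpha (g * h) = alpha g * alpha h - beta g * cnj (beta h)"
    by (simp add: Rep_su2_row)
  have "beta (g * h) = alpha g * Rep_su2 h $ 1 $ 2 + beta g * Rep_su2 h $ 2 $ 2"
    unfolding alpha_def beta_def times_su2.rep_eq by (simp add: matrix_matrix_mult_def sum_2)
  then show "beta (g * h) = alpha g * beta h + beta g * cnj (alpha h)"
    by (simp add: Rep_su2_row)
qed

lemma alpha_one [simp]: "alpha 1 = 1" and beta_one [simp]: "beta 1 = 0"
  unfolding alpha_def beta_def one_su2.rep_eq by (simp_all add: mat_def)

lemma dist_su2_row:
  "dist g h \<le> 2 * dist (alpha g) (alpha h) + 2 * dist (beta g) (beta h)"
proof -
  have e: "dist (- cnj x) (- cnj y) = dist x y" "dist (cnj x) (cnj y) = dist x y" for x y :: complex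
    by (simp_all add: dist_norm flip: complex_cnj_diff)
       (metis complex_cnj_diff complex_mod_cnj minus_diff_eq norm_minus_commute uminus_add_conv_diff)
  have "dist g h \<le> (\<Sum>i\<in>UNIV. dist (Rep_su2 g $ i) (Rep_su2 h $ i))"
    unfolding dist_su2_def dist_vec_def by (rule L2_set_le_sum) auto
  also have "\<dots> \<le> (\<Sum>i\<in>UNIV. \<Sum>j\<in>UNIV. dist (Rep_su2 g $ i $ j) (Rep_su2 h $ i $ j))"
    unfolding dist_vec_def[where 'b = 2] by (intro sum_mono L2_set_le_sum) auto
  also have "\<dots> = 2 * dist (alpha g) (alpha h) + 2 * dist (beta g) (beta h)"
    by (simp add: sum_2 Rep_su2_row e)
  finally show ?thesis .
qed

lemma continuous_on_alpha: "continuous_on UNIV alpha" and continuous_on_beta: "continuous_on UNIV beta"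
proof -
  have "dist (alpha g) (alpha h) \<le> dist g h" "dist (beta g) (beta h) \<le> dist g h" for g h
    unfolding dist_su2_def alpha_def beta_def
    by (meson dist_vec_nth_le order_trans)+
  then show "continuous_on UNIV alpha" "continuous_on UNIV beta"
    unfolding continuous_on_iff by (meson order.strict_trans1)+
qed

lemma continuous_into_su2:
  assumes "continuous_on S (\<lambda>x. alpha (f x))" "continuous_on S (\<lambda>x. beta (f x))"
  shows "continuous_on S f"
  unfolding continuous_on_def
proof
  fix x assume x: "x \<in> S"
  have "((\<lambda>y. 2 * dist (alpha (f y)) (alpha (f x)) + 2 * dist (beta (f y)) (beta (f x)))
      \<longlongrightarrow> 2 * 0 + 2 * 0) (at x within S)"
    using assms x unfolding continuous_on_def
    by (intro tendsto_add tendsto_mult tendsto_const iffD1[OF tendsto_dist_iff]) auto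
  then have lim: "((\<lambda>y. 2 * dist (alpha (f y)) (alpha (f x)) + 2 * dist (beta (f y)) (beta (f x)))
      \<longlongrightarrow> 0) (at x within S)"
    by (simp only: mult_zero_right add_0)
  have "((\<lambda>y. dist (f y) (f x)) \<longlongrightarrow> 0) (at x within S)"
    by (rule tendsto_sandwich[OF always_eventually always_eventually tendsto_const lim])
      (simp_all add: dist_su2_row)
  then show "(f \<longlongrightarrow> f x) (at x within S)"
    by (rule iffD2[OF tendsto_dist_iff])
qed

lemma compact_su2: "compact (UNIV :: su2 set)"
proof -
  define S where "S = {p :: complex \<times> complex. fst p * cnj (fst p) + snd p * cnj (snd p) = 1}"
  define mk where "mk p = (SOME g. alpha g = fst p \<and> beta g = snd p)" for p
  have mk: "alpha (mk p) = fst p \<and> beta (mk p) = snd p" if "p \<in> S" for p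
  proof -
    have "fst p * cnj (fst p) + snd p * cnj (snd p) = 1"
      using that by (simp add: S_def)
    then obtain g where "alpha g = fst p" "beta g = snd p"
      by (rule exists_su2_row)
    then have "\<exists>g. alpha g = fst p \<and> beta g = snd p" by blast
    then show ?thesis unfolding mk_def by (rule someI_ex)
  qed
  have nrm: "norm p = 1" if "p \<in> S" for p
  proof -
    have "complex_of_real ((cmod (fst p))\<^sup>2 + (cmod (snd p))\<^sup>2) = 1"
      using that unfolding S_def of_real_add complex_norm_square by simp
    then show ?thesis
      unfolding norm_prod_def of_real_eq_1_iff by simp
  qed
  have "closed S"
    unfolding S_def by (intro closed_Collect_eq continuous_intros)
  moreover have "bounded S"
    unfolding bounded_iff using nrm by (intro exI[of _ 1]) auto
  ultimately have "compact S" by (simp add: compact_eq_bounded_closed)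
  moreover have "continuous_on S mk"
    using mk by (intro continuous_into_su2)
      (auto intro!: continuous_intros cong: continuous_on_cong)
  ultimately have "compact (mk ` S)" by (rule compact_continuous_image[rotated])
  moreover have "g \<in> mk ` S" for g
  proof
    show S: "(alpha g, beta g) \<in> S" unfolding S_def using row_norm by simp
    show "g = mk (alpha g, beta g)" using mk[OF S] by (intro su2_eqI) auto
  qed
  ultimately show ?thesis
    by (metis UNIV_eq_I)
qed

text \<open>A matrix of square \<open>- 1\<close> generates a copy of the complex numbers, in which the exponential
  series is Euler's formula. Every Lie algebra element that occurs below is a real multiple of such
  a matrix.\<close>

lemma matrix_exp_unit:
  assumes "B ** B = - mat 1"
  shows "matrix_exp (s *\<^sub>R B) = cos s *\<^sub>R mat 1 + sin s *\<^sub>R B"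
proof -
  have pow: "((**) (s *\<^sub>R B) ^^ k) (mat 1)
      = (fact k * (cos_coeff k * s ^ k)) *\<^sub>R mat 1 + (fact k * (sin_coeff k * s ^ k)) *\<^sub>R B" for k
  proof (induction k)
    case 0
    then show ?case by (simp add: cos_coeff_def sin_coeff_def)
  next
    case (Suc k)
    have lin: "(s *\<^sub>R B) ** (x *\<^sub>R mat 1 + y *\<^sub>R B) = (- (s * y)) *\<^sub>R mat 1 + (s * x) *\<^sub>R B" for x y
    proof -
      have "(s *\<^sub>R B) ** (x *\<^sub>R mat 1 + y *\<^sub>R B) = (s * x) *\<^sub>R (B ** mat 1) + (s * y) *\<^sub>R (B ** B)"
        by (simp add: vec_eq_iff matrix_matrix_mult_def sum_2 algebra_simps)
      then show ?thesis by (simp add: assms)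
    qed
    have f: "fact (Suc k) * (- sin_coeff k / real (Suc k) * s ^ Suc k) = - (s * (fact k * (sin_coeff k * s ^ k)))"
      "fact (Suc k) * (cos_coeff k / real (Suc k) * s ^ Suc k) = s * (fact k * (cos_coeff k * s ^ k))"
      by (simp_all add: field_simps del: of_nat_Suc)
    show ?case
      unfolding funpow.simps o_apply Suc lin cos_coeff_Suc sin_coeff_Suc f ..
  qed
  have "(\<lambda>k. (cos_coeff k *\<^sub>R s ^ k) *\<^sub>R mat 1 + (sin_coeff k *\<^sub>R s ^ k) *\<^sub>R B)
      sums (cos s *\<^sub>R mat 1 + sin s *\<^sub>R B)"
    by (intro sums_add sums_scaleR_left cos_converges sin_converges)
  then show ?thesis
    unfolding matrix_exp_def pow by (simp add: scaleR_add_right sums_iff)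
qed

lemma su2_exp_unit:
  assumes "a * cnj a + b * cnj b = 1" "a = - cnj a"
  shows "alpha (su2_exp (s *\<^sub>R row_matrix a b)) = of_real (cos s) + of_real (sin s) * a"
    and "beta (su2_exp (s *\<^sub>R row_matrix a b)) = of_real (sin s) * b"
proof -
  have a: "cnj a = - a" using assms(2) by (metis minus_minus)
  have n: "a * a = b * cnj b - 1" using assms(1) unfolding a by (simp add: algebra_simps)
  have "row_matrix a b ** row_matrix a b = - mat 1"
    using n
    by (simp add: vec_eq_iff matrix_matrix_mult_def sum_2 forall_2 mat_def a algebra_simps)
  from matrix_exp_unit[OF this] have m: "matrix_exp (s *\<^sub>R row_matrix a b)
      = row_matrix (of_real (cos s) + of_real (sin s) * a) (of_real (sin s) * b)"
    by (simp add: vec_eq_iff forall_2 mat_def scaleR_conv_of_real[where 'a = complex] a)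
  have "(complex_of_real (cos s))\<^sup>2 + (complex_of_real (sin s))\<^sup>2 = 1"
    by (simp flip: of_real_power of_real_add)
  then have "(of_real (cos s) + of_real (sin s) * a) * cnj (of_real (cos s) + of_real (sin s) * a) + (of_real (sin s) * b) * cnj (of_real (sin s) * b) = 1"
    unfolding complex_cnj_add complex_cnj_mult complex_cnj_complex_of_real a using n by algebra
  then have "Rep_su2 (su2_exp (s *\<^sub>R row_matrix a b)) = row_matrix (of_real (cos s) + of_real (sin s) * a) (of_real (sin s) * b)"
    unfolding su2_exp_def m by (intro Abs_su2_inverse) (simp only: mem_Collect_eq row_matrix_in_su2)
  then show "alpha (su2_exp (s *\<^sub>R row_matrix a b)) = of_real (cos s) + of_real (sin s) * a"
    "beta (su2_exp (s *\<^sub>R row_matrix a b)) = of_real (sin s) * b"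
    by (simp_all add: alpha_def beta_def)
qed

lemma mX_row: "mX = row_matrix 0 1" and mY_row: "mY = row_matrix 0 \<i>" and mZ_row: "mZ = row_matrix \<i> 0"
  by (simp_all add: mX_def mY_def mZ_def row_matrix_def)

lemma alpha_cyl: "alpha (cyl r \<theta> z) = of_real (cos r) * cis z"
  and beta_cyl: "beta (cyl r \<theta> z) = of_real (sin r) * cis (\<theta> - z)"
proof -
  have "(r * cos \<theta>) *\<^sub>R mX + (r * sin \<theta>) *\<^sub>R mY = r *\<^sub>R row_matrix 0 (cis \<theta>)"
    by (simp add: mX_row mY_row vec_eq_iff forall_2 scaleR_conv_of_real[where 'a = complex] complex_eq_iff)
  then have c: "cyl r \<theta> z = su2_exp (r *\<^sub>R row_matrix 0 (cis \<theta>)) * su2_exp (z *\<^sub>R row_matrix \<i> 0)"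
    by (simp add: cyl_def mZ_row)
  have 1: "alpha (su2_exp (r *\<^sub>R row_matrix 0 (cis \<theta>))) = of_real (cos r)"
    "beta (su2_exp (r *\<^sub>R row_matrix 0 (cis \<theta>))) = of_real (sin r) * cis \<theta>"
    by (simp_all add: su2_exp_unit cis_cnj cis_mult)
  have 2: "alpha (su2_exp (z *\<^sub>R row_matrix \<i> 0)) = cis z"
    "beta (su2_exp (z *\<^sub>R row_matrix \<i> 0)) = 0"
    by (simp_all add: su2_exp_unit complex_eq_iff)
  show "alpha (cyl r \<theta> z) = of_real (cos r) * cis z" "beta (cyl r \<theta> z) = of_real (sin r) * cis (\<theta> - z)"
    unfolding c alpha_mult beta_mult 1 2 by (simp_all add: cis_cnj cis_mult)
qed

lemma continuous_on_cyl:
  "continuous_on S (\<lambda>x. cyl (fst x) (fst (snd x)) (snd (snd x)))"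
  by (rule continuous_into_su2) (auto simp: alpha_cyl beta_cyl cis_conv_exp intro!: continuous_intros)

text \<open>Polar coordinates for the two entries of the first row.\<close>

lemma cyl_surj:
  obtains r \<theta> z where "r \<in> {0..pi/2}" "\<theta> \<in> {0..2*pi}" "z \<in> {-pi..pi}" "g = cyl r \<theta> z"
proof -
  define z where "z = Arg (alpha g)"
  have az: "alpha g = cmod (alpha g) * cis z"
    unfolding z_def by (metis rcis_cmod_Arg rcis_def)
  define b where "b = beta g * cis z"
  define \<theta> where "\<theta> = Arg2pi b"
  have bt: "b = cmod b * cis \<theta>"
    unfolding \<theta>_def cis_conv_exp by (rule Arg2pi_eq)
  have nb: "cmod b = cmod (beta g)" by (simp add: b_def norm_mult)
  have be: "beta g = cmod (beta g) * cis (\<theta> - z)"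
  proof -
    have "beta g = b * cis (- z)" by (simp add: b_def cis_mult mult.assoc)
    also have "\<dots> = cmod b * (cis \<theta> * cis (- z))"
      by (subst bt) (simp only: mult.assoc)
    finally show ?thesis by (simp add: cis_mult nb)
  qed
  define r where "r = arccos (cmod (alpha g))"
  have sq: "(cmod (alpha g))\<^sup>2 + (cmod (beta g))\<^sup>2 = 1"
  proof -
    have "complex_of_real ((cmod (alpha g))\<^sup>2 + (cmod (beta g))\<^sup>2) = 1"
      unfolding of_real_add by (metis complex_norm_square row_norm)
    then show ?thesis by (metis of_real_eq_1_iff)
  qed
  have le: "cmod (alpha g) \<le> 1"
  proof (rule power2_le_imp_le)
    show "(cmod (alpha g))\<^sup>2 \<le> 1\<^sup>2"
      using sq zero_le_power2[of "cmod (beta g)"] unfolding one_power2 by linarith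
  qed simp
  have c: "cos r = cmod (alpha g)"
    unfolding r_def using le by (intro cos_arccos) (auto intro: order_trans[OF _ norm_ge_zero])
  have s: "sin r = cmod (beta g)"
  proof -
    have "sin r = sqrt (1 - (cmod (alpha g))\<^sup>2)"
      unfolding r_def using le by (intro sin_arccos) (auto intro: order_trans[OF _ norm_ge_zero])
    also have "1 - (cmod (alpha g))\<^sup>2 = (cmod (beta g))\<^sup>2" using sq by simp
    finally show ?thesis by simp
  qed
  show thesis
  proof
    show "r \<in> {0..pi/2}"
      unfolding r_def using le arccos_le_pi2[of "cmod (alpha g)"]
      by (auto intro!: arccos_lbound order_trans[OF _ norm_ge_zero])
    show "\<theta> \<in> {0..2*pi}" unfolding \<theta>_def using Arg2pi_ge_0 Arg2pi_lt_2pi by (auto intro: less_imp_le)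
    show "z \<in> {-pi..pi}" unfolding z_def using mpi_less_Arg Arg_le_pi by (auto intro: less_imp_le)
    show "g = cyl r \<theta> z" by (rule su2_eqI) (simp_all add: alpha_cyl beta_cyl c s flip: az be)
  qed
qed

section \<open>Polynomial functions and the sublaplacian\<close>

text \<open>\<open>f'\<close> is the derivative of \<open>f\<close> along the left-invariant field of \<open>A\<close>. Complex values are used
  because the entries \<open>alpha\<close> and \<open>beta\<close> are eigenvectors of the torus action and real parts
  would destroy this structure.\<close>

definition has_lie :: "complex^2^2 \<Rightarrow> (su2 \<Rightarrow> complex) \<Rightarrow> (su2 \<Rightarrow> complex) \<Rightarrow> bool" where
  "has_lie A f f' \<longleftrightarrow>
     (\<forall>g. ((\<lambda>s. f (g * su2_exp (s *\<^sub>R A))) has_vector_derivative f' g) (at 0))"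

lemma su2_exp_0: "su2_exp (0 *\<^sub>R A) = 1"
  using su2_exp_unit[of 0 1 0] by (intro su2_eqI) simp_all

lemma has_lie_const: "has_lie A (\<lambda>_. c) (\<lambda>_. 0)"
  by (simp add: has_lie_def)

lemma has_lie_add:
  "has_lie A f f' \<Longrightarrow> has_lie A h h' \<Longrightarrow> has_lie A (\<lambda>g. f g + h g) (\<lambda>g. f' g + h' g)"
  unfolding has_lie_def by (auto intro: has_vector_derivative_add)

lemma has_lie_mult:
  assumes "has_lie A f f'" "has_lie A h h'"
  shows "has_lie A (\<lambda>g. f g * h g) (\<lambda>g. f g * h' g + f' g * h g)"
  unfolding has_lie_def
proof
  fix g
  have "((\<lambda>s. f (g * su2_exp (s *\<^sub>R A)) * h (g * su2_exp (s *\<^sub>R A))) has_vector_derivative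
     f (g * su2_exp (0 *\<^sub>R A)) * h' g + f' g * h (g * su2_exp (0 *\<^sub>R A))) (at 0)"
    using assms unfolding has_lie_def by (intro has_vector_derivative_mult) blast+
  then show "((\<lambda>s. f (g * su2_exp (s *\<^sub>R A)) * h (g * su2_exp (s *\<^sub>R A))) has_vector_derivative
     f g * h' g + f' g * h g) (at 0)"
    by (simp only: su2_exp_0 mult_1_right)
qed

lemma has_lie_cnj: "has_lie A f f' \<Longrightarrow> has_lie A (\<lambda>g. cnj (f g)) (\<lambda>g. cnj (f' g))"
  unfolding has_lie_def
  by (auto intro: bounded_linear.has_vector_derivative[OF bounded_linear_cnj])

lemma has_lie_row:
  assumes "a * cnj a + b * cnj b = 1" "a = - cnj a"
  shows "has_lie (row_matrix a b) alpha (\<lambda>g. a * alpha g + - cnj b * beta g)"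
    and "has_lie (row_matrix a b) beta (\<lambda>g. b * alpha g + cnj a * beta g)"
proof -
  have d: "((\<lambda>s. c * of_real (cos s) + d * of_real (sin s)) has_vector_derivative d) (at 0)"
    for c d :: complex
    by (rule derivative_eq_intros refl | simp)+
  have "alpha (g * su2_exp (s *\<^sub>R row_matrix a b))
      = alpha g * of_real (cos s) + (a * alpha g + - cnj b * beta g) * of_real (sin s)"
    "beta (g * su2_exp (s *\<^sub>R row_matrix a b))
      = beta g * of_real (cos s) + (b * alpha g + cnj a * beta g) * of_real (sin s)" for g s
    unfolding alpha_mult beta_mult su2_exp_unit[OF assms]
    by (simp_all add: algebra_simps)
  then show "has_lie (row_matrix a b) alpha (\<lambda>g. a * alpha g + - cnj b * beta g)"
    "has_lie (row_matrix a b) beta (\<lambda>g. b * alpha g + cnj a * beta g)"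
    unfolding has_lie_def by (simp_all only: d simp_thms)
qed

text \<open>The generators enter only as left factors. Induction over this set then meets a
  monomial times a polynomial, so linear functionals can be computed on all of it from their values
  on monomials, and closure under products becomes a lemma.\<close>

inductive_set su2_poly :: "(su2 \<Rightarrow> complex) set" where
  const: "(\<lambda>_. c) \<in> su2_poly"
| add: "f \<in> su2_poly \<Longrightarrow> h \<in> su2_poly \<Longrightarrow> (\<lambda>g. f g + h g) \<in> su2_poly"
| gen: "u \<in> {alpha, beta, cnj \<circ> alpha, cnj \<circ> beta} \<Longrightarrow> f \<in> su2_poly \<Longrightarrow> (\<lambda>g. u g * f g) \<in> su2_poly"

lemma su2_poly_mult: "f \<in> su2_poly \<Longrightarrow> h \<in> su2_poly \<Longrightarrow> (\<lambda>g. f g * h g) \<in> su2_poly"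
proof (induction rule: su2_poly.induct)
  case (const c)
  from const show ?case
  proof (induction rule: su2_poly.induct)
    case (add f h)
    then show ?case by (simp add: distrib_left su2_poly.add)
  next
    case (gen u f)
    from su2_poly.gen[OF gen(1,3)] show ?case by (simp add: mult.left_commute)
  qed (rule su2_poly.const)
next
  case (add f h)
  then show ?case by (simp add: distrib_right su2_poly.add)
next
  case (gen u f)
  then show ?case by (simp add: mult.assoc su2_poly.gen)
qed

lemma su2_poly_gen:
  "alpha \<in> su2_poly" "beta \<in> su2_poly" "(\<lambda>g. cnj (alpha g)) \<in> su2_poly" "(\<lambda>g. cnj (beta g)) \<in> su2_poly"
  using su2_poly.gen[OF _ su2_poly.const[of 1], of alpha] su2_poly.gen[OF _ su2_poly.const[of 1], of beta]
    su2_poly.gen[OF _ su2_poly.const[of 1], of "cnj \<circ> alpha"]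
    su2_poly.gen[OF _ su2_poly.const[of 1], of "cnj \<circ> beta"]
  by (simp_all add: o_def)

lemma su2_poly_cnj: "f \<in> su2_poly \<Longrightarrow> (\<lambda>g. cnj (f g)) \<in> su2_poly"
proof (induction rule: su2_poly.induct)
  case (const c)
  then show ?case by (rule su2_poly.const)
next
  case (add f h)
  then show ?case by (simp add: su2_poly.add)
next
  case (gen u f)
  then have "(\<lambda>g. cnj (u g)) \<in> su2_poly" by (auto simp: su2_poly_gen)
  with gen show ?case by (simp add: su2_poly_mult)
qed

lemma su2_poly_power: "f \<in> su2_poly \<Longrightarrow> (\<lambda>g. f g ^ n) \<in> su2_poly"
  by (induction n) (simp_all add: su2_poly.const su2_poly_mult)

lemma su2_poly_continuous: "f \<in> su2_poly \<Longrightarrow> continuous_on UNIV f"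
proof (induction rule: su2_poly.induct)
  case (gen u f)
  then have "continuous_on UNIV u"
    by (auto simp: o_def intro!: continuous_on_cnj continuous_on_alpha continuous_on_beta)
  with gen show ?case by (intro continuous_on_mult)
qed (auto intro: continuous_intros)

lemma su2_poly_lie:
  assumes A: "A \<in> {mX, mY, mZ}" and "f \<in> su2_poly"
  shows "\<exists>f'\<in>su2_poly. has_lie A f f'"
  using assms(2)
proof (induction rule: su2_poly.induct)
  case (const c)
  then show ?case using has_lie_const su2_poly.const by blast
next
  case (add f h)
  then show ?case using has_lie_add su2_poly.add by meson
next
  case (gen u f)
  obtain a b where ab: "A = row_matrix a b" "a * cnj a + b * cnj b = 1" "a = - cnj a"
    using A mX_row mY_row mZ_row by fastforce
  note comb = su2_poly.add[OF su2_poly_mult[OF su2_poly.const] su2_poly_mult[OF su2_poly.const]]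
  obtain a' b' where "a' \<in> su2_poly" "has_lie A alpha a'" "b' \<in> su2_poly" "has_lie A beta b'"
    using has_lie_row[OF ab(2,3)] comb[OF su2_poly_gen(1,2)] unfolding ab(1) by blast
  then have "\<exists>u'\<in>su2_poly. has_lie A alpha u'" "\<exists>u'\<in>su2_poly. has_lie A beta u'"
    "\<exists>u'\<in>su2_poly. has_lie A (cnj \<circ> alpha) u'" "\<exists>u'\<in>su2_poly. has_lie A (cnj \<circ> beta) u'"
    unfolding o_def using has_lie_cnj su2_poly_cnj by metis+
  then obtain u' where u': "u' \<in> su2_poly" "has_lie A u u'"
    using gen(1) by blast
  have "u \<in> su2_poly" using gen(1) su2_poly_gen by (auto simp: o_def)
  moreover obtain f' where f': "f' \<in> su2_poly" "has_lie A f f'"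
    using gen by blast
  ultimately show ?case
    using u' gen(2)
    by (intro bexI[of "has_lie A _", OF has_lie_mult[OF u'(2) f'(2)]] su2_poly.add su2_poly_mult)
qed

lemma has_lie_Re:
  assumes "has_lie A f f'"
  shows "((\<lambda>s. Re (f (g * su2_exp (s *\<^sub>R A)))) has_real_derivative Re (f' g)) (at 0)"
  using assms unfolding has_lie_def has_real_derivative_iff_has_vector_derivative
  by (auto intro: bounded_linear.has_vector_derivative[OF bounded_linear_Re])

lemma lie_deriv_Re: "has_lie A f f' \<Longrightarrow> lie_deriv A (\<lambda>g. Re (f g)) = (\<lambda>g. Re (f' g))"
  unfolding lie_deriv_def by (rule ext) (intro DERIV_imp_deriv has_lie_Re)

text \<open>All iterated Lie derivatives of a polynomial are polynomials, hence exist and are continuous.\<close>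

lemma su2_poly_smooth:
  assumes "f \<in> su2_poly"
  shows "su2_smooth (\<lambda>g. Re (f g))"
  unfolding su2_smooth_def
proof
  fix k
  show "su2_Ck k (\<lambda>g. Re (f g))"
    using assms
  proof (induction k arbitrary: f)
    case 0
    then show ?case by (auto intro!: continuous_intros su2_poly_continuous)
  next
    case (Suc k)
    have "(\<forall>g. (\<lambda>s. Re (f (g * su2_exp (s *\<^sub>R A)))) differentiable at 0) \<and>
        su2_Ck k (lie_deriv A (\<lambda>g. Re (f g)))" if A: "A \<in> {mX, mY, mZ}" for A
    proof -
      obtain f' where f': "f' \<in> su2_poly" "has_lie A f f'"
        using su2_poly_lie[OF A Suc.prems] by blast
      show ?thesis
        unfolding lie_deriv_Re[OF f'(2)]
        using Suc.IH[OF f'(1)] has_lie_Re[OF f'(2)] real_differentiable_def by blast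
    qed
    then show ?case
      using Suc.prems by (auto intro!: continuous_intros su2_poly_continuous)
  qed
qed

text \<open>Carrying the first derivatives \<open>fx\<close>, \<open>fy\<close> along with \<open>l = X\<^sup>2 f + Y\<^sup>2 f\<close> makes the
  predicate stable under products: the mixed term of the Leibniz rule for \<open>X\<^sup>2 + Y\<^sup>2\<close> needs them.\<close>

definition has_sublaplacian ::
  "(su2 \<Rightarrow> complex) \<Rightarrow> (su2 \<Rightarrow> complex) \<Rightarrow> (su2 \<Rightarrow> complex) \<Rightarrow> (su2 \<Rightarrow> complex) \<Rightarrow> bool" where
  "has_sublaplacian f fx fy l \<longleftrightarrow> has_lie mX f fx \<and> has_lie mY f fy \<and>
     (\<exists>fxx fyy. has_lie mX fx fxx \<and> has_lie mY fy fyy \<and> l = (\<lambda>g. fxx g + fyy g))"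

lemma sublaplacian_Re:
  assumes "has_sublaplacian f fx fy l"
  shows "sublaplacian (\<lambda>g. Re (f g)) = (\<lambda>g. Re (l g))"
  using assms unfolding has_sublaplacian_def sublaplacian_def by (auto simp: lie_deriv_Re)

lemma has_sublaplacian_mult:
  assumes "has_sublaplacian u ux uy lu" "has_sublaplacian v vx vy lv"
  shows "has_sublaplacian (\<lambda>g. u g * v g) (\<lambda>g. u g * vx g + ux g * v g) (\<lambda>g. u g * vy g + uy g * v g)
    (\<lambda>g. lu g * v g + u g * lv g + 2 * (ux g * vx g + uy g * vy g))"
proof -
  obtain uxx uyy vxx vyy where 1: "has_lie mX u ux" "has_lie mX v vx" "has_lie mY u uy" "has_lie mY v vy"
     "has_lie mX ux uxx" "has_lie mX vx vxx" "has_lie mY uy uyy" "has_lie mY vy vyy"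
     "lu = (\<lambda>g. uxx g + uyy g)" "lv = (\<lambda>g. vxx g + vyy g)"
    using assms unfolding has_sublaplacian_def by blast
  show ?thesis
    unfolding has_sublaplacian_def
  proof (intro conjI exI)
    show "has_lie mX (\<lambda>g. u g * vx g + ux g * v g)
        (\<lambda>g. (u g * vxx g + ux g * vx g) + (ux g * vx g + uxx g * v g))"
      "has_lie mY (\<lambda>g. u g * vy g + uy g * v g)
        (\<lambda>g. (u g * vyy g + uy g * vy g) + (uy g * vy g + uyy g * v g))"
      by (intro has_lie_add has_lie_mult 1)+
  qed (auto simp: 1 algebra_simps intro!: has_lie_mult)
qed

lemma has_sublaplacian_cnj:
  assumes "has_sublaplacian f fx fy l"
  shows "has_sublaplacian (\<lambda>g. cnj (f g)) (\<lambda>g. cnj (fx g)) (\<lambda>g. cnj (fy g)) (\<lambda>g. cnj (l g))"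
  using assms unfolding has_sublaplacian_def by (fastforce intro: has_lie_cnj)

lemma has_sublaplacian_cong:
  "has_sublaplacian f fx fy l \<Longrightarrow> (\<And>g. f g = f' g) \<Longrightarrow> (\<And>g. fx g = fx' g) \<Longrightarrow> (\<And>g. fy g = fy' g) \<Longrightarrow>
    (\<And>g. l g = l' g) \<Longrightarrow> has_sublaplacian f' fx' fy' l'"
  by (metis ext)

lemma has_lie_mX_mY:
  "has_lie mX alpha (\<lambda>g. - beta g)" "has_lie mX beta alpha"
  "has_lie mY alpha (\<lambda>g. \<i> * beta g)" "has_lie mY beta (\<lambda>g. \<i> * alpha g)"
  using has_lie_row[of 0 1] has_lie_row[of 0 \<i>] by (simp_all add: mX_row mY_row)

lemma has_lie_cmult: "has_lie A f f' \<Longrightarrow> has_lie A (\<lambda>g. c * f g) (\<lambda>g. c * f' g)"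
  using has_lie_mult[OF has_lie_const] by fastforce

lemma has_sublaplacian_alpha: "has_sublaplacian alpha (\<lambda>g. - beta g) (\<lambda>g. \<i> * beta g) (\<lambda>g. - 2 * alpha g)"
  unfolding has_sublaplacian_def
  using has_lie_mX_mY has_lie_cmult[OF has_lie_mX_mY(4), of \<i>] has_lie_cmult[OF has_lie_mX_mY(2), of "-1"]
  by (intro conjI exI[of _ "\<lambda>g. - alpha g"]) (auto simp: mult.assoc[symmetric])

lemma has_sublaplacian_beta: "has_sublaplacian beta alpha (\<lambda>g. \<i> * alpha g) (\<lambda>g. - 2 * beta g)"
  unfolding has_sublaplacian_def
  using has_lie_mX_mY has_lie_cmult[OF has_lie_mX_mY(3), of \<i>]
  by (intro conjI exI[of _ "\<lambda>g. - beta g"]) (auto simp: mult.assoc[symmetric])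

lemma has_sublaplacian_const: "has_sublaplacian (\<lambda>_. c) (\<lambda>_. 0) (\<lambda>_. 0) (\<lambda>_. 0)"
  unfolding has_sublaplacian_def using has_lie_const by fastforce

text \<open>When the horizontal gradient of \<open>f\<close> is a null vector of the complex bilinear form, the second
  order term of the chain rule disappears and \<open>X\<^sup>2 + Y\<^sup>2\<close> acts on powers of \<open>f\<close> as a derivation.
  Both \<open>alpha\<close> and \<open>beta\<close> have this property.\<close>

lemma has_sublaplacian_power:
  assumes f: "has_sublaplacian f fx fy l" and null: "\<And>g. fx g * fx g + fy g * fy g = 0"
  shows "has_sublaplacian (\<lambda>g. f g ^ n) (\<lambda>g. of_nat n * f g ^ (n - 1) * fx g)
     (\<lambda>g. of_nat n * f g ^ (n - 1) * fy g) (\<lambda>g. of_nat n * f g ^ (n - 1) * l g)"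
proof (induction n)
  case 0
  show ?case by (rule has_sublaplacian_cong[OF has_sublaplacian_const[of 1]]) simp_all
next
  case (Suc n)
  have s: "f g * (of_nat n * f g ^ (n - 1)) = of_nat n * f g ^ n" for g
    by (cases n) simp_all
  have r: "a * (N * b * x) + x * p = (1 + N) * p * x" if "a * (N * b) = N * p" for a b p x N :: complex
    using that by algebra
  show ?case
  proof (rule has_sublaplacian_cong[OF has_sublaplacian_mult[OF f Suc]])
    fix g
    show "f g * f g ^ n = f g ^ Suc n" by simp
    show "f g * (of_nat n * f g ^ (n - 1) * fx g) + fx g * f g ^ n = of_nat (Suc n) * f g ^ (Suc n - 1) * fx g"
      "f g * (of_nat n * f g ^ (n - 1) * fy g) + fy g * f g ^ n = of_nat (Suc n) * f g ^ (Suc n - 1) * fy g"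
      using r[OF s] by simp_all
    have "l g * f g ^ n + f g * (of_nat n * f g ^ (n - 1) * l g) +
         2 * (fx g * (of_nat n * f g ^ (n - 1) * fx g) + fy g * (of_nat n * f g ^ (n - 1) * fy g))
       = l g * f g ^ n + (f g * (of_nat n * f g ^ (n - 1))) * l g
         + 2 * (of_nat n * f g ^ (n - 1)) * (fx g * fx g + fy g * fy g)"
      by (simp add: algebra_simps)
    then show "l g * f g ^ n + f g * (of_nat n * f g ^ (n - 1) * l g) +
         2 * (fx g * (of_nat n * f g ^ (n - 1) * fx g) + fy g * (of_nat n * f g ^ (n - 1) * fy g))
       = of_nat (Suc n) * f g ^ (Suc n - 1) * l g"
      unfolding s null by (simp add: algebra_simps)
  qed
qed

definition su2_monomial :: "nat \<Rightarrow> nat \<Rightarrow> nat \<Rightarrow> su2 \<Rightarrow> complex" where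
  "su2_monomial w i j g = beta g ^ w * alpha g ^ i * cnj (alpha g) ^ j"

lemma su2_monomial_poly: "su2_monomial w i j \<in> su2_poly"
  unfolding su2_monomial_def by (intro su2_poly_mult su2_poly_power su2_poly_gen)

text \<open>The operator is triangular on these monomials: besides a multiple of the monomial itself
  only the one with \<open>i\<close> and \<open>j\<close> lowered occurs. It comes from the mixed term of \<open>alpha ^ i\<close>
  and \<open>cnj alpha ^ j\<close>, which contains \<open>beta * cnj beta = 1 - alpha * cnj alpha\<close>.\<close>

lemma sublaplacian_monomial:
  "sublaplacian (\<lambda>g. Re (c * su2_monomial w i j g)) =
    (\<lambda>g. - (2 * w + 2 * (i + j) + 4 * i * j + 4 * w * i) * Re (c * su2_monomial w i j g)
       + 4 * i * j * Re (c * su2_monomial w (i - 1) (j - 1) g))"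
proof -
  have b: "has_sublaplacian (\<lambda>g. beta g ^ w) (\<lambda>g. of_nat w * beta g ^ (w - 1) * alpha g)
      (\<lambda>g. of_nat w * beta g ^ (w - 1) * (\<i> * alpha g)) (\<lambda>g. of_nat w * beta g ^ (w - 1) * (- 2 * beta g))"
    by (rule has_sublaplacian_power[OF has_sublaplacian_beta]) (simp add: algebra_simps)
  have a: "has_sublaplacian (\<lambda>g. alpha g ^ i) (\<lambda>g. of_nat i * alpha g ^ (i - 1) * - beta g)
      (\<lambda>g. of_nat i * alpha g ^ (i - 1) * (\<i> * beta g)) (\<lambda>g. of_nat i * alpha g ^ (i - 1) * (- 2 * alpha g))" for i
    by (rule has_sublaplacian_power[OF has_sublaplacian_alpha]) (simp add: algebra_simps)
  note L = sublaplacian_Re[OF has_sublaplacian_mult[OF has_sublaplacian_const[of c]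
      has_sublaplacian_mult[OF has_sublaplacian_mult[OF b a[of i]] has_sublaplacian_cnj[OF a[of j]]]]]
  have p: "of_nat n * x ^ (n - 1) * x = of_nat n * x ^ n" for n and x :: complex
    by (cases n) simp_all
  let ?l = "- of_nat (2 * w + 2 * (i + j) + 4 * i * j + 4 * w * i) :: complex"
  have "c * (((of_nat w * b ^ (w - 1) * (- 2 * b)) * a ^ i + b ^ w * (of_nat i * a ^ (i - 1) * (- 2 * a))
       + 2 * ((of_nat w * b ^ (w - 1) * a) * (of_nat i * a ^ (i - 1) * - b)
         + (of_nat w * b ^ (w - 1) * (\<i> * a)) * (of_nat i * a ^ (i - 1) * (\<i> * b)))) * a' ^ j
       + (b ^ w * a ^ i) * (of_nat j * a' ^ (j - 1) * (- 2 * a'))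
       + 2 * ((b ^ w * (of_nat i * a ^ (i - 1) * - b) + (of_nat w * b ^ (w - 1) * a) * a ^ i)
             * (of_nat j * a' ^ (j - 1) * - b')
          + (b ^ w * (of_nat i * a ^ (i - 1) * (\<i> * b)) + (of_nat w * b ^ (w - 1) * (\<i> * a)) * a ^ i)
             * (of_nat j * a' ^ (j - 1) * (- \<i> * b'))))
     = ?l * (c * (b ^ w * a ^ i * a' ^ j)) + of_nat (4 * i * j) * (c * (b ^ w * a ^ (i - 1) * a' ^ (j - 1)))"
    if n: "a * a' + b * b' = 1" for a a' b b'
  proof -
    \<comment> \<open>These satisfy \<open>W * b = w * b ^ w\<close> also for \<open>w = 0\<close>, where \<open>w - 1 = 0\<close>.\<close>
    define W I J where "W = of_nat w * b ^ (w - 1)" and "I = of_nat i * a ^ (i - 1)"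
      and "J = of_nat j * a' ^ (j - 1)"
    have e: "W * b = of_nat w * b ^ w" "I * a = of_nat i * a ^ i" "J * a' = of_nat j * a' ^ j"
      unfolding W_def I_def J_def by (rule p)+
    have l: "?l = - (2 * of_nat w + 2 * (of_nat i + of_nat j) + 4 * of_nat i * of_nat j + 4 * of_nat w * of_nat i)"
      by simp
    have r: "of_nat (4 * i * j) * (c * (b ^ w * a ^ (i - 1) * a' ^ (j - 1))) = 4 * c * b ^ w * I * J"
      by (simp add: I_def J_def)
    have ii: "\<i> * \<i> = -1" by simp
    have "c * ((W * (- 2 * b) * P + B * (I * (- 2 * a)) + 2 * (W * a * (I * - b) + W * (\<i> * a) * (I * (\<i> * b)))) * Q
        + B * P * (J * (- 2 * a'))
        + 2 * ((B * (I * - b) + W * a * P) * (J * - b') + (B * (I * (\<i> * b)) + W * (\<i> * a) * P) * (J * (- \<i> * b'))))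
      = - (2 * w' + 2 * (i' + j') + 4 * i' * j' + 4 * w' * i') * (c * (B * P * Q)) + 4 * c * B * I * J"
      if "W * b = w' * B" "I * a = i' * P" "J * a' = j' * Q" for B P Q w' i' j'
      using that n ii by algebra
    then show ?thesis
      unfolding r l W_def[symmetric] I_def[symmetric] J_def[symmetric] using e by blast
  qed
  from this[OF row_norm] have "Re (c * (((of_nat w * beta g ^ (w - 1) * (- 2 * beta g)) * alpha g ^ i + beta g ^ w * (of_nat i * alpha g ^ (i - 1) * (- 2 * alpha g))
       + 2 * ((of_nat w * beta g ^ (w - 1) * alpha g) * (of_nat i * alpha g ^ (i - 1) * - beta g)
         + (of_nat w * beta g ^ (w - 1) * (\<i> * alpha g)) * (of_nat i * alpha g ^ (i - 1) * (\<i> * beta g)))) * cnj (alpha g) ^ j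
       + (beta g ^ w * alpha g ^ i) * (of_nat j * cnj (alpha g) ^ (j - 1) * (- 2 * cnj (alpha g)))
       + 2 * ((beta g ^ w * (of_nat i * alpha g ^ (i - 1) * - beta g) + (of_nat w * beta g ^ (w - 1) * alpha g) * alpha g ^ i)
             * (of_nat j * cnj (alpha g) ^ (j - 1) * - cnj (beta g))
          + (beta g ^ w * (of_nat i * alpha g ^ (i - 1) * (\<i> * beta g)) + (of_nat w * beta g ^ (w - 1) * (\<i> * alpha g)) * alpha g ^ i)
             * (of_nat j * cnj (alpha g) ^ (j - 1) * (- \<i> * cnj (beta g))))))
     = - (2 * w + 2 * (i + j) + 4 * i * j + 4 * w * i) * Re (c * su2_monomial w i j g)
       + 4 * i * j * Re (c * su2_monomial w (i - 1) (j - 1) g)" for g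
    unfolding su2_monomial_def of_nat_id minus_complex.simps
    by (simp flip: of_nat_mult of_nat_add)
  with L show ?thesis
    by (simp add: su2_monomial_def mult.assoc)
qed

section \<open>Monomials under the heat semigroup\<close>

text \<open>For a generator only the limit of difference quotients from the right is available, so the
  usual uniqueness theorems for differential equations have to be based on right derivatives. If
  the values differ at \<open>t\<close>, they leave some cone \<open>\<bar>E s - E 0\<bar> \<le> e * s\<close>; at the infimum of the
  times outside the cone the right derivative would be too large.\<close>

lemma right_derivative_zero_constant:
  fixes E :: "real \<Rightarrow> real"
  assumes cont: "continuous_on {0..} E"
    and lim: "\<And>t. 0 \<le> t \<Longrightarrow> ((\<lambda>h. (E (t + h) - E t) / h) \<longlongrightarrow> 0) (at_right 0)"
    and t: "0 \<le> t"
  shows "E t = E 0"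
proof (rule ccontr)
  assume ne: "E t \<noteq> E 0"
  with t have "0 < t" by (metis less_eq_real_def)
  define e where "e = \<bar>E t - E 0\<bar> / (2 * t)"
  have e: "0 < e" using ne \<open>0 < t\<close> by (simp add: e_def)
  define B where "B = {s \<in> {0..t}. e * s < \<bar>E s - E 0\<bar>}"
  define c where "c = Inf B"
  have tB: "t \<in> B" using ne \<open>0 < t\<close> by (simp add: B_def e_def)
  have bdd: "bdd_below B" unfolding B_def by (rule bdd_belowI[of _ 0]) simp
  have c0: "0 \<le> c" unfolding c_def using tB by (intro cInf_greatest) (auto simp: B_def)
  have ct: "c \<le> t" unfolding c_def by (rule cInf_lower[OF tB bdd])
  have below: "\<bar>E s - E 0\<bar> \<le> e * s" if "0 \<le> s" "s < c" for s
  proof (rule ccontr)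
    assume "\<not> ?thesis"
    then have "s \<in> B" using that ct by (simp add: B_def)
    from cInf_lower[OF this bdd] show False using that by (simp add: c_def)
  qed
  have atc: "\<bar>E c - E 0\<bar> \<le> e * c"
  proof (cases "c = 0")
    case False
    then have "0 < c" using c0 by simp
    have "(E \<longlongrightarrow> E c) (at c within {0..})"
      using cont c0 by (simp add: continuous_on_def)
    then have "(E \<longlongrightarrow> E c) (at c within {0..<c})"
      by (rule tendsto_within_subset) auto
    then have "((\<lambda>s. \<bar>E s - E 0\<bar>) \<longlongrightarrow> \<bar>E c - E 0\<bar>) (at c within {0..<c})"
      by (intro tendsto_intros)
    moreover have "((\<lambda>s. e * s) \<longlongrightarrow> e * c) (at c within {0..<c})"
      by (intro tendsto_intros)
    moreover have "at c within {0..<c} \<noteq> bot"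
      using \<open>0 < c\<close> by (simp add: trivial_limit_within islimpt_Ico)
    moreover have "\<forall>\<^sub>F s in at c within {0..<c}. \<bar>E s - E 0\<bar> \<le> e * s"
      using below by (auto simp: eventually_at_filter)
    ultimately show ?thesis by (intro tendsto_le)
  qed simp
  have "\<forall>\<^sub>F h in at_right 0. \<bar>(E (c + h) - E c) / h\<bar> < e"
    using lim[OF c0] e by (auto simp: tendsto_iff dist_real_def)
  then obtain d where d: "0 < d" "\<And>h. 0 < h \<Longrightarrow> h < d \<Longrightarrow> \<bar>(E (c + h) - E c) / h\<bar> < e"
    unfolding eventually_at_right_field by auto
  have "c + d \<le> s" if s: "s \<in> B" for s
  proof (rule ccontr)
    assume "\<not> ?thesis"
    moreover have "c \<le> s" unfolding c_def by (rule cInf_lower[OF s bdd])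
    moreover have "s \<noteq> c" using s atc by (auto simp: B_def)
    ultimately have h: "0 < s - c" "s - c < d" by auto
    have "\<bar>E s - E c\<bar> < e * (s - c)"
      using d(2)[OF h] h by (simp add: abs_divide pos_divide_less_eq)
    then have "\<bar>E s - E 0\<bar> \<le> e * s" using atc by (simp add: algebra_simps)
    then show False using s by (simp add: B_def)
  qed
  then have "c + d \<le> c" unfolding c_def using tB by (intro cInf_greatest) auto
  then show False using d by simp
qed

lemma right_derivative_linear_zero:
  fixes D :: "real \<Rightarrow> real"
  assumes cont: "continuous_on {0..} D"
    and lim: "\<And>t. 0 \<le> t \<Longrightarrow> ((\<lambda>h. (D (t + h) - D t) / h) \<longlongrightarrow> \<kappa> * D t) (at_right 0)"
    and "D 0 = 0" "0 \<le> t"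
  shows "D t = 0"
proof -
  define E where "E s = exp (- \<kappa> * s) * D s" for s
  have "((\<lambda>h. (E (s + h) - E s) / h) \<longlongrightarrow> 0) (at_right 0)" if "0 \<le> s" for s
  proof -
    have "((\<lambda>x. exp (- \<kappa> * x)) has_real_derivative - \<kappa>) (at 0)"
      by (auto intro!: derivative_eq_intros)
    then have "((\<lambda>h. (exp (- \<kappa> * h) - 1) / h) \<longlongrightarrow> - \<kappa>) (at 0)"
      unfolding DERIV_def by simp
    then have "((\<lambda>h. (exp (- \<kappa> * h) - 1) / h) \<longlongrightarrow> - \<kappa>) (at_right 0)"
      by (rule tendsto_within_subset) simp
    moreover have "((\<lambda>h. exp (- \<kappa> * h)) \<longlongrightarrow> exp (- \<kappa> * 0)) (at_right 0)"
      by (intro tendsto_intros)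
    ultimately have "((\<lambda>h. exp (- \<kappa> * s) * (exp (- \<kappa> * h) * ((D (s + h) - D s) / h)
        + D s * ((exp (- \<kappa> * h) - 1) / h))) \<longlongrightarrow>
        exp (- \<kappa> * s) * (exp (- \<kappa> * 0) * (\<kappa> * D s) + D s * - \<kappa>)) (at_right 0)"
      by (intro tendsto_intros lim that)
    then have "((\<lambda>h. exp (- \<kappa> * s) * (exp (- \<kappa> * h) * ((D (s + h) - D s) / h)
        + D s * ((exp (- \<kappa> * h) - 1) / h))) \<longlongrightarrow> 0) (at_right 0)"
      by simp
    moreover have "\<forall>\<^sub>F h in at_right 0. exp (- \<kappa> * s) * (exp (- \<kappa> * h) * ((D (s + h) - D s) / h)
        + D s * ((exp (- \<kappa> * h) - 1) / h)) = (E (s + h) - E s) / h"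
      by (auto simp: eventually_at_filter E_def field_simps exp_add[symmetric] exp_diff)
    ultimately show ?thesis by (rule Lim_transform_eventually)
  qed
  moreover have "continuous_on {0..} E"
    unfolding E_def by (intro continuous_intros cont)
  ultimately have "E t = E 0"
    using \<open>0 \<le> t\<close> by (intro right_derivative_zero_constant)
  then show ?thesis using \<open>D 0 = 0\<close> by (simp add: E_def)
qed

lemma continuous_bcontfun_su2:
  fixes F :: "su2 \<Rightarrow> real"
  assumes "continuous_on UNIV F"
  shows "F \<in> bcontfun"
proof -
  have "bounded (range F)"
    using compact_continuous_image[OF assms compact_su2] by (rule compact_imp_bounded)
  with assms show ?thesis by (simp add: bcontfun_def)
qed

text \<open>The integral of \<open>F\<close> against the kernel of \<open>P t\<close> at the identity, available without
  reference to such a kernel.\<close>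

definition heat_mean :: "(real \<Rightarrow> (su2 \<Rightarrow>\<^sub>C real) \<Rightarrow>\<^sub>L (su2 \<Rightarrow>\<^sub>C real)) \<Rightarrow> (su2 \<Rightarrow> real) \<Rightarrow> real \<Rightarrow> real" where
  "heat_mean P F t = apply_bcontfun (blinfun_apply (P t) (Bcontfun F)) 1"

lemma bounded_linear_eval: "bounded_linear (\<lambda>f :: su2 \<Rightarrow>\<^sub>C real. apply_bcontfun f x)"
  by (rule bounded_linear_intro[where K = 1]) (simp_all add: norm_bounded[where 'b = real, unfolded real_norm_def])

lemma heat_mean_linear:
  assumes "continuous_on UNIV F" "continuous_on UNIV H"
  shows "heat_mean P (\<lambda>g. x * F g + y * H g) t = x * heat_mean P F t + y * heat_mean P H t"
proof -
  have "Bcontfun (\<lambda>g. x * F g + y * H g) = x *\<^sub>R Bcontfun F + y *\<^sub>R Bcontfun H"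
    using assms
    by (intro bcontfun_eqI)
      (simp add: Bcontfun_inverse continuous_bcontfun_su2 continuous_intros)
  then show ?thesis
    by (simp add: heat_mean_def blinfun.add_right blinfun.scaleR_right)
qed

text \<open>The semigroup law reduces the right derivative at \<open>t\<close> to the one at \<open>0\<close>, which is the
  generator; evaluation at the identity and \<open>P t\<close> are bounded operators.\<close>

lemma heat_mean_evolution:
  assumes P: "is_heat_semigroup P" and F: "su2_smooth F" and L: "continuous_on UNIV (sublaplacian F)"
  shows "continuous_on {0..} (heat_mean P F)"
    and "heat_mean P F 0 = F 1"
    and "0 \<le> t \<Longrightarrow> ((\<lambda>h. (heat_mean P F (t + h) - heat_mean P F t) / h)
           \<longlongrightarrow> heat_mean P (sublaplacian F) t) (at_right 0)"
proof -
  have sg: "P 0 = id_blinfun" "\<And>s t. 0 \<le> s \<Longrightarrow> 0 \<le> t \<Longrightarrow> P (s + t) = P s o\<^sub>L P t"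
    "\<And>f. continuous_on {0..} (\<lambda>t. blinfun_apply (P t) f)"
    using P by (auto simp: is_heat_semigroup_def C0_semigroup_def)
  have cF: "continuous_on UNIV F"
    using F unfolding su2_smooth_def by (metis su2_Ck.simps(1))
  have bF: "apply_bcontfun (Bcontfun F) = F" and bL: "apply_bcontfun (Bcontfun (sublaplacian F)) = sublaplacian F"
    using cF L by (simp_all add: Bcontfun_inverse continuous_bcontfun_su2)
  show "continuous_on {0..} (heat_mean P F)"
    unfolding heat_mean_def
    by (intro bounded_linear.continuous_on[OF bounded_linear_eval] sg)
  show "heat_mean P F 0 = F 1"
    by (simp add: heat_mean_def sg bF)
  assume t: "0 \<le> t"
  have "(Bcontfun F, Bcontfun (sublaplacian F)) \<in> generator P"
    using P F bF bL unfolding is_heat_semigroup_def by (auto intro!: closure_subset[THEN subsetD])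
  then have "((\<lambda>h. (1 / h) *\<^sub>R (blinfun_apply (P h) (Bcontfun F) - Bcontfun F))
      \<longlongrightarrow> Bcontfun (sublaplacian F)) (at_right 0)"
    by (simp add: generator_def)
  then have "((\<lambda>h. apply_bcontfun (blinfun_apply (P t)
       ((1 / h) *\<^sub>R (blinfun_apply (P h) (Bcontfun F) - Bcontfun F))) 1)
      \<longlongrightarrow> heat_mean P (sublaplacian F) t) (at_right 0)"
    unfolding heat_mean_def
    by (intro bounded_linear.tendsto[OF bounded_linear_eval]
        bounded_linear.tendsto[OF blinfun.bounded_linear_right])
  moreover have "\<forall>\<^sub>F h in at_right 0. apply_bcontfun (blinfun_apply (P t)
       ((1 / h) *\<^sub>R (blinfun_apply (P h) (Bcontfun F) - Bcontfun F))) 1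
      = (heat_mean P F (t + h) - heat_mean P F t) / h"
    using sg(2)[OF t]
    by (auto simp: eventually_at_filter heat_mean_def blinfun.scaleR_right blinfun.diff_right)
  ultimately show "((\<lambda>h. (heat_mean P F (t + h) - heat_mean P F t) / h)
           \<longlongrightarrow> heat_mean P (sublaplacian F) t) (at_right 0)"
    by (rule Lim_transform_eventually)
qed

lemma continuous_Re_monomial: "continuous_on UNIV (\<lambda>g. Re (c * su2_monomial w i j g))"
  by (intro continuous_intros su2_poly_continuous su2_monomial_poly)

lemma smooth_Re_monomial: "su2_smooth (\<lambda>g. Re (c * su2_monomial w i j g))"
  by (intro su2_poly_smooth su2_poly_mult su2_poly.const su2_monomial_poly)

lemma continuous_sublaplacian_monomial:
  "continuous_on UNIV (sublaplacian (\<lambda>g. Re (c * su2_monomial w i j g)))"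
  unfolding sublaplacian_monomial by (intro continuous_intros su2_poly_continuous su2_monomial_poly)

lemma heat_mean_monomial_evolution:
  fixes c :: complex
  assumes P: "is_heat_semigroup P" and t: "0 \<le> t"
  defines "M \<equiv> \<lambda>w i j. heat_mean P (\<lambda>g. Re (c * su2_monomial w i j g))"
  shows "((\<lambda>h. (M w i j (t + h) - M w i j t) / h) \<longlongrightarrow>
     - (2 * w + 2 * (i + j) + 4 * i * j + 4 * w * i) * M w i j t + 4 * i * j * M w (i - 1) (j - 1) t)
    (at_right 0)"
  using heat_mean_evolution(3)[OF P smooth_Re_monomial continuous_sublaplacian_monomial t]
  unfolding M_def sublaplacian_monomial
  by (subst (asm) heat_mean_linear) (rule continuous_Re_monomial)+

lemma heat_mean_monomial_initial:
  assumes "is_heat_semigroup P"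
  shows "continuous_on {0..} (heat_mean P (\<lambda>g. Re (c * su2_monomial w i j g)))"
    and "heat_mean P (\<lambda>g. Re (c * su2_monomial w i j g)) 0 = (if w = 0 then Re c else 0)"
  using heat_mean_evolution(1,2)[OF assms smooth_Re_monomial continuous_sublaplacian_monomial, of c w i j]
  by (simp_all add: su2_monomial_def)

text \<open>The monomial vanishes at the identity because \<open>beta\<close> does, and by triangularity its mean
  solves a homogeneous linear equation once the lower monomials are known to have mean zero.\<close>

lemma heat_mean_monomial_off_diagonal:
  assumes P: "is_heat_semigroup P" and w: "w > 0" and t: "0 \<le> t"
  shows "heat_mean P (\<lambda>g. Re (c * su2_monomial w i j g)) t = 0"
  using t
proof (induction i arbitrary: j t)
  case 0
  have "((\<lambda>h. (heat_mean P (\<lambda>g. Re (c * su2_monomial w 0 j g)) (t + h)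
         - heat_mean P (\<lambda>g. Re (c * su2_monomial w 0 j g)) t) / h)
      \<longlongrightarrow> - (2 * w + 2 * j) * heat_mean P (\<lambda>g. Re (c * su2_monomial w 0 j g)) t) (at_right 0)"
    if "0 \<le> t" for t
    using heat_mean_monomial_evolution[OF P that, of c w 0 j] by simp
  note lim = this
  show ?case
  proof (rule right_derivative_linear_zero[OF heat_mean_monomial_initial(1)[OF P] lim _ 0])
    show "heat_mean P (\<lambda>g. Re (c * su2_monomial w 0 j g)) 0 = 0"
      unfolding heat_mean_monomial_initial(2)[OF P] using w by simp
  qed
next
  case (Suc i)
  have "((\<lambda>h. (heat_mean P (\<lambda>g. Re (c * su2_monomial w (Suc i) j g)) (t + h)
         - heat_mean P (\<lambda>g. Re (c * su2_monomial w (Suc i) j g)) t) / h)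
      \<longlongrightarrow> - (2 * real w + 2 * (real (Suc i) + real j) + 4 * real (Suc i) * real j + 4 * real w * real (Suc i))
          * heat_mean P (\<lambda>g. Re (c * su2_monomial w (Suc i) j g)) t) (at_right 0)" if "0 \<le> t" for t
    using heat_mean_monomial_evolution[OF P that, of c w "Suc i" j] Suc.IH[OF that, of "j - 1"]
    by (simp only: diff_Suc_1 mult_zero_right add_0_right)
  note lim = this
  show ?case
  proof (rule right_derivative_linear_zero[OF heat_mean_monomial_initial(1)[OF P] lim _ Suc.prems])
    show "heat_mean P (\<lambda>g. Re (c * su2_monomial w (Suc i) j g)) 0 = 0"
      unfolding heat_mean_monomial_initial(2)[OF P] using w by simp
  qed
qed

text \<open>Minus the eigenvalue of \<open>X\<^sup>2 + Y\<^sup>2\<close> on the matrix coefficient of weight \<open>n\<close> in the irreducible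
  representation of dimension \<open>2 * k + n + 1\<close>: the Casimir value \<open>(2 * k + n + 1)\<^sup>2 - 1\<close> minus
  the contribution \<open>n\<^sup>2\<close> of \<open>Z\<^sup>2\<close>.\<close>

definition decay_rate :: "nat \<Rightarrow> nat \<Rightarrow> real" where
  "decay_rate n k = 4 * k * (k + n + 1) + 2 * n"

text \<open>This turns out to be the integral of \<open>u ^ (n + l)\<close> over \<open>[0, 1]\<close> against the Jacobi
  polynomial of degree \<open>k\<close> for the weight \<open>u ^ n\<close>, normalized to the value \<open>1\<close> at \<open>u = 1\<close>.\<close>

definition moment :: "nat \<Rightarrow> nat \<Rightarrow> nat \<Rightarrow> real" where
  "moment n k l = (if k \<le> l then fact l * fact (n + l) / (fact (n + l + k + 1) * fact (l - k)) else 0)"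

text \<open>The integral of \<open>alpha ^ (n + l) * cnj alpha ^ l\<close> against the spectral expansion of the heat
  kernel. The sum is finite because Jacobi polynomials are orthogonal to lower degrees.\<close>

definition heat_moment :: "nat \<Rightarrow> nat \<Rightarrow> real \<Rightarrow> real" where
  "heat_moment n l t = (\<Sum>k\<le>l. real (2 * k + n + 1) * exp (- decay_rate n k * t) * moment n k l)"

lemma moment_step:
  "(decay_rate n (Suc l) - decay_rate n k) * moment n k (Suc l) = 4 * real (Suc l) * real (n + Suc l) * moment n k l"
proof (cases "k \<le> l")
  case True
  then obtain d where d: "l = k + d" using le_Suc_ex by blast
  have "decay_rate n (Suc l) - decay_rate n k = 4 * (real (1 + d) * real (n + l + k + 2))"
    by (simp add: decay_rate_def d algebra_simps)
  moreover have "moment n k (Suc l) * (real (1 + d) * real (n + l + k + 2)) = real (Suc l) * real (n + Suc l) * moment n k l"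
  proof -
    have f: "fact (n + Suc l + k + 1) = (n + l + k + 2) * (fact (n + l + k + 1) :: real)"
      "fact (Suc l - k) = (1 + d) * (fact (l - k) :: real)"
      "fact (Suc l) = Suc l * (fact l :: real)"
      "fact (n + Suc l) = (n + Suc l) * (fact (n + l) :: real)"
      using d by (simp_all add: algebra_simps)
    have "moment n k (Suc l) = real (Suc l) * fact l * (real (n + Suc l) * fact (n + l)) /
        (real (n + l + k + 2) * fact (n + l + k + 1) * (real (1 + d) * fact (l - k)))"
      using True unfolding moment_def f by (simp only: le_SucI if_True)
    moreover have "moment n k l = fact l * fact (n + l) / (fact (n + l + k + 1) * fact (l - k))"
      using True unfolding moment_def by (simp only: if_True)
    moreover have "a * F * (b * G) / (c * H * (e * K)) * (e * c) = a * b * (F * G / (H * K))"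
      if "c > 0" "e > 0" for a b c e F G H K :: real
      using that by simp
    ultimately show ?thesis
      by (simp only: of_nat_0_less_iff zero_less_Suc add_gr_0 zero_less_numeral zero_less_one simp_thms)
  qed
  ultimately show ?thesis by (simp add: algebra_simps)
next
  case False
  then show ?thesis by (cases "k = Suc l") (simp_all add: moment_def)
qed

lemma heat_moment_derivative:
  "((heat_moment n l) has_real_derivative
     - decay_rate n l * heat_moment n l t + 4 * real l * real (n + l) * heat_moment n (l - 1) t) (at t)"
proof -
  have D: "((heat_moment n l) has_real_derivative
     (\<Sum>k\<le>l. real (2 * k + n + 1) * (exp (- decay_rate n k * t) * - decay_rate n k) * moment n k l)) (at t)"
  proof -
    have "((\<lambda>t. x * exp (- s * t) * y) has_real_derivative x * (exp (- s * t) * - s) * y) (at t)"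
      for x y s :: real
      by (auto intro!: derivative_eq_intros)
    then show ?thesis
      unfolding heat_moment_def[abs_def] by (intro DERIV_sum)
  qed
  have "(\<Sum>k\<le>l. real (2 * k + n + 1) * (exp (- decay_rate n k * t) * - decay_rate n k) * moment n k l)
     = - decay_rate n l * heat_moment n l t
       + (\<Sum>k\<le>l. real (2 * k + n + 1) * exp (- decay_rate n k * t) * ((decay_rate n l - decay_rate n k) * moment n k l))"
    unfolding heat_moment_def sum_distrib_left sum.distrib[symmetric]
    by (intro sum.cong refl) algebra
  also have "(\<Sum>k\<le>l. real (2 * k + n + 1) * exp (- decay_rate n k * t) * ((decay_rate n l - decay_rate n k) * moment n k l))
     = 4 * real l * real (n + l) * heat_moment n (l - 1) t"
  proof (cases l)
    case (Suc m)
    have z: "moment n (Suc m) m = 0" by (simp add: moment_def)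
    show ?thesis
      unfolding Suc moment_step heat_moment_def
      by (simp only: sum.atMost_Suc z mult_zero_right add_0_right sum_distrib_left mult_ac diff_Suc_1)
  qed simp
  finally show ?thesis using D by simp
qed

text \<open>At time \<open>0\<close> the expansion has to reproduce the value \<open>1\<close> of the monomial at the identity; the
  sum telescopes.\<close>

lemma heat_moment_0: "heat_moment n l 0 = 1"
proof -
  \<comment> \<open>The terms of the sum are the differences of \<open>S\<close>, which vanishes beyond \<open>l\<close>.\<close>
  define S :: "nat \<Rightarrow> real" where
    "S k = (if k \<le> l then fact l * fact (n + l) / (fact (n + l + k) * fact (l - k)) else 0)" for k
  have "real (2 * k + n + 1) * moment n k l = S k - S (Suc k)" if "k \<le> l" for k
  proof -
    define A where "A = fact (n + l + k) * (fact (l - k) :: real)"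
    have A: "A > 0" by (simp add: A_def)
    have f: "fact (n + l + k + 1) = (n + l + k + 1) * (fact (n + l + k) :: real)"
      by simp
    have m: "moment n k l = fact l * fact (n + l) / (real (n + l + k + 1) * A)"
      unfolding moment_def A_def f using that by (simp add: mult_ac)
    have s: "S (Suc k) = real (l - k) * (fact l * fact (n + l)) / (real (n + l + k + 1) * A)"
    proof (cases "k = l")
      case False
      then have "l - k = Suc (l - Suc k)" using that by simp
      then have "fact (l - k) = (l - k) * (fact (l - Suc k) :: real)"
        by (metis fact_Suc)
      moreover have "fact (n + l + Suc k) = (n + l + k + 1) * (fact (n + l + k) :: real)"
        by simp
      moreover have "real (l - k) > 0" using that False by simp
      ultimately show ?thesis
        using that False unfolding S_def A_def by (simp del: of_nat_add of_nat_diff fact_Suc add_Suc_right)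
    qed (simp add: S_def)
    have S: "S k = fact l * fact (n + l) / A" using that by (simp add: S_def A_def)
    have key: "x * (F / (N * A)) = F / A - y * F / (N * A)" if "x = N - y" "N > 0" for x y N F :: real
      using that(2) A unfolding that(1) by (simp add: field_simps)
    show ?thesis
      unfolding m s S using that by (intro key) (simp_all add: of_nat_diff)
  qed
  then have "heat_moment n l 0 = (\<Sum>k<Suc l. S k - S (Suc k))"
    unfolding heat_moment_def lessThan_Suc_atMost by (intro sum.cong) auto
  also have "\<dots> = S 0 - S (Suc l)" by (rule sum_lessThan_telescope')
  also have "\<dots> = 1" by (simp add: S_def)
  finally show ?thesis .
qed

text \<open>Both sides solve the same triangular system of linear equations with the same initial
  value.\<close>

lemma heat_mean_monomial_diagonal:
  assumes P: "is_heat_semigroup P" and t: "0 \<le> t"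
  shows "heat_mean P (\<lambda>g. Re (c * su2_monomial 0 (n + l) l g)) t = Re c * heat_moment n l t"
  using t
proof (induction l arbitrary: t rule: less_induct)
  case (less l)
  define M where "M l = heat_mean P (\<lambda>g. Re (c * su2_monomial 0 (n + l) l g))" for l
  define D where "D t = M l t - Re c * heat_moment n l t" for t
  have lim: "((\<lambda>h. (D (t + h) - D t) / h) \<longlongrightarrow> - decay_rate n l * D t) (at_right 0)" if t: "0 \<le> t" for t
  proof -
    have low: "real l * heat_mean P (\<lambda>g. Re (c * su2_monomial 0 (n + l - 1) (l - 1) g)) t
        = real l * (Re c * heat_moment n (l - 1) t)"
      using less.IH[of "l - 1" t] t by (cases l) simp_all
    have "((\<lambda>h. (M l (t + h) - M l t) / h) \<longlongrightarrow>
       - decay_rate n l * M l t + 4 * real (n + l) * (real l * heat_mean P (\<lambda>g. Re (c * su2_monomial 0 (n + l - 1) (l - 1) g)) t))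
       (at_right 0)"
      using heat_mean_monomial_evolution[OF P t, of c 0 "n + l" l]
      by (simp add: M_def decay_rate_def algebra_simps)
    moreover have "((\<lambda>h. (heat_moment n l (t + h) - heat_moment n l t) / h) \<longlongrightarrow>
        - decay_rate n l * heat_moment n l t + 4 * real l * real (n + l) * heat_moment n (l - 1) t) (at_right 0)"
      using heat_moment_derivative[of n l t] unfolding DERIV_def
      by (rule tendsto_within_subset) simp
    ultimately have "((\<lambda>h. (M l (t + h) - M l t) / h
         - Re c * ((heat_moment n l (t + h) - heat_moment n l t) / h)) \<longlongrightarrow>
         (- decay_rate n l * M l t + 4 * real (n + l) * (real l * (Re c * heat_moment n (l - 1) t)))
         - Re c * (- decay_rate n l * heat_moment n l t + 4 * real l * real (n + l) * heat_moment n (l - 1) t)) (at_right 0)"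
      unfolding low by (intro tendsto_intros)
    moreover have "(- decay_rate n l * M l t + 4 * real (n + l) * (real l * (Re c * heat_moment n (l - 1) t)))
         - Re c * (- decay_rate n l * heat_moment n l t + 4 * real l * real (n + l) * heat_moment n (l - 1) t)
        = - decay_rate n l * D t"
      unfolding D_def by (simp add: algebra_simps)
    ultimately show ?thesis
      unfolding D_def by (simp add: algebra_simps diff_divide_distrib add_divide_distrib)
  qed
  have cont: "continuous_on {0..} D"
  proof -
    have "continuous_on {0..} (M l)"
      unfolding M_def by (rule heat_mean_monomial_initial(1)[OF P])
    moreover have "continuous_on {0..} (heat_moment n l)"
      using heat_moment_derivative by (blast intro: continuous_at_imp_continuous_on DERIV_isCont)
    ultimately show ?thesis
      unfolding D_def by (intro continuous_intros)
  qed
  have init: "D 0 = 0"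
    unfolding D_def M_def by (subst heat_mean_monomial_initial(2)[OF P]) (simp add: heat_moment_0)
  have "D t = 0"
    by (rule right_derivative_linear_zero[OF cont lim init less.prems])
  then show ?case by (simp add: D_def M_def)
qed

section \<open>Disc polynomials\<close>

text \<open>The matrix coefficient between the vector \<open>x ^ (n + k) * y ^ k\<close> and itself for the rotation
  with cosine \<open>c\<close> and sine \<open>s\<close> acting on binary forms. It equals \<open>c ^ n\<close> times a Jacobi polynomial
  in \<open>c\<^sup>2\<close>, but in this form the bound by \<open>1\<close> and the Laguerre limit can both be read off.\<close>

definition disc_poly :: "nat \<Rightarrow> nat \<Rightarrow> real \<Rightarrow> real \<Rightarrow> real" where
  "disc_poly n k c s =
     (\<Sum>i\<le>k. (-1) ^ i * real ((n + k) choose i) * real (k choose i) * c ^ (n + 2 * (k - i)) * s ^ (2 * i))"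

text \<open>The maximum of \<open>S ^ p * T ^ q\<close> on the segment, attained at \<open>S = p\<close>, \<open>T = q\<close>, from
  \<open>x \<le> exp (x - 1)\<close> for \<open>x = S / p\<close> and \<open>x = T / q\<close>.\<close>

lemma weighted_power_le:
  fixes S T :: real
  assumes "0 \<le> S" "0 \<le> T" "S + T = real p + real q" "0 < p" "0 < q"
  shows "S ^ p * T ^ q \<le> real p ^ p * real q ^ q"
proof -
  have 1: "(x / real m) ^ m \<le> exp (x - real m)" if "0 \<le> x" "0 < m" for x and m :: nat
  proof -
    have "x / real m \<le> exp (x / real m - 1)"
      using exp_ge_add_one_self[of "x / real m - 1"] by simp
    then have "(x / real m) ^ m \<le> exp (x / real m - 1) ^ m"
      using that by (intro power_mono) auto
    also have "\<dots> = exp (x - real m)"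
      using that by (simp add: field_simps flip: exp_of_nat_mult)
    finally show ?thesis .
  qed
  have "(S / real p) ^ p * (T / real q) ^ q \<le> exp (S - real p) * exp (T - real q)"
    using assms by (intro mult_mono 1) auto
  also have "\<dots> = 1" using assms by (simp flip: exp_add)
  finally have "S ^ p * T ^ q / (real p ^ p * real q ^ q) \<le> 1"
    by (simp add: power_divide)
  then show ?thesis using assms by (simp add: divide_le_eq)
qed

lemma integral_cis:
  fixes m :: int
  shows "((\<lambda>\<tau>. cis (m * \<tau>)) has_integral (if m = 0 then complex_of_real (2 * pi) else 0)) {-pi..pi}"
    and "((\<lambda>\<tau>. cis (m * \<tau>)) has_integral (if m = 0 then complex_of_real (2 * pi) else 0)) {0..2 * pi}"
proof -
  have *: "((\<lambda>\<tau>. cis (m * \<tau>)) has_integral (if m = 0 then complex_of_real (2 * pi) else 0)) {a..a + 2 * pi}" for a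
  proof (cases "m = 0")
    case True
    then show ?thesis
      using has_integral_const_real[of "1 :: complex" a "a + 2 * pi"]
      by (simp add: scaleR_conv_of_real)
  next
    case False
    have "((\<lambda>\<tau>. cis (m * \<tau>)) has_integral
       cis (m * (a + 2 * pi)) / (\<i> * m) - cis (m * a) / (\<i> * m)) {a..a + 2 * pi}"
    proof (rule fundamental_theorem_of_calculus[where f = "\<lambda>\<tau>. cis (m * \<tau>) / (\<i> * m)"])
      fix x :: real
      show "((\<lambda>\<tau>. cis (m * \<tau>) / (\<i> * m)) has_vector_derivative cis (m * x)) (at x within {a..a + 2 * pi})"
        unfolding has_vector_derivative_def using False
        by (auto intro!: derivative_eq_intros simp: fun_eq_iff scaleR_conv_of_real field_simps)
    qed simp
    moreover have "cis (m * (a + 2 * pi)) = cis (m * a)"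
      using cis_multiple_2pi[of "real_of_int m"] by (simp add: distrib_left cis_mult[symmetric] mult_ac)
    ultimately show ?thesis using False by simp
  qed
  from *[of "-pi"] *[of 0] show "((\<lambda>\<tau>. cis (m * \<tau>)) has_integral (if m = 0 then complex_of_real (2 * pi) else 0)) {-pi..pi}"
    "((\<lambda>\<tau>. cis (m * \<tau>)) has_integral (if m = 0 then complex_of_real (2 * pi) else 0)) {0..2 * pi}"
    by simp_all
qed

text \<open>This is unitarity of the representation, proved as a Cauchy estimate. The number is the
  coefficient of \<open>X ^ (n + k) * Y ^ k\<close> in \<open>(c X + s Y) ^ (n + k) * (- s X + c Y) ^ k\<close>. A rotation
  preserves \<open>\<bar>X\<bar>\<^sup>2 + \<bar>Y\<bar>\<^sup>2\<close>, so on the torus \<open>\<bar>X\<bar>\<^sup>2 = n + k\<close>, \<open>\<bar>Y\<bar>\<^sup>2 = k\<close> the product is at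
  most the maximum of \<open>\<bar>X\<bar> ^ (n + k) * \<bar>Y\<bar> ^ k\<close> over that sphere, which is attained on this very
  torus.\<close>

lemma abs_disc_poly_le_1:
  assumes cs: "c\<^sup>2 + s\<^sup>2 = 1"
  shows "\<bar>disc_poly n k c s\<bar> \<le> 1"
proof (cases "k = 0")
  case True
  have "c\<^sup>2 \<le> 1" using cs zero_le_power2[of s] by linarith
  then have "\<bar>c\<bar> \<le> 1" by (simp add: abs_square_le_1)
  then show ?thesis
    using True by (simp add: disc_poly_def power_abs power_le_one)
next
  case False
  define p where "p = n + k"
  have pk: "0 < p" "0 < k" "k \<le> p" using False by (simp_all add: p_def)
  \<comment> \<open>The radii of the torus on which the Cauchy estimate is sharp.\<close>
  define x where "x = sqrt p"
  define y where "y = sqrt k"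
  have xy: "x\<^sup>2 = p" "y\<^sup>2 = k" "0 < x" "0 < y" using pk by (simp_all add: x_def y_def)
  define e where "e = - s * x"
  define u v where "u \<tau> = complex_of_real (s * y) + of_real (c * x) * cis \<tau>"
    and "v \<tau> = of_real e * cis \<tau> + of_real (c * y)" for \<tau>
  define F where "F \<tau> = u \<tau> ^ p * v \<tau> ^ k * cis (- real p * \<tau>)" for \<tau>
  define A B where "A i = real (p choose i) * (s * y) ^ i * (c * x) ^ (p - i)"
    and "B j = real (k choose j) * e ^ j * (c * y) ^ (k - j)" for i j
  have F: "F \<tau> = (\<Sum>i\<le>p. \<Sum>j\<le>k. of_real (A i * B j) * cis (real_of_int (int j - int i) * \<tau>))" for \<tau>
  proof -
    have dm: "cis (real m * \<tau>) = cis \<tau> ^ m" for m by (simp only: Complex.DeMoivre)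
    have u: "u \<tau> ^ p = (\<Sum>i\<le>p. of_real (A i) * cis (real (p - i) * \<tau>))"
      unfolding u_def binomial_ring A_def dm
      by (intro sum.cong) (simp_all add: power_mult_distrib mult_ac)
    have v: "v \<tau> ^ k = (\<Sum>j\<le>k. of_real (B j) * cis (real j * \<tau>))"
      unfolding v_def binomial_ring B_def dm
      by (intro sum.cong) (simp_all add: power_mult_distrib mult_ac)
    have "F \<tau> = (\<Sum>i\<le>p. \<Sum>j\<le>k. of_real (A i * B j) *
        (cis (real (p - i) * \<tau>) * cis (real j * \<tau>) * cis (- real p * \<tau>)))"
      unfolding F_def u v sum_product
      by (simp only: sum_distrib_right sum_distrib_left of_real_mult mult_ac)
    also have "\<dots> = (\<Sum>i\<le>p. \<Sum>j\<le>k. of_real (A i * B j) * cis (real_of_int (int j - int i) * \<tau>))"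
      by (intro sum.cong refl) (simp add: cis_mult of_nat_diff algebra_simps)
    finally show ?thesis .
  qed
  have "(F has_integral (\<Sum>i\<le>p. \<Sum>j\<le>k. complex_of_real (A i * B j) * (if int j - int i = 0 then complex_of_real (2 * pi) else 0))) {-pi..pi}"
    unfolding F by (intro has_integral_sum has_integral_mult_right integral_cis) auto
  also have "(\<Sum>i\<le>p. \<Sum>j\<le>k. complex_of_real (A i * B j) * (if int j - int i = 0 then complex_of_real (2 * pi) else 0))
      = of_real (2 * pi * (\<Sum>j\<le>k. A j * B j))"
  proof -
    have "(\<Sum>i\<le>p. \<Sum>j\<le>k. complex_of_real (A i * B j) * (if int j - int i = 0 then complex_of_real (2 * pi) else 0))
      = (\<Sum>j\<le>k. \<Sum>i\<le>p. if i = j then of_real (A i * B j * (2 * pi)) else 0)"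
      by (subst sum.swap) (intro sum.cong refl, auto)
    also have "\<dots> = (\<Sum>j\<le>k. of_real (A j * B j * (2 * pi)))"
      using pk by (intro sum.cong) auto
    finally show ?thesis by (simp add: sum_distrib_left mult_ac)
  qed
  also have "(\<Sum>j\<le>k. A j * B j) = x ^ p * y ^ k * disc_poly n k c s"
    unfolding disc_poly_def sum_distrib_left
  proof (intro sum.cong refl)
    fix i assume "i \<in> {..k}"
    then obtain d where d: "k = i + d" using le_Suc_ex by auto
    have e: "p - i = n + d" "k - i = d" "p = n + d + i" by (simp_all add: p_def d)
    have "c ^ (n + 2 * d) = c ^ (n + d) * c ^ d" "s ^ (2 * i) = s ^ i * s ^ i"
      "x ^ (n + d + i) = x ^ (n + d) * x ^ i" "y ^ k = y ^ i * y ^ d" "e ^ i = (- 1) ^ i * s ^ i * x ^ i"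
      by (simp_all add: d e_def mult_2 power_add add.assoc power_mult_distrib[symmetric])
    then show "A i * B i = x ^ p * y ^ k * ((- 1) ^ i * real ((n + k) choose i) * real (k choose i) *
         c ^ (n + 2 * (k - i)) * s ^ (2 * i))"
      unfolding A_def B_def p_def[symmetric] e(1,2) unfolding e(3)
      by (simp only: power_mult_distrib mult_ac)
  qed
  finally have I: "(F has_integral of_real (2 * pi * (x ^ p * y ^ k * disc_poly n k c s))) {-pi..pi}" .
  have "cmod (F \<tau>) \<le> x ^ p * y ^ k" for \<tau>
  proof (rule power2_le_imp_le)
    have u: "(cmod (u \<tau>))\<^sup>2 = (s * y + c * x * cos \<tau>)\<^sup>2 + (c * x * sin \<tau>)\<^sup>2"
      and v: "(cmod (v \<tau>))\<^sup>2 = (c * y - s * x * cos \<tau>)\<^sup>2 + (s * x * sin \<tau>)\<^sup>2"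
      by (simp_all add: cmod_power2 u_def v_def e_def)
    have "(cmod (u \<tau>))\<^sup>2 + (cmod (v \<tau>))\<^sup>2 = real p + real k"
      unfolding u v xy(1,2)[symmetric] using cs sin_cos_squared_add[of \<tau>] by algebra
    then have "((cmod (u \<tau>))\<^sup>2) ^ p * ((cmod (v \<tau>))\<^sup>2) ^ k \<le> real p ^ p * real k ^ k"
      using pk by (intro weighted_power_le) auto
    then show "(cmod (F \<tau>))\<^sup>2 \<le> (x ^ p * y ^ k)\<^sup>2"
      unfolding xy(1,2)[symmetric]
      by (simp add: F_def norm_mult norm_power power_mult_distrib flip: power_mult) (simp add: mult.commute)
  qed (use xy in simp)
  then have "cmod (of_real (2 * pi * (x ^ p * y ^ k * disc_poly n k c s))) \<le> x ^ p * y ^ k * Henstock_Kurzweil_Integration.content {-pi..pi}"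
    using xy by (intro has_integral_bound_real[OF _ _ I, where S = "{}"]) auto
  then have "\<bar>2 * pi * (x ^ p * y ^ k * disc_poly n k c s)\<bar> \<le> x ^ p * y ^ k * (2 * pi)"
    unfolding norm_of_real by simp
  then show ?thesis
    using xy by (simp add: abs_mult)
qed

text \<open>A Beta integral in the variable \<open>cos r ^ 2\<close>; integration by parts trades a power of the sine
  for a power of the cosine.\<close>

lemma integral_cos_sin_powers:
  "((\<lambda>r. sin (2 * r) * cos r ^ (2 * x) * sin r ^ (2 * y)) has_integral
      fact x * fact y / fact (x + y + 1)) {0..pi/2}"
proof (induction y arbitrary: x)
  case 0
  have "((\<lambda>r. sin (2 * r) * cos r ^ (2 * x)) has_integral
     (- (cos (pi/2) ^ (2 * x + 2)) / (x + 1)) - (- (cos 0 ^ (2 * x + 2)) / (x + 1))) {0..pi/2}"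
  proof (rule fundamental_theorem_of_calculus)
    fix r
    show "((\<lambda>r. - (cos r ^ (2 * x + 2)) / (x + 1)) has_vector_derivative
        sin (2 * r) * cos r ^ (2 * x)) (at r within {0..pi/2})"
    proof -
      have pow: "((\<lambda>r. cos r ^ m) has_real_derivative real m * cos r ^ (m - 1) * - sin r) (at r within {0..pi/2})" for m
        by (auto intro!: derivative_eq_intros)
      have "((\<lambda>r. - (cos r ^ (2 * x + 2)) / (x + 1)) has_real_derivative
          - (real (2 * x + 2) * cos r ^ (2 * x + 1) * - sin r) / (x + 1)) (at r within {0..pi/2})"
        using DERIV_cdivide[OF DERIV_minus[OF pow[of "2 * x + 2"]], of "real (x + 1)"] by simp
      also have "- (real (2 * x + 2) * cos r ^ (2 * x + 1) * - sin r) / (x + 1) = sin (2 * r) * cos r ^ (2 * x)"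
        unfolding sin_double by (simp add: field_simps)
      finally show ?thesis
        unfolding has_real_derivative_iff_has_vector_derivative .
    qed
  qed simp
  then show ?case by simp
next
  case (Suc y)
  have "((\<lambda>r. sin (2 * r) * ((y + 1) * cos r ^ (2 * x + 2) * sin r ^ (2 * y)
         - (x + 1) * cos r ^ (2 * x) * sin r ^ (2 * y + 2))) has_integral
     (cos (pi/2) ^ (2 * x + 2) * sin (pi/2) ^ (2 * y + 2)) - (cos 0 ^ (2 * x + 2) * sin 0 ^ (2 * y + 2)))
     {0..pi/2}"
  proof (rule fundamental_theorem_of_calculus)
    fix r
    show "((\<lambda>r. cos r ^ (2 * x + 2) * sin r ^ (2 * y + 2)) has_vector_derivative
        sin (2 * r) * ((y + 1) * cos r ^ (2 * x + 2) * sin r ^ (2 * y)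
         - (x + 1) * cos r ^ (2 * x) * sin r ^ (2 * y + 2))) (at r within {0..pi/2})"
    proof -
      have "((\<lambda>r. cos r ^ m) has_real_derivative real m * cos r ^ (m - 1) * - sin r) (at r within {0..pi/2})"
        "((\<lambda>r. sin r ^ m) has_real_derivative real m * sin r ^ (m - 1) * cos r) (at r within {0..pi/2})" for m
        by (auto intro!: derivative_eq_intros)
      from DERIV_mult[OF this(1)[of "2 * x + 2"] this(2)[of "2 * y + 2"]]
      have "((\<lambda>r. cos r ^ (2 * x + 2) * sin r ^ (2 * y + 2)) has_real_derivative
         real (2 * x + 2) * cos r ^ (2 * x + 1) * - sin r * sin r ^ (2 * y + 2)
          + real (2 * y + 2) * sin r ^ (2 * y + 1) * cos r * cos r ^ (2 * x + 2)) (at r within {0..pi/2})"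
        by simp
      also have "real (2 * x + 2) * cos r ^ (2 * x + 1) * - sin r * sin r ^ (2 * y + 2)
          + real (2 * y + 2) * sin r ^ (2 * y + 1) * cos r * cos r ^ (2 * x + 2)
         = sin (2 * r) * ((y + 1) * cos r ^ (2 * x + 2) * sin r ^ (2 * y)
         - (x + 1) * cos r ^ (2 * x) * sin r ^ (2 * y + 2))"
        unfolding sin_double by (simp add: algebra_simps)
      finally show ?thesis
        unfolding has_real_derivative_iff_has_vector_derivative .
    qed
  qed simp
  then have 0: "((\<lambda>r. sin (2 * r) * ((y + 1) * cos r ^ (2 * x + 2) * sin r ^ (2 * y)
         - (x + 1) * cos r ^ (2 * x) * sin r ^ (2 * y + 2))) has_integral 0) {0..pi/2}"
    by simp
  have "((\<lambda>r. (1 / (x + 1)) * ((y + 1) * (sin (2 * r) * cos r ^ (2 * (x + 1)) * sin r ^ (2 * y))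
      - sin (2 * r) * ((y + 1) * cos r ^ (2 * x + 2) * sin r ^ (2 * y)
         - (x + 1) * cos r ^ (2 * x) * sin r ^ (2 * y + 2)))) has_integral
      (1 / (x + 1)) * ((y + 1) * (fact (x + 1) * fact y / fact (x + 1 + y + 1)) - 0)) {0..pi/2}"
    by (intro has_integral_mult_right has_integral_diff Suc.IH 0)
  moreover have "(1 / (x + 1)) * ((y + 1) * (sin (2 * r) * cos r ^ (2 * (x + 1)) * sin r ^ (2 * y))
      - sin (2 * r) * ((y + 1) * cos r ^ (2 * x + 2) * sin r ^ (2 * y)
         - (x + 1) * cos r ^ (2 * x) * sin r ^ (2 * y + 2)))
      = sin (2 * r) * cos r ^ (2 * x) * sin r ^ (2 * Suc y)" for r :: real
    by (simp add: field_simps)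
  moreover have "(1 / (x + 1)) * ((y + 1) * (fact (x + 1) * fact y / fact (x + 1 + y + 1)) - 0)
      = fact x * fact (Suc y) / (fact (x + Suc y + 1) :: real)"
  proof -
    have "fact (x + 1 + y + 1) = (fact (x + Suc y + 1) :: real)" by (simp only: add_Suc_right add_Suc Suc_eq_plus1 add.assoc) simp
    moreover have "fact (x + 1) = (x + 1) * (fact x :: real)" "fact (Suc y) = (y + 1) * (fact y :: real)" by simp_all
    ultimately show ?thesis by (simp only:) simp
  qed
  ultimately show ?case by (simp only:)
qed

text \<open>A \<open>k\<close>-fold finite difference of \<open>m \<mapsto> m choose l\<close>, computed with Pascal's rule.\<close>

lemma alternating_binomial_sum:
  "k \<le> m \<Longrightarrow> (\<Sum>i\<le>k. (-1) ^ i * real (k choose i) * real ((m - i) choose l))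
     = (if k \<le> l then real ((m - k) choose (l - k)) else 0)"
proof (induction k arbitrary: m)
  case 0
  then show ?case by simp
next
  case (Suc k)
  define f where "f i = real ((m - i) choose l)" for i
  have "(\<Sum>i\<le>Suc k. (-1) ^ i * real (Suc k choose i) * f i)
     = f 0 + (\<Sum>i\<le>k. (-1) ^ Suc i * real (Suc k choose Suc i) * f (Suc i))"
    by (subst sum.atMost_Suc_shift) simp
  also have "\<dots> = (f 0 + (\<Sum>i\<le>k. (-1) ^ Suc i * real (k choose Suc i) * f (Suc i)))
      - (\<Sum>i\<le>k. (-1) ^ i * real (k choose i) * f (Suc i))"
  proof -
    have "(-1) ^ Suc i * real (Suc k choose Suc i) * f (Suc i)
      = (-1) ^ Suc i * real (k choose Suc i) * f (Suc i) - (-1) ^ i * real (k choose i) * f (Suc i)" for i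
      by (simp add: algebra_simps)
    then show ?thesis by (simp only: sum_subtractf add_diff_eq)
  qed
  also have "f 0 + (\<Sum>i\<le>k. (-1) ^ Suc i * real (k choose Suc i) * f (Suc i))
      = (\<Sum>i\<le>Suc k. (-1) ^ i * real (k choose i) * f i)"
    by (subst sum.atMost_Suc_shift) simp
  also have "\<dots> = (\<Sum>i\<le>k. (-1) ^ i * real (k choose i) * f i)" by simp
  also have "\<dots> = (if k \<le> l then real ((m - k) choose (l - k)) else 0)"
    unfolding f_def using Suc by simp
  also have "(\<Sum>i\<le>k. (-1) ^ i * real (k choose i) * f (Suc i))
      = (if k \<le> l then real ((m - 1 - k) choose (l - k)) else 0)"
    using Suc.IH[of "m - 1"] Suc.prems by (simp add: f_def)
  also have "(if k \<le> l then real ((m - k) choose (l - k)) else 0)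
       - (if k \<le> l then real ((m - 1 - k) choose (l - k)) else 0)
     = (if Suc k \<le> l then real ((m - Suc k) choose (l - Suc k)) else 0)"
  proof (cases "Suc k \<le> l")
    case True
    then have "m - k = Suc (m - Suc k)" "l - k = Suc (l - Suc k)" "m - 1 - k = m - Suc k"
      using Suc.prems by simp_all
    then show ?thesis using True by simp
  next
    case False
    then show ?thesis by (cases "k = l") auto
  qed
  finally show ?case unfolding f_def .
qed

text \<open>Each term of \<open>disc_poly\<close> contributes a Beta integral. What remains is a \<open>k\<close>-th finite
  difference of a polynomial of degree \<open>l\<close>, which is zero for \<open>l < k\<close>.\<close>

lemma integral_disc_poly_moment:
  "((\<lambda>r. sin (2 * r) * cos r ^ (n + 2 * l) * disc_poly n k (cos r) (sin r)) has_integral moment n k l) {0..pi/2}"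
proof -
  define C where "C i = (-1) ^ i * real ((n + k) choose i) * real (k choose i)" for i
  have "((\<lambda>r. \<Sum>i\<le>k. C i * (sin (2 * r) * cos r ^ (2 * (n + l + (k - i))) * sin r ^ (2 * i))) has_integral
     (\<Sum>i\<le>k. C i * (fact (n + l + (k - i)) * fact i / fact (n + l + (k - i) + i + 1)))) {0..pi/2}"
    by (intro has_integral_sum has_integral_mult_right integral_cos_sin_powers) simp
  moreover have "(\<Sum>i\<le>k. C i * (sin (2 * r) * cos r ^ (2 * (n + l + (k - i))) * sin r ^ (2 * i)))
     = sin (2 * r) * cos r ^ (n + 2 * l) * disc_poly n k (cos r) (sin r)" for r
    unfolding disc_poly_def sum_distrib_left C_def
  proof (intro sum.cong refl)
    fix i
    have "2 * (n + l + (k - i)) = (n + 2 * l) + (n + 2 * (k - i))" by simp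
    then have "cos r ^ (2 * (n + l + (k - i))) = cos r ^ (n + 2 * l) * cos r ^ (n + 2 * (k - i))"
      by (metis power_add)
    then show "(-1) ^ i * real ((n + k) choose i) * real (k choose i) * (sin (2 * r) * cos r ^ (2 * (n + l + (k - i))) * sin r ^ (2 * i))
      = sin (2 * r) * cos r ^ (n + 2 * l) * ((-1) ^ i * real ((n + k) choose i) * real (k choose i) * cos r ^ (n + 2 * (k - i)) * sin r ^ (2 * i))"
      by (simp add: mult_ac)
  qed
  moreover have "(\<Sum>i\<le>k. C i * (fact (n + l + (k - i)) * fact i / fact (n + l + (k - i) + i + 1))) = moment n k l"
  proof -
    let ?R = "fact (n + k) * fact l / fact (n + l + k + 1) :: real"
    have "(\<Sum>i\<le>k. C i * (fact (n + l + (k - i)) * fact i / fact (n + l + (k - i) + i + 1)))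
       = (\<Sum>i\<le>k. ?R * ((-1) ^ i * real (k choose i) * real ((n + l + k - i) choose l)))"
    proof (intro sum.cong refl)
      fix i assume "i \<in> {..k}"
      then obtain d where d: "k = i + d" using le_Suc_ex by auto
      have 1: "real ((n + k) choose i) = fact (n + k) / (fact i * fact (n + d))"
        using binomial_fact[of i "n + k", where 'a = real] by (simp add: d)
      have 2: "real ((n + l + k - i) choose l) = fact (n + l + d) / (fact l * fact (n + d))"
        using binomial_fact[of l "n + l + d", where 'a = real] by (simp add: d add.assoc)
      have 3: "n + l + (k - i) + i + 1 = n + l + k + 1" "n + l + (k - i) = n + l + d" by (simp_all add: d)
      show "C i * (fact (n + l + (k - i)) * fact i / fact (n + l + (k - i) + i + 1))
         = ?R * ((-1) ^ i * real (k choose i) * real ((n + l + k - i) choose l))"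
        unfolding C_def 3(1) unfolding 3(2) 1 2 by (simp add: field_simps)
    qed
    also have "\<dots> = ?R * (if k \<le> l then real ((n + l) choose (l - k)) else 0)"
      unfolding sum_distrib_left[symmetric] by (subst alternating_binomial_sum) auto
    also have "\<dots> = moment n k l"
    proof (cases "k \<le> l")
      case True
      then obtain d where d: "l = k + d" using le_Suc_ex by blast
      have 1: "real ((n + l) choose (l - k)) = fact (n + l) / (fact (l - k) * fact (n + k))"
        using binomial_fact[of "l - k" "n + l", where 'a = real] by (simp add: d)
      show ?thesis using True unfolding moment_def 1 by simp
    qed (simp add: moment_def)
    finally show ?thesis .
  qed
  ultimately show ?thesis by simp
qed

section \<open>Haar integrals of zonal functions\<close>

text \<open>The box may be closed at \<open>r = pi / 2\<close> because the density \<open>sin (2 * r)\<close> vanishes there; on a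
  compact box the continuous integrand is accessible to the integral of Henstock and Kurzweil.\<close>

lemma
  fixes F :: "su2 \<Rightarrow> real"
  assumes F: "continuous_on UNIV F"
  shows haar_su2_integrable: "integrable haar_su2 F"
    and haar_su2_box_integral: "(\<integral>g. F g \<partial>haar_su2) = integral (cbox (0, 0, -pi) (pi/2, 2*pi, pi))
      (\<lambda>x. sin (2 * fst x) / (4 * pi\<^sup>2) * F (cyl (fst x) (fst (snd x)) (snd (snd x))))"
proof -
  define C where "C x = cyl (fst x) (fst (snd x)) (snd (snd x))" for x :: "real \<times> real \<times> real"
  define B where "B = cbox (0, 0, -pi) (pi/2, 2*pi, pi :: real)"
  define w where "w x = indicator ({0..<pi/2} \<times> {0..2*pi} \<times> {-pi..pi}) x * (sin (2 * fst x) / (4 * pi\<^sup>2))"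
    for x :: "real \<times> real \<times> real"
  have w0: "0 \<le> w x" for x
    unfolding w_def by (auto simp: indicator_def intro!: divide_nonneg_nonneg sin_ge_zero)
  have wm: "w \<in> borel_measurable borel"
    unfolding w_def
    by (intro borel_measurable_times borel_measurable_indicator borel_measurable_continuous_onI
        continuous_intros borel_Times) (auto intro: borel_closed)
  have cC: "continuous_on S C" for S
    unfolding C_def by (rule continuous_on_cyl)
  have Cm: "C \<in> borel_measurable borel"
    by (rule borel_measurable_continuous_onI[OF cC])
  have Fm: "F \<in> borel_measurable borel"
    by (rule borel_measurable_continuous_onI[OF F])
  have cFC: "continuous_on S (\<lambda>x. F (C x))" for S
    by (rule continuous_on_compose2[OF F cC]) auto
  have haar: "haar_su2 = distr (density lborel (\<lambda>x. ennreal (w x))) borel C"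
    unfolding haar_su2_def
  proof (intro arg_cong3[where f = distr] arg_cong2[where f = density] refl ext)
    fix x :: "real \<times> real \<times> real"
    show "(case x of (r, \<theta>, z) \<Rightarrow> indicator ({0..<pi/2} \<times> {0..2*pi} \<times> {-pi..pi}) (r, \<theta>, z) *
        ennreal (sin (2 * r) / (4 * pi\<^sup>2))) = ennreal (w x)"
      by (cases x) (auto simp: w_def indicator_def)
    show "(case x of (r, \<theta>, z) \<Rightarrow> cyl r \<theta> z) = C x"
      by (cases x) (auto simp: C_def)
  qed
  have Cd: "C \<in> density lborel (\<lambda>x. ennreal (w x)) \<rightarrow>\<^sub>M borel"
    using Cm by (subst measurable_cong_sets[of _ borel _ borel]) simp_all
  have FC: "(\<lambda>x. F (C x)) \<in> borel_measurable lborel"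
    using cFC[of UNIV] by (auto intro: borel_measurable_continuous_onI)
  have weq: "w x *\<^sub>R F (C x) = indicator B x *\<^sub>R (sin (2 * fst x) / (4 * pi\<^sup>2) * F (C x))" for x
  proof -
    obtain r \<theta> z where x: "x = (r, \<theta>, z)" by (cases x)
    show ?thesis
    proof (cases "r = pi/2")
      case True
      then have "2 * fst x = pi" by (simp add: x)
      then have "sin (2 * fst x) = 0" by (simp only: sin_pi)
      then show ?thesis
        unfolding w_def
        by (simp only: div_0 mult_zero_left mult_zero_right scaleR_zero_left scaleR_zero_right)
    next
      case False
      then show ?thesis unfolding w_def B_def x by (auto simp: indicator_def cbox_Pair_eq)
    qed
  qed
  have si: "set_integrable lborel B (\<lambda>x. sin (2 * fst x) / (4 * pi\<^sup>2) * F (C x))"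
    unfolding set_integrable_def
    by (rule borel_integrable_compact) (auto simp: B_def intro!: continuous_intros cFC)
  then have "integrable lborel (\<lambda>x. w x *\<^sub>R F (C x))"
    unfolding weq set_integrable_def .
  then have "integrable (density lborel (\<lambda>x. ennreal (w x))) (\<lambda>x. F (C x))"
    using FC wm w0 by (subst integrable_density) auto
  then show "integrable haar_su2 F"
    unfolding haar using Cd Fm by (subst integrable_distr_eq) auto
  have "(\<integral>g. F g \<partial>haar_su2) = (\<integral>x. F (C x) \<partial>density lborel (\<lambda>x. ennreal (w x)))"
    unfolding haar using Cd Fm by (rule integral_distr)
  also have "\<dots> = (\<integral>x. w x *\<^sub>R F (C x) \<partial>lborel)"
    using FC wm w0 by (intro integral_density) auto
  also have "\<dots> = (LINT x:B|lborel. sin (2 * fst x) / (4 * pi\<^sup>2) * F (C x))"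
    unfolding set_lebesgue_integral_def weq ..
  also have "\<dots> = integral B (\<lambda>x. sin (2 * fst x) / (4 * pi\<^sup>2) * F (C x))"
    by (rule set_borel_integral_eq_integral(2)[OF si])
  finally show "(\<integral>g. F g \<partial>haar_su2) = integral (cbox (0, 0, -pi) (pi/2, 2*pi, pi))
      (\<lambda>x. sin (2 * fst x) / (4 * pi\<^sup>2) * F (cyl (fst x) (fst (snd x)) (snd (snd x))))"
    unfolding B_def C_def .
qed

lemma haar_su2_integral:
  fixes F :: "su2 \<Rightarrow> real"
  assumes F: "continuous_on UNIV F"
  shows "(\<integral>g. F g \<partial>haar_su2) = integral {0..pi/2} (\<lambda>r. integral {0..2*pi} (\<lambda>\<theta>. integral {-pi..pi}
      (\<lambda>z. sin (2 * r) / (4 * pi\<^sup>2) * F (cyl r \<theta> z))))"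
proof -
  have c: "continuous_on S (\<lambda>x. sin (2 * fst x) / (4 * pi\<^sup>2) * F (cyl (fst x) (fst (snd x)) (snd (snd x))))" for S
    by (intro continuous_intros continuous_on_compose2[OF F continuous_on_cyl]) auto
  have c2: "continuous_on S (\<lambda>y. sin (2 * r) / (4 * pi\<^sup>2) * F (cyl r (fst y) (snd y)))" for S r
    using continuous_on_compose2[OF c[of UNIV], of S "\<lambda>y. (r, y)"] by (simp add: continuous_intros)
  show ?thesis
    unfolding haar_su2_box_integral[OF F]
    by (subst integral_prod_continuous[OF c], simp only: fst_conv snd_conv,
        subst integral_prod_continuous[OF c2], simp)
qed

text \<open>In cylindric coordinates the integrand vanishes on the whole box; the zeros of the density at
  its two ends in \<open>r\<close> are reached by continuity.\<close>

lemma haar_su2_full_support: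
  fixes F :: "su2 \<Rightarrow> real"
  assumes F: "continuous_on UNIV F" and nn: "\<And>g. 0 \<le> F g" and int: "(\<integral>g. F g \<partial>haar_su2) = 0"
  shows "F g = 0"
proof -
  let ?f = "\<lambda>x. sin (2 * fst x) / (4 * pi\<^sup>2) * F (cyl (fst x) (fst (snd x)) (snd (snd x)))"
  have c: "continuous_on S ?f" for S
    by (intro continuous_intros continuous_on_compose2[OF F continuous_on_cyl]) auto
  have i0: "(?f has_integral 0) (cbox (0, 0, -pi) (pi/2, 2*pi, pi))"
  proof -
    have "(?f has_integral integral (cbox (0, 0, -pi) (pi/2, 2*pi, pi)) ?f) (cbox (0, 0, -pi) (pi/2, 2*pi, pi))"
      by (rule integrable_integral[OF integrable_continuous[OF c]])
    then show ?thesis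
      using int unfolding haar_su2_box_integral[OF F] by (simp only:)
  qed
  have *: "F (cyl r \<theta> z) = 0" if "r \<in> {0<..<pi/2}" "\<theta> \<in> {0..2*pi}" "z \<in> {-pi..pi}" for r \<theta> z
  proof -
    have "?f (r, \<theta>, z) = 0"
    proof (rule has_integral_0_cbox_imp_0[OF c _ i0])
      fix x assume "x \<in> box (0, 0, -pi) (pi/2, 2*pi, pi :: real)"
      then show "0 \<le> ?f x"
        by (cases x) (auto simp: box_def Basis_prod_def nn intro!: mult_nonneg_nonneg divide_nonneg_nonneg sin_ge_zero)
    next
      show "box (0, 0, -pi) (pi/2, 2*pi, pi :: real) \<noteq> {}"
        by (simp add: box_ne_empty Basis_prod_def)
    qed (use that in \<open>auto simp: cbox_Pair_eq\<close>)
    moreover have "sin (2 * r) > 0" using that by (intro sin_gt_zero) auto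
    ultimately show ?thesis by simp
  qed
  obtain r \<theta> z where r: "r \<in> {0..pi/2}" "\<theta> \<in> {0..2*pi}" "z \<in> {-pi..pi}" "g = cyl r \<theta> z"
    by (rule cyl_surj)
  have "F (cyl r \<theta> z) = 0"
  proof (rule continuous_constant_on_closure[where S = "{0<..<pi/2}" and f = "\<lambda>r. F (cyl r \<theta> z)"])
    have "continuous_on UNIV (\<lambda>r. cyl r \<theta> z)"
      using continuous_on_compose2[OF continuous_on_cyl[of UNIV], of UNIV "\<lambda>r. (r, \<theta>, z)"]
      by (simp add: continuous_intros)
    then show "continuous_on (closure {0<..<pi/2}) (\<lambda>r. F (cyl r \<theta> z))"
      by (intro continuous_on_compose2[OF F]) (auto intro: continuous_on_subset)
  qed (use * r in auto)
  then show ?thesis using r by simp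
qed

text \<open>The real part of a diagonal matrix coefficient; the extension of \<open>disc_poly\<close> to the group that
  is invariant under conjugation by the torus.\<close>

definition zonal :: "nat \<Rightarrow> nat \<Rightarrow> su2 \<Rightarrow> real" where
  "zonal n k g = Re (alpha g ^ n) *
     (\<Sum>i\<le>k. (-1) ^ i * real ((n + k) choose i) * real (k choose i) *
        cmod (alpha g) ^ (2 * (k - i)) * cmod (beta g) ^ (2 * i))"

lemma zonal_cyl:
  fixes z :: real
  shows "zonal n k (cyl r \<theta> z) = cos (n * z) * disc_poly n k (cos r) (sin r)"
proof -
  have "cmod (alpha (cyl r \<theta> z)) ^ (2 * i) = cos r ^ (2 * i)"
    "cmod (beta (cyl r \<theta> z)) ^ (2 * i) = sin r ^ (2 * i)" for i
    by (simp_all add: alpha_cyl beta_cyl norm_mult power_mult)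
  moreover have "Re (alpha (cyl r \<theta> z) ^ n) = cos r ^ n * cos (n * z)"
    by (simp add: alpha_cyl power_mult_distrib Complex.DeMoivre flip: of_real_power)
  ultimately show ?thesis
    by (simp add: zonal_def disc_poly_def sum_distrib_left power_add mult_ac)
qed

lemma continuous_on_zonal: "continuous_on UNIV (zonal n k)"
  unfolding zonal_def by (intro continuous_intros continuous_on_alpha continuous_on_beta)

lemma abs_zonal_le_1: "\<bar>zonal n k g\<bar> \<le> 1"
proof -
  obtain r \<theta> z where g: "g = cyl r \<theta> z" by (rule cyl_surj)
  have "\<bar>cos (n * z)\<bar> * \<bar>disc_poly n k (cos r) (sin r)\<bar> \<le> 1 * 1"
    by (intro mult_mono abs_disc_poly_le_1) auto
  then show ?thesis by (simp add: g zonal_cyl abs_mult)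
qed

text \<open>The coefficients of weight \<open>n\<close> and \<open>- n\<close> have the same real part and are counted together.\<close>

definition zonal_weight :: "nat \<Rightarrow> real" where
  "zonal_weight n = (if n = 0 then 1 else 2)"

lemma integral_cos_cis:
  fixes m :: int
  shows "((\<lambda>z. of_real (cos (n * z)) * cis (m * z)) has_integral
    (if int n = \<bar>m\<bar> then of_real (2 * pi / zonal_weight n) else 0)) {-pi..pi}"
proof -
  have "((\<lambda>z. (cis ((m + int n) * z) + cis ((m - int n) * z)) / 2) has_integral
     ((if m + int n = 0 then complex_of_real (2 * pi) else 0) + (if m - int n = 0 then complex_of_real (2 * pi) else 0)) / 2) {-pi..pi}"
    by (intro has_integral_divide has_integral_add integral_cis)
  moreover have "(cis ((m + int n) * z) + cis ((m - int n) * z)) / 2 = of_real (cos (n * z)) * cis (m * z)" for z :: real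
  proof -
    have "cis ((m + int n) * z) = cis (m * z) * cis (n * z)" "cis ((m - int n) * z) = cis (m * z) * cis (- (n * z))"
      by (simp_all add: cis_mult algebra_simps)
    then show ?thesis by (simp add: complex_eq_iff algebra_simps)
  qed
  moreover have "((if m + int n = 0 then complex_of_real (2 * pi) else 0) + (if m - int n = 0 then complex_of_real (2 * pi) else 0)) / 2
     = (if int n = \<bar>m\<bar> then of_real (2 * pi / zonal_weight n) else 0)"
    by (auto simp: zonal_weight_def)
  ultimately show ?thesis by simp
qed

lemma su2_monomial_cyl:
  fixes \<theta> z :: real
  shows "su2_monomial w i j (cyl r \<theta> z) = of_real (cos r ^ (i + j) * sin r ^ w) * (cis (w * \<theta>) * cis ((int i - int j - int w) * z))"
proof -
  have "cis (\<theta> - z) ^ w * cis z ^ i * cnj (cis z) ^ j = cis (w * \<theta>) * cis ((int i - int j - int w) * z)"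
    by (simp add: Complex.DeMoivre cis_cnj cis_mult algebra_simps)
  then show ?thesis
    by (simp add: su2_monomial_def alpha_cyl beta_cyl power_mult_distrib power_add mult_ac)
qed

text \<open>The angular integrals over \<open>\<theta>\<close> and \<open>z\<close> select \<open>w = 0\<close> and the weight \<open>\<bar>i - j\<bar>\<close>; the radial
  integral is a Jacobi moment.\<close>

lemma haar_zonal_monomial:
  "(\<integral>g. zonal n k g * Re (c * su2_monomial w i j g) \<partial>haar_su2) =
     (if w = 0 \<and> int n = \<bar>int i - int j\<bar> then Re c * moment n k (min i j) / zonal_weight n else 0)"
proof -
  define m where "m = int i - int j - int w"
  define K where "K = (if int n = \<bar>m\<bar> then complex_of_real (2 * pi / zonal_weight n) else 0)"
  define K' where "K' = (if w = 0 then complex_of_real (2 * pi) else 0)"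
  define R where "R r = sin (2 * r) / (4 * pi\<^sup>2) * disc_poly n k (cos r) (sin r) * (cos r ^ (i + j) * sin r ^ w)" for r
  have F: "sin (2 * r) / (4 * pi\<^sup>2) * (zonal n k (cyl r \<theta> z) * Re (c * su2_monomial w i j (cyl r \<theta> z)))
     = R r * Re (c * cis (w * \<theta>) * (of_real (cos (n * z)) * cis (m * z)))" for r \<theta> z :: real
  proof -
    have *: "Re (c * (of_real x * (a * b))) = x * Re (c * a * b)"
      "Re (c * a * (of_real x * b)) = x * Re (c * a * b)" for x a b
      by (simp_all add: algebra_simps)
    then show ?thesis
      unfolding zonal_cyl su2_monomial_cyl m_def[symmetric] R_def * by (simp only: mult_ac)
  qed
  have z: "integral {-pi..pi} (\<lambda>z. R r * Re (c * cis (w * \<theta>) * (of_real (cos (n * z)) * cis (m * z))))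
      = R r * Re (c * K * cis (w * \<theta>))" for r \<theta> :: real
  proof (rule integral_unique)
    have "((\<lambda>z. R r * Re (c * cis (w * \<theta>) * (of_real (cos (n * z)) * cis (m * z)))) has_integral
       R r * Re (c * cis (w * \<theta>) * K)) {-pi..pi}"
      unfolding K_def
      by (intro has_integral_mult_right has_integral_linear[OF _ bounded_linear_Re, unfolded o_def] integral_cos_cis)
    then show "((\<lambda>z. R r * Re (c * cis (w * \<theta>) * (of_real (cos (n * z)) * cis (m * z)))) has_integral
       R r * Re (c * K * cis (w * \<theta>))) {-pi..pi}" by (simp only: mult_ac)
  qed
  have t: "integral {0..2*pi} (\<lambda>\<theta>. R r * Re (c * K * cis (w * \<theta>))) = R r * Re (c * K * K')" for r
  proof (rule integral_unique)
    have "((\<lambda>\<theta>. cis (real_of_int (int w) * \<theta>)) has_integral K') {0..2*pi}"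
      unfolding K'_def using integral_cis(2)[of "int w"] by simp
    then show "((\<lambda>\<theta>. R r * Re (c * K * cis (w * \<theta>))) has_integral R r * Re (c * K * K')) {0..2*pi}"
      by (intro has_integral_mult_right has_integral_linear[OF _ bounded_linear_Re, unfolded o_def]) simp
  qed
  have "(\<integral>g. zonal n k g * Re (c * su2_monomial w i j g) \<partial>haar_su2)
     = integral {0..pi/2} (\<lambda>r. R r * Re (c * K * K'))"
    by (subst haar_su2_integral) (simp_all only: F z t continuous_on_mult continuous_on_zonal continuous_Re_monomial)
  also have "\<dots> = (if w = 0 \<and> int n = \<bar>int i - int j\<bar> then Re c * moment n k (min i j) / zonal_weight n else 0)"
  proof (cases "w = 0 \<and> int n = \<bar>int i - int j\<bar>")
    case True
    then have e: "i + j = n + 2 * min i j" and w: "w = 0" by auto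
    have "((\<lambda>r. Re (c * K * K') / (4 * pi\<^sup>2) *
       (sin (2 * r) * cos r ^ (n + 2 * min i j) * disc_poly n k (cos r) (sin r))) has_integral
        Re (c * K * K') / (4 * pi\<^sup>2) * moment n k (min i j)) {0..pi/2}"
      by (intro has_integral_mult_right integral_disc_poly_moment)
    moreover have "Re (c * K * K') = Re c * (4 * pi\<^sup>2) / zonal_weight n"
      using True by (simp add: K_def K'_def m_def power2_eq_square)
    ultimately show ?thesis
      using True by (intro integral_unique) (simp add: R_def e mult_ac)
  next
    case False
    then have "K = 0 \<or> K' = 0" by (auto simp: K_def K'_def m_def)
    then show ?thesis using False by auto
  qed
  finally show ?thesis .
qed

section \<open>The spectral expansion of the heat kernel\<close>

lemma abs_suminf_le:
  fixes f :: "nat \<Rightarrow> real"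
  assumes B: "\<And>i. \<bar>f i\<bar> \<le> B i" and "summable B"
  shows "\<bar>\<Sum>i. f i\<bar> \<le> (\<Sum>i. B i)"
proof -
  have s: "summable (\<lambda>i. norm (f i))"
    using B by (intro summable_comparison_test'[OF \<open>summable B\<close>, of 0]) simp
  have "\<bar>\<Sum>i. f i\<bar> \<le> (\<Sum>i. norm (f i))"
    using summable_norm[OF s] by simp
  also have "\<dots> \<le> (\<Sum>i. B i)"
    using B by (intro suminf_le s \<open>summable B\<close>) simp
  finally show ?thesis .
qed

lemma
  fixes F :: "nat \<Rightarrow> su2 \<Rightarrow> real"
  assumes F: "\<And>i. continuous_on UNIV (F i)" and B: "\<And>i g. \<bar>F i g\<bar> \<le> B i" and "summable B"
  shows continuous_on_suminf_su2: "continuous_on UNIV (\<lambda>g. \<Sum>i. F i g)"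
    and haar_su2_integral_suminf: "(\<integral>g. (\<Sum>i. F i g) \<partial>haar_su2) = (\<Sum>i. \<integral>g. F i g \<partial>haar_su2)"
proof -
  have ul: "uniform_limit UNIV (\<lambda>n g. \<Sum>i<n. F i g) (\<lambda>g. \<Sum>i. F i g) sequentially"
    by (rule Weierstrass_m_test[OF _ \<open>summable B\<close>]) (use B in simp)
  show "continuous_on UNIV (\<lambda>g. \<Sum>i. F i g)"
    by (rule uniform_limit_theorem[OF always_eventually ul]) (auto intro!: continuous_intros F)
  have sn: "summable (\<lambda>i. norm (F i g))" for g
    using B by (intro summable_comparison_test'[OF \<open>summable B\<close>, of 0]) simp
  have int: "integrable haar_su2 (\<lambda>g. norm (F i g))" for i
    by (intro haar_su2_integrable continuous_intros F)
  have c: "integrable haar_su2 (\<lambda>g. x :: real)" for x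
    by (intro haar_su2_integrable continuous_intros)
  have "summable (\<lambda>i. \<integral>g. norm (F i g) \<partial>haar_su2)"
  proof (rule summable_comparison_test'[where N = 0])
    show "summable (\<lambda>i. B i * (\<integral>g. 1 \<partial>haar_su2))"
      by (intro summable_mult2 \<open>summable B\<close>)
    fix i
    have "(\<integral>g. norm (F i g) \<partial>haar_su2) \<le> (\<integral>g. B i * 1 \<partial>haar_su2)"
      using B by (intro integral_mono int) (auto intro: c)
    then show "norm (\<integral>g. norm (F i g) \<partial>haar_su2) \<le> B i * (\<integral>g. 1 \<partial>haar_su2)"
      by (subst (asm) Bochner_Integration.integral_mult_right[OF c]) (simp add: integral_nonneg_AE)
  qed
  then show "(\<integral>g. (\<Sum>i. F i g) \<partial>haar_su2) = (\<Sum>i. \<integral>g. F i g \<partial>haar_su2)"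
    using sn by (intro integral_suminf) (auto intro: haar_su2_integrable F)
qed

definition heat_coeff :: "nat \<Rightarrow> nat \<Rightarrow> real \<Rightarrow> real" where
  "heat_coeff n k t = zonal_weight n * real (2 * k + n + 1) * exp (- decay_rate n k * t)"

text \<open>The expansion of the heat kernel by the theorem of Peter and Weyl: each diagonal coefficient
  with the dimension of its representation and the decay given by its eigenvalue.\<close>

definition heat_series :: "real \<Rightarrow> su2 \<Rightarrow> real" where
  "heat_series t g = (\<Sum>k. \<Sum>n. heat_coeff n k t * zonal n k g)"

lemma heat_coeff_nonneg: "0 \<le> heat_coeff n k t"
  by (simp add: heat_coeff_def zonal_weight_def)

text \<open>A bound by a function of \<open>k\<close> times a function of \<open>n\<close>, which makes every exchange of the double
  series with integrals and limits elementary.\<close>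

lemma heat_coeff_le:
  assumes "0 < t"
  shows "heat_coeff n k t \<le> (real (2 * k + 1) * exp (- 4 * t) ^ k) * (2 * real (n + 1) * exp (- 2 * t) ^ n)"
proof -
  have "decay_rate n k \<ge> 4 * k + 2 * n" by (simp add: decay_rate_def algebra_simps)
  then have "exp (- decay_rate n k * t) \<le> exp (- (4 * k + 2 * n) * t)"
    using assms by (intro exp_le_cancel_iff[THEN iffD2] mult_right_mono) auto
  also have "\<dots> = exp (- 4 * t) ^ k * exp (- 2 * t) ^ n"
    by (simp add: algebra_simps flip: exp_of_nat_mult exp_add)
  finally have e: "exp (- decay_rate n k * t) \<le> exp (- 4 * t) ^ k * exp (- 2 * t) ^ n" .
  have "zonal_weight n * real (2 * k + n + 1) \<le> 2 * (real (2 * k + 1) * real (n + 1))"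
  proof (intro mult_mono)
    show "real (2 * k + n + 1) \<le> real (2 * k + 1) * real (n + 1)"
      by (simp add: algebra_simps)
  qed (auto simp: zonal_weight_def)
  then have "heat_coeff n k t \<le> 2 * (real (2 * k + 1) * real (n + 1)) * (exp (- 4 * t) ^ k * exp (- 2 * t) ^ n)"
    unfolding heat_coeff_def by (rule mult_mono[OF _ e]) auto
  then show ?thesis by (simp only: mult_ac)
qed

lemma summable_linear_geometric:
  fixes q :: real
  assumes "\<bar>q\<bar> < 1"
  shows "summable (\<lambda>n. real (n + 1) * q ^ n)" "summable (\<lambda>n. real (2 * n + 1) * q ^ n)"
proof -
  show 1: "summable (\<lambda>n. real (n + 1) * q ^ n)"
    using geometric_deriv_sums[of q] assms by (simp add: sums_iff)
  have "summable (\<lambda>n. 2 * (real (n + 1) * q ^ n) - q ^ n)"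
    using assms by (intro summable_diff summable_mult 1 summable_geometric) simp
  then show "summable (\<lambda>n. real (2 * n + 1) * q ^ n)"
    by (simp add: algebra_simps)
qed

lemma
  assumes t: "0 < t"
  shows continuous_on_heat_series: "continuous_on UNIV (heat_series t)"
    and haar_heat_series: "continuous_on UNIV f \<Longrightarrow> (\<integral>g. heat_series t g * f g \<partial>haar_su2)
      = (\<Sum>k. \<Sum>n. heat_coeff n k t * (\<integral>g. zonal n k g * f g \<partial>haar_su2))"
proof -
  define a where "a k = real (2 * k + 1) * exp (- 4 * t) ^ k" for k
  define b where "b n = 2 * real (n + 1) * exp (- 2 * t) ^ n" for n
  have a: "summable a"
    unfolding a_def using t by (intro summable_linear_geometric) simp
  have b: "summable b"
    unfolding b_def mult.assoc using t by (intro summable_mult summable_linear_geometric) simp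
  have ab: "heat_coeff n k t \<le> a k * b n" for n k
    unfolding a_def b_def by (rule heat_coeff_le[OF t])
  have cz: "\<bar>heat_coeff n k t * zonal n k g\<bar> \<le> a k * b n" for n k g
  proof -
    have "heat_coeff n k t * \<bar>zonal n k g\<bar> \<le> (a k * b n) * 1"
      using ab[of n k] heat_coeff_nonneg[of n k t] abs_zonal_le_1[of n k g]
      by (intro mult_mono) (auto intro: order_trans)
    then show ?thesis using heat_coeff_nonneg[of n k t] by (simp add: abs_mult)
  qed
  have main: "continuous_on UNIV (\<lambda>g. \<Sum>k. \<Sum>n. heat_coeff n k t * zonal n k g * h g) \<and>
     (\<integral>g. (\<Sum>k. \<Sum>n. heat_coeff n k t * zonal n k g * h g) \<partial>haar_su2)
      = (\<Sum>k. \<Sum>n. heat_coeff n k t * (\<integral>g. zonal n k g * h g \<partial>haar_su2)) \<and>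
     (\<forall>g. (\<Sum>k. \<Sum>n. heat_coeff n k t * zonal n k g * h g) = heat_series t g * h g)"
    if h: "continuous_on UNIV h" for h
  proof -
    have "bounded (range h)"
      using compact_continuous_image[OF h compact_su2] by (rule compact_imp_bounded)
    then obtain M where M: "\<And>g. \<bar>h g\<bar> \<le> M" by (auto simp: bounded_iff)
    have c: "continuous_on UNIV (\<lambda>g. heat_coeff n k t * zonal n k g * h g)" for n k
      by (intro continuous_intros continuous_on_zonal h)
    have bd: "\<bar>heat_coeff n k t * zonal n k g * h g\<bar> \<le> a k * b n * M" for n k g
      unfolding abs_mult[of _ "h g"] using M cz
      by (intro mult_mono) (auto intro: order_trans[OF abs_ge_zero cz])
    have s: "summable (\<lambda>n. a k * b n * M)" for k
      by (intro summable_mult summable_mult2 b)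
    have s': "(\<Sum>n. a k * b n * M) = a k * (suminf b * M)" for k
      using b by (simp add: suminf_mult suminf_mult2[symmetric] summable_mult mult.assoc summable_mult2)
    have bd2: "\<bar>\<Sum>n. heat_coeff n k t * zonal n k g * h g\<bar> \<le> a k * (suminf b * M)" for k g
      using abs_suminf_le[OF bd s] unfolding s' .
    have s2: "summable (\<lambda>k. a k * (suminf b * M))"
      by (intro summable_mult2 a)
    note c2 = continuous_on_suminf_su2[OF c bd s]
    have "(\<integral>g. (\<Sum>k. \<Sum>n. heat_coeff n k t * zonal n k g * h g) \<partial>haar_su2)
        = (\<Sum>k. \<integral>g. (\<Sum>n. heat_coeff n k t * zonal n k g * h g) \<partial>haar_su2)"
      by (rule haar_su2_integral_suminf[OF c2 bd2 s2])
    also have "\<dots> = (\<Sum>k. \<Sum>n. \<integral>g. heat_coeff n k t * zonal n k g * h g \<partial>haar_su2)"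
      by (subst haar_su2_integral_suminf[OF c bd s]) simp
    finally have "(\<integral>g. (\<Sum>k. \<Sum>n. heat_coeff n k t * zonal n k g * h g) \<partial>haar_su2)
      = (\<Sum>k. \<Sum>n. heat_coeff n k t * (\<integral>g. zonal n k g * h g \<partial>haar_su2))"
      by (simp add: mult.assoc)
    moreover have "(\<Sum>k. \<Sum>n. heat_coeff n k t * zonal n k g * h g) = heat_series t g * h g" for g
    proof -
      have 1: "summable (\<lambda>n. heat_coeff n k t * zonal n k g)" for k
        using cz b by (intro summable_comparison_test'[OF summable_mult[OF b], of 0]) (auto simp: real_norm_def)
      have "\<bar>\<Sum>n. heat_coeff n k t * zonal n k g\<bar> \<le> a k * suminf b" for k
      proof -
        have "\<bar>\<Sum>n. heat_coeff n k t * zonal n k g\<bar> \<le> (\<Sum>n. a k * b n)"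
          by (rule abs_suminf_le[OF cz summable_mult[OF b]])
        then show ?thesis using b by (simp add: suminf_mult)
      qed
      then have 2: "summable (\<lambda>k. \<Sum>n. heat_coeff n k t * zonal n k g)"
        by (intro summable_comparison_test'[OF summable_mult2[OF a], of 0]) auto
      show ?thesis
        unfolding heat_series_def by (simp add: suminf_mult2[OF 1] suminf_mult2[OF 2])
    qed
    ultimately show ?thesis
      using continuous_on_suminf_su2[OF c2 bd2 s2] by blast
  qed
  show "(\<integral>g. heat_series t g * f g \<partial>haar_su2)
      = (\<Sum>k. \<Sum>n. heat_coeff n k t * (\<integral>g. zonal n k g * f g \<partial>haar_su2))"
    if f: "continuous_on UNIV f"
  proof -
    have eq: "(\<lambda>g. heat_series t g * f g) = (\<lambda>g. \<Sum>k. \<Sum>n. heat_coeff n k t * zonal n k g * f g)"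
      using main[OF f] by (simp only: fun_eq_iff simp_thms)
    show ?thesis unfolding eq using main[OF f] by blast
  qed
  show "continuous_on UNIV (heat_series t)"
  proof -
    have "heat_series t = (\<lambda>g. \<Sum>k. \<Sum>n. heat_coeff n k t * zonal n k g * 1)"
      by (auto simp: heat_series_def)
    moreover have "continuous_on UNIV (\<lambda>g. \<Sum>k. \<Sum>n. heat_coeff n k t * zonal n k g * 1)"
      using main[OF continuous_on_const[of UNIV 1]] by blast
    ultimately show ?thesis by argo
  qed
qed

lemma haar_heat_series_monomial:
  assumes t: "0 < t"
  shows "(\<integral>g. heat_series t g * Re (c * su2_monomial w i j g) \<partial>haar_su2) =
     (if w = 0 then Re c * heat_moment (nat \<bar>int i - int j\<bar>) (min i j) t else 0)"
proof (cases "w = 0")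
  case False
  then show ?thesis unfolding haar_heat_series[OF t continuous_Re_monomial] haar_zonal_monomial by simp
next
  case True
  define m where "m = nat \<bar>int i - int j\<bar>"
  define l where "l = min i j"
  have "(\<integral>g. heat_series t g * Re (c * su2_monomial w i j g) \<partial>haar_su2) =
     (\<Sum>k. \<Sum>n. heat_coeff n k t * (if n = m then Re c * moment n k l / zonal_weight n else 0))"
    unfolding haar_heat_series[OF t continuous_Re_monomial] haar_zonal_monomial
    using True by (intro suminf_cong arg_cong2[where f = "(*)"] refl if_cong) (auto simp: m_def l_def)
  also have "\<dots> = (\<Sum>k. heat_coeff m k t * (Re c * moment m k l / zonal_weight m))"
  proof (intro suminf_cong)
    fix k
    have "(\<Sum>n. heat_coeff n k t * (if n = m then Re c * moment n k l / zonal_weight n else 0))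
      = (\<Sum>n\<in>{m}. heat_coeff n k t * (if n = m then Re c * moment n k l / zonal_weight n else 0))"
      by (rule suminf_finite) auto
    then show "(\<Sum>n. heat_coeff n k t * (if n = m then Re c * moment n k l / zonal_weight n else 0))
      = heat_coeff m k t * (Re c * moment m k l / zonal_weight m)" by simp
  qed
  also have "\<dots> = (\<Sum>k\<le>l. heat_coeff m k t * (Re c * moment m k l / zonal_weight m))"
    by (rule suminf_finite) (auto simp: moment_def)
  also have "\<dots> = Re c * heat_moment m l t"
    unfolding heat_moment_def sum_distrib_left
    by (intro sum.cong refl) (simp add: heat_coeff_def zonal_weight_def)
  finally show ?thesis using True by (simp add: m_def l_def)
qed

text \<open>Both functions have the same integrals against the monomials without \<open>cnj beta\<close>. The relation
  \<open>beta * cnj beta = 1 - alpha * cnj alpha\<close> and complex conjugation extend this to all monomials,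
  linearity to all polynomials, and the theorem of Stone and Weierstrass to all continuous functions.
  The square of the difference therefore has integral zero.\<close>

lemma heat_kernel_eq_heat_series:
  assumes p: "is_heat_kernel p" and t: "0 < t"
  shows "p t = heat_series t"
proof -
  obtain P where P: "is_heat_semigroup P" "su2_smooth (p t)"
    "\<And>f. apply_bcontfun (blinfun_apply (P t) f) 1 = (\<integral>g. p t g * apply_bcontfun f g \<partial>haar_su2)"
    using p t unfolding is_heat_kernel_def by blast
  define D where "D g = p t g - heat_series t g" for g
  have cp: "continuous_on UNIV (p t)"
    using P(2) unfolding su2_smooth_def by (metis su2_Ck.simps(1))
  have cq: "continuous_on UNIV (heat_series t)"
    by (rule continuous_on_heat_series[OF t])
  have cD: "continuous_on UNIV D"
    unfolding D_def by (intro continuous_intros cp cq)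
  have mean: "(\<integral>g. p t g * F g \<partial>haar_su2) = heat_mean P F t" if "continuous_on UNIV F" for F
    using P(3)[of "Bcontfun F"] that
    by (simp add: heat_mean_def Bcontfun_inverse continuous_bcontfun_su2)
  have mono: "(\<integral>g. p t g * Re (c * su2_monomial w i j g) \<partial>haar_su2)
     = (\<integral>g. heat_series t g * Re (c * su2_monomial w i j g) \<partial>haar_su2)" for c w i j
  proof (cases "w = 0")
    case False
    then have "heat_mean P (\<lambda>g. Re (c * su2_monomial w i j g)) t = 0"
      using t by (intro heat_mean_monomial_off_diagonal[OF P(1)]) auto
    then show ?thesis
      unfolding mean[OF continuous_Re_monomial] haar_heat_series_monomial[OF t] by (simp only: False if_False)
  next
    case True
    have diag: "(\<integral>g. p t g * Re (c * su2_monomial 0 (n + l) l g) \<partial>haar_su2) = Re c * heat_moment n l t" for c n l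
      unfolding mean[OF continuous_Re_monomial] using t by (intro heat_mean_monomial_diagonal[OF P(1)]) simp
    show ?thesis
    proof (cases "j \<le> i")
      case le: True
      then show ?thesis
        using diag[of c "i - j" j] True unfolding haar_heat_series_monomial[OF t] by (simp add: min_def nat_diff_distrib)
    next
      case False
      have "Re (c * su2_monomial 0 i j g) = Re (cnj c * su2_monomial 0 j i g)" for g
      proof -
        have "Re (c * su2_monomial 0 i j g) = Re (cnj (c * su2_monomial 0 i j g))" by (simp only: cnj.sel)
        also have "cnj (c * su2_monomial 0 i j g) = cnj c * su2_monomial 0 j i g" by (simp add: su2_monomial_def)
        finally show ?thesis .
      qed
      then show ?thesis
        using diag[of "cnj c" "j - i" i] True False unfolding haar_heat_series_monomial[OF t]
        by (simp add: min_def nat_diff_distrib)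
    qed
  qed
  \<comment> \<open>Linearity in \<open>c\<close> lets one real integral carry the information of a complex one.\<close>
  define null where "null h \<longleftrightarrow> (\<forall>c. (\<integral>g. D g * Re (c * h g) \<partial>haar_su2) = 0)" for h
  have null_combination: "null (\<lambda>g. x * u g + y * v g)" if "null u" "null v" "u \<in> su2_poly" "v \<in> su2_poly" for u v x y
    unfolding null_def
  proof
    fix c
    have "(\<integral>g. D g * Re (c * (x * u g + y * v g)) \<partial>haar_su2)
      = (\<integral>g. D g * Re ((c * x) * u g) + D g * Re ((c * y) * v g) \<partial>haar_su2)"
      by (intro Bochner_Integration.integral_cong refl) (simp add: algebra_simps)
    also have "\<dots> = (\<integral>g. D g * Re ((c * x) * u g) \<partial>haar_su2) + (\<integral>g. D g * Re ((c * y) * v g) \<partial>haar_su2)"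
      by (intro Bochner_Integration.integral_add haar_su2_integrable continuous_intros cD su2_poly_continuous that)
    finally show "(\<integral>g. D g * Re (c * (x * u g + y * v g)) \<partial>haar_su2) = 0"
      using that by (simp only: null_def add_0)
  qed
  define E where "E w v i j g = beta g ^ w * cnj (beta g) ^ v * alpha g ^ i * cnj (alpha g) ^ j" for w v i j g
  have E_poly: "E w v i j \<in> su2_poly" for w v i j
    unfolding E_def by (intro su2_poly_mult su2_poly_power su2_poly_gen)
  have null_mono: "null (su2_monomial w i j)" for w i j
    unfolding null_def
  proof
    fix c
    have "(\<integral>g. D g * Re (c * su2_monomial w i j g) \<partial>haar_su2)
      = (\<integral>g. p t g * Re (c * su2_monomial w i j g) - heat_series t g * Re (c * su2_monomial w i j g) \<partial>haar_su2)"
      by (intro Bochner_Integration.integral_cong refl) (simp only: D_def left_diff_distrib)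
    also have "\<dots> = 0"
      using mono
      by (subst Bochner_Integration.integral_diff)
         (auto intro!: haar_su2_integrable continuous_on_mult cp cq continuous_Re_monomial simp del: times_complex.sel)
    finally show "(\<integral>g. D g * Re (c * su2_monomial w i j g) \<partial>haar_su2) = 0" .
  qed
  have null_E: "null (E w v i j)" for w v i j
  proof (induction w arbitrary: v i j)
    case 0
    show ?case
      unfolding null_def
    proof
      fix c
      have eq: "Re (c * E 0 v i j g) = Re (cnj c * su2_monomial v j i g)" for g
      proof -
        have "Re (c * E 0 v i j g) = Re (cnj (c * E 0 v i j g))" by (simp only: cnj.sel)
        also have "cnj (c * E 0 v i j g) = cnj c * su2_monomial v j i g" by (simp add: su2_monomial_def E_def mult_ac)
        finally show ?thesis .
      qed
      have "(\<integral>g. D g * Re (cnj c * su2_monomial v j i g) \<partial>haar_su2) = 0"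
        using null_mono[of v j i] unfolding null_def by blast
      then show "(\<integral>g. D g * Re (c * E 0 v i j g) \<partial>haar_su2) = 0"
        unfolding eq .
    qed
  next
    case (Suc w)
    show ?case
    proof (cases v)
      case 0
      have "E (Suc w) v i j = su2_monomial (Suc w) i j" by (auto simp: E_def su2_monomial_def 0)
      then show ?thesis by (simp only: null_mono)
    next
      case (Suc u)
      have "E (Suc w) v i j = (\<lambda>g. 1 * E w u i j g + - 1 * E w u (Suc i) (Suc j) g)"
      proof
        fix g
        have "E (Suc w) v i j g = (beta g * cnj (beta g)) * E w u i j g"
          by (simp add: E_def Suc mult_ac)
        also have "beta g * cnj (beta g) = 1 - alpha g * cnj (alpha g)"
          using row_norm[of g] by (simp add: algebra_simps)
        finally show "E (Suc w) v i j g = 1 * E w u i j g + - 1 * E w u (Suc i) (Suc j) g"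
          by (simp add: E_def algebra_simps)
      qed
      then show ?thesis by (simp only: null_combination[OF Suc.IH Suc.IH E_poly E_poly])
    qed
  qed
  have null_poly: "null (\<lambda>g. E w v i j g * h g)" if "h \<in> su2_poly" for w v i j h
    using that
  proof (induction h arbitrary: w v i j rule: su2_poly.induct)
    case (const c)
    show ?case using null_combination[OF null_E null_E E_poly E_poly, of c w v i j 0] by (simp add: mult.commute)
  next
    case (add f h)
    then show ?case
      using null_combination[OF add.IH su2_poly_mult[OF E_poly add.hyps(1)] su2_poly_mult[OF E_poly add.hyps(2)],
          of 1 w v i j 1 w v i j]
      by (simp add: distrib_left)
  next
    case (gen u f)
    have "E w v i j g * alpha g = E w v (Suc i) j g" "E w v i j g * beta g = E (Suc w) v i j g"
      "E w v i j g * cnj (alpha g) = E w v i (Suc j) g" "E w v i j g * cnj (beta g) = E w (Suc v) i j g" for g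
      by (simp_all add: E_def mult_ac)
    then show ?case
      using gen by (auto simp: mult.assoc[symmetric])
  qed
  define R where "R = {f. (\<lambda>g. complex_of_real (f g)) \<in> su2_poly}"
  have null_R: "(\<integral>g. D g * f g \<partial>haar_su2) = 0" if "f \<in> R" for f
  proof -
    have "null (\<lambda>g. E 0 0 0 0 g * complex_of_real (f g))"
      using that by (intro null_poly) (simp add: R_def)
    then have "(\<integral>g. D g * Re (1 * (E 0 0 0 0 g * complex_of_real (f g))) \<partial>haar_su2) = 0"
      unfolding null_def by blast
    then show ?thesis by (simp add: E_def)
  qed
  interpret function_ring_on R UNIV
  proof
    show "compact (UNIV :: su2 set)" by (rule compact_su2)
    show "continuous_on UNIV f" if "f \<in> R" for f
    proof -
      have "continuous_on UNIV (\<lambda>g. Re (complex_of_real (f g)))"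
        using that by (intro continuous_intros su2_poly_continuous) (simp add: R_def)
      then show ?thesis by simp
    qed
    show "(\<lambda>x. f x + h x) \<in> R" "(\<lambda>x. f x * h x) \<in> R" if "f \<in> R" "h \<in> R" for f h
      using that su2_poly.add su2_poly_mult by (auto simp: R_def)
    show "(\<lambda>_. c) \<in> R" for c by (auto simp: R_def intro: su2_poly.const)
    show "\<exists>f\<in>R. f x \<noteq> f y" if "x \<noteq> y" for x y
    proof -
      have RI: "(\<lambda>g. Re (h g)) \<in> R" "(\<lambda>g. Im (h g)) \<in> R" if h: "h \<in> su2_poly" for h
      proof -
        have "(\<lambda>g. (1/2) * (h g + cnj (h g))) \<in> su2_poly" "(\<lambda>g. (- \<i>/2) * (h g + (-1) * cnj (h g))) \<in> su2_poly"
          by (intro su2_poly_mult su2_poly.add su2_poly.const su2_poly_cnj h)+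
        moreover have "complex_of_real (Re z) = (1/2) * (z + cnj z)"
          "complex_of_real (Im z) = (- \<i>/2) * (z + (-1) * cnj z)" for z
          by (simp_all add: complex_eq_iff)
        ultimately show "(\<lambda>g. Re (h g)) \<in> R" "(\<lambda>g. Im (h g)) \<in> R"
          by (simp_all only: R_def mem_Collect_eq)
      qed
      have "alpha x \<noteq> alpha y \<or> beta x \<noteq> beta y" using that su2_eqI by blast
      then have "Re (alpha x) \<noteq> Re (alpha y) \<or> Im (alpha x) \<noteq> Im (alpha y) \<or>
          Re (beta x) \<noteq> Re (beta y) \<or> Im (beta x) \<noteq> Im (beta y)"
        by (auto simp: complex_eq_iff)
      then show ?thesis
        by (elim disjE bexI[OF _ RI(1)[OF su2_poly_gen(1)]] bexI[OF _ RI(2)[OF su2_poly_gen(1)]]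
            bexI[OF _ RI(1)[OF su2_poly_gen(2)]] bexI[OF _ RI(2)[OF su2_poly_gen(2)]])
    qed
  qed
  have "(\<integral>g. D g * D g \<partial>haar_su2) = 0"
  proof (rule ccontr)
    let ?N = "\<integral>g. D g * D g \<partial>haar_su2" and ?A = "\<integral>g. \<bar>D g\<bar> \<partial>haar_su2"
    assume ne: "?N \<noteq> 0"
    moreover have "0 \<le> ?N" by (intro integral_nonneg_AE) simp
    ultimately have N: "0 < ?N" by linarith
    have A: "0 \<le> ?A" by (intro integral_nonneg_AE) simp
    have "\<exists>e>0. A * e < N" if "0 \<le> A" "0 < N" for A N :: real
      using that by (intro exI[of _ "N / (2 * (A + 1))"]) (auto simp: pos_divide_less_eq algebra_simps add_nonneg_pos)
    then obtain e where e: "0 < e" "?A * e < ?N" using A N by blast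
    from Stone_Weierstrass_basic[OF cD e(1)] obtain f where f: "f \<in> R" "\<And>x. \<bar>D x - f x\<bar> < e" by auto
    have cf: "continuous_on UNIV f" by (rule continuous[OF f(1)])
    have "?N = (\<integral>g. D g * D g - D g * f g \<partial>haar_su2)"
      using null_R[OF f(1)]
      by (subst Bochner_Integration.integral_diff) (auto intro!: haar_su2_integrable continuous_intros cD cf)
    also have "\<dots> \<le> (\<integral>g. \<bar>D g\<bar> * e \<partial>haar_su2)"
    proof (rule integral_mono)
      fix g
      have "D g * D g - D g * f g = D g * (D g - f g)" by (simp add: algebra_simps)
      also have "\<dots> \<le> \<bar>D g\<bar> * \<bar>D g - f g\<bar>" by (metis abs_ge_self abs_mult)
      also have "\<dots> \<le> \<bar>D g\<bar> * e" using f(2)[of g] by (intro mult_left_mono) auto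
      finally show "D g * D g - D g * f g \<le> \<bar>D g\<bar> * e" .
    qed (auto intro!: haar_su2_integrable continuous_intros cD cf)
    also have "\<dots> = ?A * e" by simp
    also have "\<dots> < ?N" by (rule e(2))
    finally show False by simp
  qed
  then have "D g * D g = 0" for g
    by (intro haar_su2_full_support[where F = "\<lambda>g. D g * D g"]) (auto intro!: continuous_intros cD)
  then show ?thesis by (auto simp: D_def)
qed

section \<open>Riemann sums and the Laguerre limit\<close>

text \<open>The number \<open>n\<close> with \<open>n * t < x \<le> (n + 1) * t\<close>. With it a series over \<open>n\<close>
  becomes the integral of a step function, and dominated convergence replaces a discussion of Riemann
  sums. Intervals closed on the right fill \<open>{0<..}\<close> exactly.\<close>

definition cell :: "real \<Rightarrow> real \<Rightarrow> nat" where
  "cell t x = nat (\<lceil>x / t\<rceil> - 1)"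

lemma cell_bounds:
  assumes "0 < t" "0 < x"
  shows "real (cell t x) * t < x" "x \<le> real (cell t x + 1) * t"
proof -
  have "0 < x / t" using assms by simp
  then have "1 \<le> \<lceil>x / t\<rceil>" by linarith
  then have n: "real (cell t x) = of_int \<lceil>x / t\<rceil> - 1" by (simp add: cell_def)
  have "real (cell t x) < x / t" "x / t \<le> real (cell t x) + 1"
    unfolding n using ceiling_correct[of "x / t"] by auto
  then show "real (cell t x) * t < x" "x \<le> real (cell t x + 1) * t"
    using assms by (simp_all add: field_simps)
qed

lemma cell_unique:
  assumes "0 < t" "real n * t < x" "x \<le> real (n + 1) * t"
  shows "cell t x = n"
proof -
  have "\<lceil>x / t\<rceil> = int n + 1"
    using assms by (intro ceiling_unique) (auto simp: field_simps)
  then show ?thesis by (simp add: cell_def)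
qed

lemma
  assumes t: "0 < t" and c: "summable (\<lambda>n. \<bar>c n\<bar>)"
  shows integrable_cell: "integrable lborel (\<lambda>x. indicator {0<..} x * c (cell t x) :: real)"
    and integral_cell: "(\<integral>x. indicator {0<..} x * c (cell t x) \<partial>lborel) = t * (\<Sum>n. c n)"
proof -
  define f where "f n x = c n * indicator {real n * t<..real (n + 1) * t} x" for n and x :: real
  have f: "f n x = (if 0 < x \<and> n = cell t x then c n else 0)" for n x
  proof (cases "0 < x")
    case True
    have "x \<in> {real n * t<..real (n + 1) * t} \<longleftrightarrow> n = cell t x"
      unfolding greaterThanAtMost_iff using cell_bounds[OF t True] cell_unique[OF t] by blast
    then show ?thesis
      using True unfolding f_def by (simp only: indicator_simps split: if_split) auto
  next
    case False
    moreover have "0 \<le> real n * t" using t by simp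
    ultimately have "\<not> real n * t < x" by linarith
    then show ?thesis using False by (simp add: f_def)
  qed
  have s: "(\<lambda>x. \<Sum>n. f n x) = (\<lambda>x. indicator {0<..} x * c (cell t x))"
  proof
    fix x
    have "(\<Sum>n. f n x) = (\<Sum>n\<in>{cell t x}. f n x)"
      by (rule suminf_finite) (auto simp: f)
    then show "(\<Sum>n. f n x) = indicator {0<..} x * c (cell t x)"
      by (simp add: f)
  qed
  have i: "integrable lborel (f n)" for n
    unfolding f_def using t by (intro integrable_mult_right integrable_real_indicator) (auto simp: emeasure_lborel_Ioc)
  have m: "(\<integral>x. indicator {real n * t<..real (n + 1) * t} x \<partial>lborel) = t" for n
    using t by (simp add: algebra_simps)
  have n: "(\<integral>x. norm (f n x) \<partial>lborel) = \<bar>c n\<bar> * t" for n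
    unfolding f_def using m[of n] by (simp add: abs_mult)
  have v: "(\<integral>x. f n x \<partial>lborel) = c n * t" for n
    unfolding f_def using m[of n] by simp
  have a: "AE x in lborel. summable (\<lambda>n. norm (f n x))"
  proof (intro AE_I2)
    fix x
    show "summable (\<lambda>n. norm (f n x))"
      by (rule summable_finite[of "{cell t x}"]) (auto simp: f)
  qed
  have b: "summable (\<lambda>n. \<integral>x. norm (f n x) \<partial>lborel)"
    unfolding n by (intro summable_mult2 c)
  show "integrable lborel (\<lambda>x. indicator {0<..} x * c (cell t x))"
    using integrable_suminf[OF i a b] unfolding s .
  show "(\<integral>x. indicator {0<..} x * c (cell t x) \<partial>lborel) = t * (\<Sum>n. c n)"
    using integral_suminf[OF i a b] summable_rabs_cancel[OF c] unfolding s v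
    by (simp add: suminf_mult mult.commute)
qed

lemma has_bochner_integral_exp_decay:
  fixes b :: real
  assumes "0 < b"
  shows "has_bochner_integral lborel (\<lambda>x. indicator {0<..} x * exp (- b * x)) (1 / b)"
proof (rule has_bochner_integral_nn_integral)
  have "((\<lambda>x. - exp (- b * x) / b) \<longlongrightarrow> - 0 / b) at_top"
    using assms
    by (intro tendsto_intros filterlim_compose[OF exp_at_bot] filterlim_tendsto_neg_mult_at_bot[OF tendsto_const _ filterlim_ident]) auto
  then have "(\<integral>\<^sup>+x. ennreal (exp (- b * x)) * indicator {0..} x \<partial>lborel) = 0 - (- exp (- b * 0) / b)"
    using assms by (intro nn_integral_FTC_atLeast) (auto intro!: derivative_eq_intros)
  moreover have "(\<integral>\<^sup>+x. ennreal (exp (- b * x)) * indicator {0..} x \<partial>lborel)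
      = (\<integral>\<^sup>+x. ennreal (indicator {0<..} x * exp (- b * x)) \<partial>lborel)"
    using AE_lborel_singleton[of 0]
    by (intro nn_integral_cong_AE) (auto simp: indicator_def elim!: eventually_mono)
  ultimately show "(\<integral>\<^sup>+x. ennreal (indicator {0<..} x * exp (- b * x)) \<partial>lborel) = ennreal (1 / b)"
    by simp
qed (use assms in auto)

definition laguerre :: "nat \<Rightarrow> real \<Rightarrow> real" where
  "laguerre k X = (\<Sum>i\<le>k. (-1) ^ i * real (k choose i) * (X ^ i / fact i))"

text \<open>The hockey-stick identity is the Cauchy product with the geometric series.\<close>

lemma binomial_column_series:
  fixes w :: real
  assumes w: "0 \<le> w" "w < 1"
  shows "(\<lambda>k. real (k choose i) * w ^ k) sums (w ^ i / (1 - w) ^ (i + 1))"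
proof (induction i)
  case 0
  then show ?case using geometric_sums[of w] w by simp
next
  case (Suc i)
  have 1: "summable (\<lambda>k. norm (real (k choose i) * w ^ k))"
    using sums_summable[OF Suc] w by simp
  have 2: "summable (\<lambda>k. norm (w ^ k))"
    using w by (simp add: summable_geometric)
  have "(\<Sum>j\<le>k. real (j choose i) * w ^ j * w ^ (k - j)) = real (Suc k choose Suc i) * w ^ k" for k
  proof -
    have "(\<Sum>j\<le>k. real (j choose i) * w ^ j * w ^ (k - j)) = (\<Sum>j\<le>k. real (j choose i)) * w ^ k"
      unfolding sum_distrib_right
      by (intro sum.cong refl) (simp add: mult.assoc flip: power_add)
    also have "(\<Sum>j\<le>k. real (j choose i)) = real (Suc k choose Suc i)"
      by (simp only: sum_choose_upper flip: of_nat_sum)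
    finally show ?thesis .
  qed
  with Cauchy_product_sums[OF 1 2]
  have "(\<lambda>k. real (Suc k choose Suc i) * w ^ k) sums (w ^ i / (1 - w) ^ (i + 1) * (1 / (1 - w)))"
    using sums_unique[OF Suc] suminf_geometric[of w] w by (simp only: abs_of_nonneg real_norm_def)
  then have "(\<lambda>k. w * (real (Suc k choose Suc i) * w ^ k)) sums (w * (w ^ i / (1 - w) ^ (i + 1) * (1 / (1 - w))))"
    by (rule sums_mult)
  then have "(\<lambda>k. real (Suc k choose Suc i) * w ^ Suc k) sums (w ^ Suc i / (1 - w) ^ (Suc i + 1))"
    by (simp add: mult_ac)
  then show ?case
    by (subst (asm) sums_Suc_iff) simp
qed

text \<open>Summed over \<open>k\<close> first, the \<open>i\<close>-th coefficients form a binomial series, and what remains is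
  the exponential series in \<open>- X * w / (1 - w)\<close>.\<close>

lemma laguerre_generating_function:
  assumes w: "0 \<le> w" "w < 1"
  shows "(\<lambda>k. w ^ k * laguerre k X) sums (exp (- X * w / (1 - w)) / (1 - w))"
proof -
  define A where "A i k = (- X) ^ i / fact i * (real (k choose i) * w ^ k)" for i k
  have col: "(\<lambda>k. A i k) sums ((- X) ^ i / fact i * (w ^ i / (1 - w) ^ (i + 1)))" for i
    unfolding A_def by (intro sums_mult binomial_column_series w)
  have ncol: "(\<lambda>k. norm (A i k)) sums (\<bar>X\<bar> ^ i / fact i * (w ^ i / (1 - w) ^ (i + 1)))" for i
    using sums_mult[OF binomial_column_series[OF w], of "\<bar>X\<bar> ^ i / fact i" i] w
    by (simp add: A_def abs_mult power_abs)
  have ex: "(\<lambda>i. Y ^ i / fact i * (w ^ i / (1 - w) ^ (i + 1))) sums (exp (Y * w / (1 - w)) / (1 - w))" for Y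
    using sums_divide[OF exp_converges[of "Y * w / (1 - w)"], of "1 - w"] w
    by (simp add: power_mult_distrib power_divide divide_inverse power_inverse mult_ac)
  let ?M = "count_space (UNIV :: nat set)"
  have i: "integrable ?M (A i)" for i
    using sums_summable[OF ncol] by (simp add: integrable_count_space_nat_iff)
  have fin: "A i k = 0" if "i \<notin> {..k}" for i k
    using that by (simp add: A_def)
  have a: "AE k in ?M. summable (\<lambda>i. norm (A i k))"
    using fin by (intro AE_I2 summable_finite[of "{..k}" for k]) auto
  have int: "integral\<^sup>L ?M f = suminf f" if "integrable ?M f" for f :: "nat \<Rightarrow> real"
    using sums_integral_count_space_nat[OF that] by (simp add: sums_iff)
  have "(\<integral>k. norm (A i k) \<partial>?M) = \<bar>X\<bar> ^ i / fact i * (w ^ i / (1 - w) ^ (i + 1))" for i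
    using int[OF integrable_norm[OF i]] ncol[of i] by (simp add: sums_iff)
  then have b: "summable (\<lambda>i. \<integral>k. norm (A i k) \<partial>?M)"
    using sums_summable[OF ex[of "\<bar>X\<bar>"]] by simp
  have row: "(\<Sum>i. A i k) = w ^ k * laguerre k X" for k
  proof -
    have "(\<Sum>i. A i k) = (\<Sum>i\<le>k. A i k)" using fin by (intro suminf_finite) auto
    also have "\<dots> = w ^ k * laguerre k X"
      unfolding laguerre_def sum_distrib_left A_def
      by (intro sum.cong refl) (simp add: power_minus[of X])
    finally show ?thesis .
  qed
  have "integrable ?M (\<lambda>k. w ^ k * laguerre k X)"
    using integrable_suminf[OF i a b] unfolding row .
  from sums_integral_count_space_nat[OF this]
  have "(\<lambda>k. w ^ k * laguerre k X) sums (\<integral>k. (\<Sum>i. A i k) \<partial>?M)"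
    unfolding row .
  also have "(\<integral>k. (\<Sum>i. A i k) \<partial>?M) = (\<Sum>i. \<integral>k. A i k \<partial>?M)"
    by (rule integral_suminf[OF i a b])
  also have "\<dots> = (\<Sum>i. (- X) ^ i / fact i * (w ^ i / (1 - w) ^ (i + 1)))"
    using int[OF i] col by (simp add: sums_iff)
  also have "\<dots> = exp (- X * w / (1 - w)) / (1 - w)"
    using ex[of "- X"] by (simp add: sums_iff)
  finally show ?thesis .
qed

text \<open>With \<open>n\<close> of order \<open>1 / t\<close> and \<open>s\<^sup>2\<close> of order \<open>t\<close>, \<open>(n + k choose i) * s ^ (2 * i)\<close> tends to
  \<open>(x * \<rho>) ^ i / fact i\<close> and \<open>c ^ n = (1 - s\<^sup>2) ^ (n / 2)\<close> to an exponential.\<close>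

lemma disc_poly_tendsto_laguerre:
  fixes t s c :: "nat \<Rightarrow> real" and n :: "nat \<Rightarrow> nat"
  assumes t: "t \<longlonglongrightarrow> 0" "\<And>j. 0 < t j"
    and n: "(\<lambda>j. real (n j) * t j) \<longlonglongrightarrow> x"
    and s: "(\<lambda>j. (s j)\<^sup>2 / t j) \<longlonglongrightarrow> \<rho>"
    and c: "\<And>j. (c j)\<^sup>2 = 1 - (s j)\<^sup>2" "\<forall>\<^sub>F j in sequentially. 0 < c j"
  shows "(\<lambda>j. disc_poly (n j) k (c j) (s j)) \<longlonglongrightarrow> exp (- (x * \<rho>) / 2) * laguerre k (x * \<rho>)"
proof -
  define u where "u j = (s j)\<^sup>2" for j
  define X where "X = x * \<rho>"
  have u0: "u \<longlonglongrightarrow> 0"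
  proof -
    have "(\<lambda>j. (s j)\<^sup>2 / t j * t j) \<longlonglongrightarrow> \<rho> * 0" by (intro tendsto_intros s t)
    moreover have "(s j)\<^sup>2 / t j * t j = u j" for j using t(2)[of j] by (simp add: u_def)
    ultimately show ?thesis by (simp add: u_def[abs_def])
  qed
  have nu: "(\<lambda>j. real (n j) * u j) \<longlonglongrightarrow> X"
  proof -
    have "(\<lambda>j. (real (n j) * t j) * ((s j)\<^sup>2 / t j)) \<longlonglongrightarrow> x * \<rho>" by (intro tendsto_intros n s)
    moreover have "(real (n j) * t j) * ((s j)\<^sup>2 / t j) = real (n j) * u j" for j
      using t(2)[of j] by (simp add: u_def)
    ultimately show ?thesis by (simp add: X_def)
  qed
  have A: "(\<lambda>j. real ((n j + k) choose i) * u j ^ i) \<longlonglongrightarrow> X ^ i / fact i" for i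
  proof -
    have "real ((n j + k) choose i) * u j ^ i = (\<Prod>l = 0..<i. real (n j) * u j + (real k - real l) * u j) / fact i" for j
    proof -
      have "real ((n j + k) choose i) = (\<Prod>l = 0..<i. real (n j + k) - real l) / fact i"
        unfolding binomial_gbinomial gbinomial_prod_rev ..
      then have "real ((n j + k) choose i) * u j ^ i = (\<Prod>l = 0..<i. (real (n j + k) - real l) * u j) / fact i"
        by (simp add: prod.distrib)
      then show ?thesis by (simp add: algebra_simps)
    qed
    moreover have "(\<lambda>j. (\<Prod>l = 0..<i. real (n j) * u j + (real k - real l) * u j) / fact i)
       \<longlonglongrightarrow> (\<Prod>l = 0..<i. X + (real k - real l) * 0) / fact i"
      by (intro tendsto_intros nu u0) simp
    ultimately show ?thesis by simp
  qed
  have B: "(\<lambda>j. c j ^ n j) \<longlonglongrightarrow> exp (- X / 2)"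
  proof -
    have ev: "\<forall>\<^sub>F j in sequentially. 0 < c j \<and> u j < 1"
      using c(2) order_tendstoD(2)[OF u0, of 1] by (simp add: eventually_conj)
    have "(\<lambda>j. real (n j) / 2 * ln (1 - u j)) \<longlonglongrightarrow> - X / 2"
    proof (rule tendsto_sandwich)
      show "\<forall>\<^sub>F j in sequentially. - (real (n j) * u j) / (2 * (1 - u j)) \<le> real (n j) / 2 * ln (1 - u j)"
        using ev
      proof eventually_elim
        case (elim j)
        have "ln (1 / (1 - u j)) \<le> 1 / (1 - u j) - 1" using elim by (intro ln_le_minus_one) auto
        then have "- u j / (1 - u j) \<le> ln (1 - u j)" using elim by (simp add: ln_div field_simps)
        from mult_left_mono[OF this, of "real (n j) / 2"] show ?case by (simp add: field_simps)
      qed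
      show "\<forall>\<^sub>F j in sequentially. real (n j) / 2 * ln (1 - u j) \<le> - (real (n j) * u j) / 2"
        using ev
      proof eventually_elim
        case (elim j)
        have "ln (1 - u j) \<le> - u j" using ln_le_minus_one[of "1 - u j"] elim by simp
        from mult_left_mono[OF this, of "real (n j) / 2"] show ?case by simp
      qed
      have "(\<lambda>j. - (real (n j) * u j) / (2 * (1 - u j))) \<longlonglongrightarrow> - X / (2 * (1 - 0))"
        by (intro tendsto_intros nu u0) simp
      then show "(\<lambda>j. - (real (n j) * u j) / (2 * (1 - u j))) \<longlonglongrightarrow> - X / 2" by simp
      show "(\<lambda>j. - (real (n j) * u j) / 2) \<longlonglongrightarrow> - X / 2"
        by (intro tendsto_intros nu) simp
    qed
    then have "(\<lambda>j. exp (real (n j) / 2 * ln (1 - u j))) \<longlonglongrightarrow> exp (- X / 2)"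
      by (intro tendsto_intros)
    moreover have "\<forall>\<^sub>F j in sequentially. exp (real (n j) / 2 * ln (1 - u j)) = c j ^ n j"
      using ev
    proof eventually_elim
      case (elim j)
      have "ln (1 - u j) = 2 * ln (c j)"
        using elim c(1)[of j] by (simp add: u_def ln_realpow flip: c(1))
      then have "exp (real (n j) / 2 * ln (1 - u j)) = exp (real (n j) * ln (c j))" by simp
      then show ?case using elim by (simp add: exp_of_nat_mult)
    qed
    ultimately show ?thesis by (rule Lim_transform_eventually)
  qed
  have "(\<lambda>j. \<Sum>i\<le>k. (-1) ^ i * real (k choose i) * (real ((n j + k) choose i) * u j ^ i) * (c j ^ n j * (1 - u j) ^ (k - i)))
     \<longlonglongrightarrow> (\<Sum>i\<le>k. (-1) ^ i * real (k choose i) * (X ^ i / fact i) * (exp (- X / 2) * (1 - 0) ^ (k - i)))"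
    by (intro tendsto_intros A B u0)
  moreover have "(\<Sum>i\<le>k. (-1) ^ i * real (k choose i) * (real ((n j + k) choose i) * u j ^ i) * (c j ^ n j * (1 - u j) ^ (k - i)))
     = disc_poly (n j) k (c j) (s j)" for j
    unfolding disc_poly_def
  proof (intro sum.cong refl)
    fix i
    have "u j ^ i = s j ^ (2 * i)" "(1 - u j) ^ (k - i) = c j ^ (2 * (k - i))"
      by (simp_all only: u_def power_mult c(1))
    then show "(-1) ^ i * real (k choose i) * (real ((n j + k) choose i) * u j ^ i) * (c j ^ n j * (1 - u j) ^ (k - i))
      = (- 1) ^ i * real ((n j + k) choose i) * real (k choose i) * c j ^ (n j + 2 * (k - i)) * s j ^ (2 * i)"
      by (simp only: power_add mult_ac)
  qed
  moreover have "(\<Sum>i\<le>k. (-1) ^ i * real (k choose i) * (X ^ i / fact i) * (exp (- X / 2) * (1 - 0) ^ (k - i)))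
     = exp (- X / 2) * laguerre k X"
    unfolding laguerre_def sum_distrib_left by (intro sum.cong refl) simp
  ultimately show ?thesis by (simp add: X_def)
qed

lemma sin_scaled_tendsto:
  fixes t r :: "nat \<Rightarrow> real"
  assumes t: "t \<longlonglongrightarrow> 0" "\<And>j. 0 < t j" and r: "r \<longlonglongrightarrow> r0"
  shows "(\<lambda>j. (sin (sqrt (t j) * r j))\<^sup>2 / t j) \<longlonglongrightarrow> r0\<^sup>2"
proof -
  have st: "(\<lambda>j. sqrt (t j)) \<longlonglongrightarrow> 0" using tendsto_real_sqrt[OF t(1)] by simp
  have "(\<lambda>j. sin (sqrt (t j) * r j) / sqrt (t j) - r j) \<longlonglongrightarrow> 0"
  proof (rule Lim_null_comparison)
    show "\<forall>\<^sub>F j in sequentially. norm (sin (sqrt (t j) * r j) / sqrt (t j) - r j) \<le> sqrt (t j) * (r j)\<^sup>2 / 2"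
    proof (intro always_eventually allI)
      fix j
      define q where "q = sqrt (t j)"
      have q: "0 < q" using t(2)[of j] by (simp add: q_def)
      have le: "\<bar>sin (q * r j) - q * r j\<bar> \<le> (q * r j)\<^sup>2 / 2"
        using Maclaurin_sin_bound[of "q * r j" 2] by (simp add: numeral_2_eq_2 sin_coeff_def)
      have "\<bar>sin (q * r j) / q - r j\<bar> = \<bar>(sin (q * r j) - q * r j) / q\<bar>"
        using q by (simp add: field_simps)
      also have "\<dots> = \<bar>sin (q * r j) - q * r j\<bar> / q"
        using q by (simp add: abs_divide)
      also have "\<dots> \<le> (q * r j)\<^sup>2 / 2 / q"
        using q by (intro divide_right_mono le) simp
      also have "\<dots> = q * (r j)\<^sup>2 / 2" using q by (simp add: power2_eq_square)
      finally show "norm (sin (sqrt (t j) * r j) / sqrt (t j) - r j) \<le> sqrt (t j) * (r j)\<^sup>2 / 2"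
        by (simp add: q_def)
    qed
    have "(\<lambda>j. sqrt (t j) * (r j)\<^sup>2 / 2) \<longlonglongrightarrow> 0 * r0\<^sup>2 / 2" by (intro tendsto_intros st r) simp
    then show "(\<lambda>j. sqrt (t j) * (r j)\<^sup>2 / 2) \<longlonglongrightarrow> 0" by simp
  qed
  from tendsto_add[OF this r] have "(\<lambda>j. sin (sqrt (t j) * r j) / sqrt (t j)) \<longlonglongrightarrow> r0" by simp
  then have "(\<lambda>j. (sin (sqrt (t j) * r j) / sqrt (t j))\<^sup>2) \<longlonglongrightarrow> r0\<^sup>2" by (intro tendsto_intros)
  moreover have "(sin (sqrt (t j) * r j) / sqrt (t j))\<^sup>2 = (sin (sqrt (t j) * r j))\<^sup>2 / t j" for j
    using t(2)[of j] by (simp add: power_divide)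
  ultimately show ?thesis by simp
qed

section \<open>The limit at small times\<close>

text \<open>The step function whose integral over \<open>x\<close> is \<open>t\<^sup>2\<close> times the \<open>k\<close>-th inner series at the rescaled
  point; \<open>x\<close> plays the role of \<open>n * t\<close>.\<close>

definition scaled_term :: "real \<Rightarrow> real \<Rightarrow> real \<Rightarrow> nat \<Rightarrow> real \<Rightarrow> real" where
  "scaled_term t r z k x = indicator {0<..} x * (t * (heat_coeff (cell t x) k t *
     (cos (real (cell t x) * (t * z)) * disc_poly (cell t x) k (cos (sqrt t * r)) (sin (sqrt t * r)))))"

text \<open>The contribution of the \<open>k\<close>-th Landau level to the Heisenberg kernel.\<close>

definition heis_term :: "real \<Rightarrow> real \<Rightarrow> nat \<Rightarrow> real \<Rightarrow> real" where
  "heis_term r z k x = indicator {0<..} x * (2 * x * exp (- (4 * real k + 2) * x) *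
     (cos (x * z) * (exp (- (x * r\<^sup>2) / 2) * laguerre k (x * r\<^sup>2))))"

definition majorant :: "nat \<Rightarrow> real" where
  "majorant k = 2 * exp 2 * (1 / real (2 * k + 1) + real (2 * k + 1) / (real (k + 1))\<^sup>2)"

text \<open>Since \<open>decay_rate n k = (4 * k + 2) * (n + 1) + 4 * k\<^sup>2 - 2\<close> and \<open>(n + 1) * t \<ge> x\<close>, the exponential
  factor is at most \<open>exp 2 * exp (- (4 * k + 2) * x) * exp (- 4 * k\<^sup>2 * t)\<close>. Half of the decay in \<open>x\<close>
  absorbs the factor \<open>x\<close>, and the decay in \<open>t\<close> turns the term \<open>(2 * k + 1) * t\<close> of the dimension
  into \<open>(2 * k + 1) / (k + 1)\<^sup>2\<close>.\<close>

lemma scaled_heat_coeff_le: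
  assumes t: "0 < t" "t \<le> 1" and x: "0 < x"
  shows "t * heat_coeff (cell t x) k t \<le> majorant k * exp (- real (2 * k + 1) * x)"
proof -
  define n where "n = cell t x"
  define d where "d = real (2 * k + 1)"
  define b where "b = d / (real (k + 1))\<^sup>2"
  have d: "1 \<le> d" "real (2 * k + 1) = d" by (simp_all add: d_def)
  have b: "0 \<le> b" by (simp add: b_def d_def)
  have n: "real n * t \<le> x" "x \<le> real (n + 1) * t"
    unfolding n_def using cell_bounds[OF t(1) x] by simp_all
  have sp: "decay_rate n k = 2 * d * real (n + 1) + 4 * (real k)\<^sup>2 - 2"
    by (simp add: decay_rate_def d_def power2_eq_square algebra_simps)
  have "- decay_rate n k * t = 2 * t - 2 * d * (real (n + 1) * t) - 4 * (real k)\<^sup>2 * t"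
    unfolding sp by (simp add: algebra_simps)
  also have "\<dots> \<le> 2 + (- (2 * d * x)) + (- (4 * (real k)\<^sup>2 * t))"
    using t mult_left_mono[OF n(2), of "2 * d"] d by linarith
  finally have "exp (- decay_rate n k * t) \<le> exp (2 + (- (2 * d * x)) + (- (4 * (real k)\<^sup>2 * t)))"
    by simp
  then have e: "exp (- decay_rate n k * t) \<le> exp 2 * exp (- (2 * d * x)) * exp (- (4 * (real k)\<^sup>2 * t))"
    unfolding exp_add .
  have te: "t * exp (- (4 * (real k)\<^sup>2 * t)) \<le> 1 / (real (k + 1))\<^sup>2"
  proof (cases "k = 0")
    case True
    then show ?thesis using t by simp
  next
    case False
    then have "real (k + 1) \<le> 2 * real k" by simp
    then have "(real (k + 1))\<^sup>2 \<le> (2 * real k)\<^sup>2" by (intro power_mono) auto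
    then have k: "(real (k + 1))\<^sup>2 \<le> 4 * (real k)\<^sup>2" by (simp add: power_mult_distrib)
    \<comment> \<open>The function \<open>y * exp (- y)\<close> is at most \<open>1\<close>.\<close>
    have "(real (k + 1))\<^sup>2 * t \<le> 4 * (real k)\<^sup>2 * t" using t k by (intro mult_right_mono) auto
    also have "\<dots> \<le> exp (4 * (real k)\<^sup>2 * t)"
      using exp_ge_add_one_self[of "4 * (real k)\<^sup>2 * t"] by linarith
    finally have "(real (k + 1))\<^sup>2 * t * exp (- (4 * (real k)\<^sup>2 * t)) \<le> 1"
      by (simp add: exp_minus field_simps)
    then show ?thesis by (simp add: pos_le_divide_eq mult_ac)
  qed
  have xe: "x * exp (- (2 * d * x)) \<le> 1 / d * exp (- (d * x))"
  proof -
    have "d * x \<le> exp (d * x)" using exp_ge_add_one_self[of "d * x"] by linarith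
    then have "x * exp (- (d * x)) \<le> 1 / d" using d by (simp add: exp_minus field_simps)
    then have "x * exp (- (d * x)) * exp (- (d * x)) \<le> 1 / d * exp (- (d * x))"
      by (intro mult_right_mono) auto
    then show ?thesis by (simp add: mult.assoc flip: exp_add)
  qed
  have le: "exp (- (2 * d * x)) \<le> exp (- (d * x))" using d x by simp
  have "t * (real (2 * k + n + 1)) = real n * t + d * t" by (simp add: d_def algebra_simps)
  also have "\<dots> \<le> x + d * t" using n by simp
  finally have tn: "t * real (2 * k + n + 1) \<le> x + d * t" .
  have "t * heat_coeff n k t = zonal_weight n * ((t * real (2 * k + n + 1)) * exp (- decay_rate n k * t))"
    by (simp add: heat_coeff_def)
  also have "\<dots> \<le> 2 * ((x + d * t) * (exp 2 * exp (- (2 * d * x)) * exp (- (4 * (real k)\<^sup>2 * t))))"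
    using t x d by (intro mult_mono tn e) (auto simp: zonal_weight_def)
  also have "\<dots> = 2 * exp 2 * (x * exp (- (2 * d * x)) * exp (- (4 * (real k)\<^sup>2 * t))
       + d * (t * exp (- (4 * (real k)\<^sup>2 * t))) * exp (- (2 * d * x)))"
    by (simp add: algebra_simps)
  also have "\<dots> \<le> 2 * exp 2 * (1 / d * exp (- (d * x)) * 1 + d * (1 / (real (k + 1))\<^sup>2) * exp (- (d * x)))"
    using t x d by (intro mult_left_mono add_mono mult_mono xe te le) auto
  also have "\<dots> = majorant k * exp (- real (2 * k + 1) * x)"
    by (simp only: majorant_def d(2)) (simp add: algebra_simps)
  finally show ?thesis by (simp add: n_def)
qed

lemma majorant_nonneg: "0 \<le> majorant k"
  by (simp add: majorant_def)

lemma abs_scaled_term_le: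
  assumes t: "0 < t" "t \<le> 1"
  shows "\<bar>scaled_term t r z k x\<bar> \<le> majorant k * (indicator {0<..} x * exp (- real (2 * k + 1) * x))"
proof (cases "0 < x")
  case True
  let ?n = "cell t x"
  have "\<bar>cos (real ?n * (t * z))\<bar> * \<bar>disc_poly ?n k (cos (sqrt t * r)) (sin (sqrt t * r))\<bar> \<le> 1 * 1"
    by (intro mult_mono abs_disc_poly_le_1) auto
  then have "(t * heat_coeff ?n k t) * (\<bar>cos (real ?n * (t * z))\<bar> * \<bar>disc_poly ?n k (cos (sqrt t * r)) (sin (sqrt t * r))\<bar>)
      \<le> (majorant k * exp (- real (2 * k + 1) * x)) * 1"
    using t heat_coeff_nonneg[of ?n k t] majorant_nonneg[of k]
    by (intro mult_mono scaled_heat_coeff_le True) auto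
  then show ?thesis
    using t True heat_coeff_nonneg[of ?n k t] by (simp add: scaled_term_def abs_mult mult_ac)
qed (simp add: scaled_term_def)

lemma integral_majorant:
  "has_bochner_integral lborel (\<lambda>x. majorant k * (indicator {0<..} x * exp (- real (2 * k + 1) * x)))
     (majorant k / real (2 * k + 1))"
  using has_bochner_integral_mult_right[OF has_bochner_integral_exp_decay[of "real (2 * k + 1)"], of "majorant k"]
  by simp

lemma summable_majorant: "summable (\<lambda>k. majorant k / real (2 * k + 1))"
proof (rule summable_comparison_test'[where N = 0])
  have "summable (\<lambda>n. inverse (real n ^ 2))" by (rule inverse_power_summable) simp
  then have "summable (\<lambda>n. inverse (real (Suc n) ^ 2))" by (subst summable_Suc_iff)
  then show "summable (\<lambda>k. 4 * exp 2 * inverse (real (Suc k) ^ 2) :: real)" by (rule summable_mult)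
  fix k
  have "2 * E * (1 / d + d / m) / d = 2 * E * (1 / d\<^sup>2 + 1 / m)" if "d > 0" for d m E :: real
    using that by (simp add: power2_eq_square add_divide_distrib distrib_left)
  then have "majorant k / real (2 * k + 1) = 2 * exp 2 * (1 / (real (2 * k + 1))\<^sup>2 + 1 / (real (k + 1))\<^sup>2)"
    unfolding majorant_def by simp
  also have "\<dots> \<le> 2 * exp 2 * (1 / (real (k + 1))\<^sup>2 + 1 / (real (k + 1))\<^sup>2)"
    by (intro mult_left_mono add_mono divide_left_mono power_mono) auto
  also have "\<dots> = 4 * exp 2 * inverse (real (Suc k) ^ 2)"
    by (simp add: divide_inverse)
  finally show "norm (majorant k / real (2 * k + 1)) \<le> 4 * exp 2 * inverse (real (Suc k) ^ 2)"
    using majorant_nonneg[of k] by simp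
qed

text \<open>For fixed \<open>x\<close> the index \<open>n\<close> of the cell of \<open>x\<close> satisfies \<open>n * t \<longlonglongrightarrow> x\<close>, so that
  \<open>decay_rate n k * t\<close> tends to \<open>(4 * k + 2) * x\<close> and \<open>t\<close> times the dimension to \<open>x\<close>. The weight is
  eventually \<open>2\<close> because \<open>x\<close> is positive.\<close>

lemma scaled_term_tendsto:
  fixes t r z :: "nat \<Rightarrow> real"
  assumes t: "t \<longlonglongrightarrow> 0" "\<And>j. 0 < t j" and r: "r \<longlonglongrightarrow> r0" and z: "z \<longlonglongrightarrow> z0"
  shows "(\<lambda>j. scaled_term (t j) (r j) (z j) k x) \<longlonglongrightarrow> heis_term r0 z0 k x"
proof (cases "0 < x")
  case x: True
  define n where "n j = cell (t j) x" for j
  have nt: "(\<lambda>j. real (n j) * t j) \<longlonglongrightarrow> x"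
  proof (rule tendsto_sandwich)
    show "\<forall>\<^sub>F j in sequentially. x - t j \<le> real (n j) * t j"
      using cell_bounds(2)[OF t(2) x] by (intro always_eventually) (simp add: n_def algebra_simps)
    show "\<forall>\<^sub>F j in sequentially. real (n j) * t j \<le> x"
      using cell_bounds(1)[OF t(2) x] by (intro always_eventually) (simp add: n_def less_imp_le)
    show "(\<lambda>j. x - t j) \<longlonglongrightarrow> x" using tendsto_diff[OF tendsto_const[of x] t(1)] by simp
  qed simp
  have w: "\<forall>\<^sub>F j in sequentially. 2 = zonal_weight (n j)"
  proof -
    have "\<forall>\<^sub>F j in sequentially. 0 < real (n j) * t j" by (rule order_tendstoD(1)[OF nt x])
    then show ?thesis
      by (rule eventually_mono) (metis mult_zero_left of_nat_0 order_less_irrefl zonal_weight_def)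
  qed
  have ex: "- decay_rate (n j) k * t j = - (4 * real k * (real k + 1) * t j + (4 * real k + 2) * (real (n j) * t j))" for j
    by (simp add: decay_rate_def algebra_simps)
  have e: "(\<lambda>j. exp (- decay_rate (n j) k * t j)) \<longlonglongrightarrow> exp (- (4 * real k * (real k + 1) * 0 + (4 * real k + 2) * x))"
    unfolding ex by (intro tendsto_intros t nt)
  have h: "(\<lambda>j. sqrt (t j) * r j) \<longlonglongrightarrow> 0"
    using tendsto_mult[OF tendsto_real_sqrt[OF t(1)] r] by simp
  have "(\<lambda>j. cos (sqrt (t j) * r j)) \<longlonglongrightarrow> cos 0" by (intro tendsto_intros h)
  then have c: "\<forall>\<^sub>F j in sequentially. 0 < cos (sqrt (t j) * r j)" by (intro order_tendstoD(1)) auto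
  have D: "(\<lambda>j. disc_poly (n j) k (cos (sqrt (t j) * r j)) (sin (sqrt (t j) * r j)))
      \<longlonglongrightarrow> exp (- (x * r0\<^sup>2) / 2) * laguerre k (x * r0\<^sup>2)"
    by (rule disc_poly_tendsto_laguerre[OF t nt sin_scaled_tendsto[OF t r] _ c]) (simp add: cos_squared_eq)
  have "(\<lambda>j. 2 * ((real (2 * k + 1) * t j + real (n j) * t j) * exp (- decay_rate (n j) k * t j)) *
      (cos ((real (n j) * t j) * z j) * disc_poly (n j) k (cos (sqrt (t j) * r j)) (sin (sqrt (t j) * r j))))
    \<longlonglongrightarrow> 2 * ((real (2 * k + 1) * 0 + x) * exp (- (4 * real k * (real k + 1) * 0 + (4 * real k + 2) * x))) *
      (cos (x * z0) * (exp (- (x * r0\<^sup>2) / 2) * laguerre k (x * r0\<^sup>2)))"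
    by (intro tendsto_intros nt t e D z)
  moreover have "2 * ((real (2 * k + 1) * 0 + x) * exp (- (4 * real k * (real k + 1) * 0 + (4 * real k + 2) * x))) *
      (cos (x * z0) * (exp (- (x * r0\<^sup>2) / 2) * laguerre k (x * r0\<^sup>2))) = heis_term r0 z0 k x"
    using x by (simp add: heis_term_def algebra_simps)
  moreover have "\<forall>\<^sub>F j in sequentially. 2 * ((real (2 * k + 1) * t j + real (n j) * t j) * exp (- decay_rate (n j) k * t j)) *
      (cos ((real (n j) * t j) * z j) * disc_poly (n j) k (cos (sqrt (t j) * r j)) (sin (sqrt (t j) * r j)))
      = scaled_term (t j) (r j) (z j) k x"
    using w
  proof eventually_elim
    case (elim j)
    show ?case
      unfolding scaled_term_def heat_coeff_def n_def[symmetric] elim[symmetric]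
      using x by (simp add: algebra_simps)
  qed
  ultimately show ?thesis
    by (simp only:) (rule Lim_transform_eventually)
qed (simp add: scaled_term_def heis_term_def)

lemma scaled_heat_series:
  assumes t: "0 < t" "t \<le> 1"
  shows "t\<^sup>2 * heat_series t (cyl (sqrt t * r) \<theta> (t * z)) = (\<Sum>k. \<integral>x. scaled_term t r z k x \<partial>lborel)"
    and "scaled_term t r z k \<in> borel_measurable lborel"
    and "\<bar>\<integral>x. scaled_term t r z k x \<partial>lborel\<bar> \<le> majorant k / real (2 * k + 1)"
proof -
  define C where "C k n = t * (heat_coeff n k t * (cos (real n * (t * z)) * disc_poly n k (cos (sqrt t * r)) (sin (sqrt t * r))))" for k n
  have S: "scaled_term t r z k = (\<lambda>x. indicator {0<..} x * C k (cell t x))" for k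
    by (simp add: scaled_term_def C_def fun_eq_iff)
  have C: "summable (\<lambda>n. \<bar>C k n\<bar>)" for k
  proof (rule summable_comparison_test'[where N = 0])
    show "summable (\<lambda>n. t * ((real (2 * k + 1) * exp (- 4 * t) ^ k) * (2 * (real (n + 1) * exp (- 2 * t) ^ n))))"
      using t by (intro summable_mult summable_linear_geometric) simp
    fix n
    have "\<bar>cos (real n * (t * z))\<bar> * \<bar>disc_poly n k (cos (sqrt t * r)) (sin (sqrt t * r))\<bar> \<le> 1 * 1"
      by (intro mult_mono abs_disc_poly_le_1) auto
    then have "heat_coeff n k t * (\<bar>cos (real n * (t * z))\<bar> * \<bar>disc_poly n k (cos (sqrt t * r)) (sin (sqrt t * r))\<bar>)
       \<le> ((real (2 * k + 1) * exp (- 4 * t) ^ k) * (2 * real (n + 1) * exp (- 2 * t) ^ n)) * 1"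
      using heat_coeff_nonneg[of n k t] by (intro mult_mono heat_coeff_le t) auto
    then have le: "heat_coeff n k t * (\<bar>cos (real n * (t * z))\<bar> * \<bar>disc_poly n k (cos (sqrt t * r)) (sin (sqrt t * r))\<bar>)
       \<le> (real (2 * k + 1) * exp (- 4 * t) ^ k) * (2 * (real (n + 1) * exp (- 2 * t) ^ n))"
      by (simp only: mult_1_right mult.assoc)
    have "norm \<bar>C k n\<bar> = t * (heat_coeff n k t * (\<bar>cos (real n * (t * z))\<bar> * \<bar>disc_poly n k (cos (sqrt t * r)) (sin (sqrt t * r))\<bar>))"
      using t heat_coeff_nonneg[of n k t] by (simp add: C_def abs_mult)
    with le show "norm \<bar>C k n\<bar> \<le> t * ((real (2 * k + 1) * exp (- 4 * t) ^ k) * (2 * (real (n + 1) * exp (- 2 * t) ^ n)))"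
      using t by (simp only: mult_left_mono less_imp_le)
  qed
  show "scaled_term t r z k \<in> borel_measurable lborel"
    unfolding S by (rule borel_measurable_integrable[OF integrable_cell[OF t(1) C]])
  have I: "(\<integral>x. scaled_term t r z k x \<partial>lborel) = t * (\<Sum>n. C k n)" for k
    unfolding S by (rule integral_cell[OF t(1) C])
  show bound: "\<bar>\<integral>x. scaled_term t r z k x \<partial>lborel\<bar> \<le> majorant k / real (2 * k + 1)" for k
  proof -
    have "\<bar>\<integral>x. scaled_term t r z k x \<partial>lborel\<bar> \<le> (\<integral>x. \<bar>scaled_term t r z k x\<bar> \<partial>lborel)"
      by (rule integral_abs_bound)
    also have "\<dots> \<le> (\<integral>x. majorant k * (indicator {0<..} x * exp (- real (2 * k + 1) * x)) \<partial>lborel)"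
    proof (rule integral_mono)
      show "integrable lborel (\<lambda>x. \<bar>scaled_term t r z k x\<bar>)"
        unfolding S by (intro integrable_abs integrable_cell[OF t(1) C])
      show "integrable lborel (\<lambda>x. majorant k * (indicator {0<..} x * exp (- real (2 * k + 1) * x)))"
        by (rule integrable.intros[OF integral_majorant])
    qed (rule abs_scaled_term_le[OF t])
    also have "\<dots> = majorant k / real (2 * k + 1)"
      using integral_majorant[of k] by (simp only: has_bochner_integral_iff)
    finally show ?thesis .
  qed
  have "summable (\<lambda>k. \<integral>x. scaled_term t r z k x \<partial>lborel)"
    by (intro summable_comparison_test'[OF summable_majorant, of 0]) (simp only: real_norm_def bound)
  then have sm: "summable (\<lambda>k. \<Sum>n. C k n)"
    unfolding I using t by (auto dest: summable_mult_D)
  have "heat_series t (cyl (sqrt t * r) \<theta> (t * z)) = (\<Sum>k. \<Sum>n. (1 / t) * C k n)"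
    unfolding heat_series_def zonal_cyl C_def using t by simp
  also have "\<dots> = (1 / t) * (\<Sum>k. \<Sum>n. C k n)"
    using summable_rabs_cancel[OF C] sm by (simp only: suminf_mult)
  finally have "t\<^sup>2 * heat_series t (cyl (sqrt t * r) \<theta> (t * z)) = t * (\<Sum>k. \<Sum>n. C k n)"
    using t by (simp add: power2_eq_square)
  then show "t\<^sup>2 * heat_series t (cyl (sqrt t * r) \<theta> (t * z)) = (\<Sum>k. \<integral>x. scaled_term t r z k x \<partial>lborel)"
    unfolding I using sm by (simp only: suminf_mult)
qed

text \<open>The absolute value of the integrand of the Heisenberg kernel at time \<open>1\<close>; it is even in \<open>\<xi>\<close>.\<close>

definition heis_density :: "real \<Rightarrow> real \<Rightarrow> real" where
  "heis_density r \<xi> = \<xi> / sinh \<xi> * exp (- (r\<^sup>2 / 4) * \<xi> * (cosh \<xi> / sinh \<xi>))"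

text \<open>The Laguerre generating function at \<open>w = exp (- 4 * x)\<close> sums the Landau levels to Mehler's
  kernel, where \<open>(1 + w) / (1 - w)\<close> is the hyperbolic cotangent of \<open>2 * x\<close>.\<close>

lemma sum_heis_term:
  "(\<lambda>k. heis_term r z k x) sums (indicator {0<..} x * (cos (x * z) * heis_density r (2 * x) / 2))"
proof (cases "0 < x")
  case x: True
  define E where "E = exp (2 * x)"
  define X where "X = x * r\<^sup>2"
  have E: "1 < E" using x by (simp add: E_def)
  then have EE: "1 < E * E" by (metis less_trans mult_less_cancel_left2 mult.right_neutral mult_strict_mono zero_less_one less_imp_le)
  define w where "w = exp (- 4 * x)"
  have w: "0 \<le> w" "w < 1" "w = 1 / (E * E)" using x by (simp_all add: w_def E_def exp_minus inverse_eq_divide flip: exp_add)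
  have "(\<lambda>k. (2 * x * exp (- 2 * x) * cos (x * z) * exp (- X / 2)) * (w ^ k * laguerre k X)) sums
     ((2 * x * exp (- 2 * x) * cos (x * z) * exp (- X / 2)) * (exp (- X * w / (1 - w)) / (1 - w)))"
    by (intro sums_mult laguerre_generating_function w)
  moreover have "(2 * x * exp (- 2 * x) * cos (x * z) * exp (- X / 2)) * (w ^ k * laguerre k X) = heis_term r z k x" for k
  proof -
    have "exp (- (4 * real k + 2) * x) = exp (- 2 * x) * w ^ k"
      unfolding w_def by (simp add: algebra_simps flip: exp_of_nat_mult exp_add)
    then show ?thesis using x unfolding heis_term_def X_def by (simp add: mult_ac)
  qed
  moreover have "(2 * x * exp (- 2 * x) * cos (x * z) * exp (- X / 2)) * (exp (- X * w / (1 - w)) / (1 - w))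
     = indicator {0<..} x * (cos (x * z) * heis_density r (2 * x) / 2)"
  proof -
    have i: "exp (- 2 * x) = 1 / E" by (simp add: E_def exp_minus inverse_eq_divide)
    have sh: "sinh (2 * x) = (E - 1 / E) / 2" "cosh (2 * x) = (E + 1 / E) / 2"
      by (simp_all add: sinh_field_def cosh_field_def E_def exp_minus inverse_eq_divide)
    have s: "E - 1 / E \<noteq> 0" using E EE by (simp add: field_simps)
    have 1: "exp (- 2 * x) / (1 - w) = 1 / (2 * sinh (2 * x))"
      unfolding i w(3) sh using E EE s by (simp add: field_simps)
    have 2: "- X / 2 + - X * w / (1 - w) = - (r\<^sup>2 / 4) * (2 * x) * (cosh (2 * x) / sinh (2 * x))"
      unfolding w(3) sh X_def using E EE s by (simp add: field_simps)
    have "(2 * x * exp (- 2 * x) * cos (x * z) * exp (- X / 2)) * (exp (- X * w / (1 - w)) / (1 - w))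
       = 2 * x * cos (x * z) * (exp (- 2 * x) / (1 - w)) * exp (- X / 2 + - X * w / (1 - w))"
      unfolding exp_add by simp
    also have "\<dots> = indicator {0<..} x * (cos (x * z) * heis_density r (2 * x) / 2)"
      unfolding 1 2 heis_density_def using x by simp
    finally show ?thesis .
  qed
  ultimately show ?thesis by (simp only:)
qed (simp add: heis_term_def)

text \<open>Dominated convergence is applied to the integral over \<open>x\<close> for each \<open>k\<close>, and Tannery's theorem
  to the sum over \<open>k\<close>. Letting \<open>r\<close> and \<open>z\<close> converge along with \<open>t\<close> yields locally uniform convergence.\<close>

lemma
  fixes t r z :: "nat \<Rightarrow> real"
  assumes t: "t \<longlonglongrightarrow> 0" "\<And>j. 0 < t j \<and> t j \<le> 1" and r: "r \<longlonglongrightarrow> r0" and z: "z \<longlonglongrightarrow> z0"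
  shows scaled_heat_series_tendsto:
      "(\<lambda>j. (t j)\<^sup>2 * heat_series (t j) (cyl (sqrt (t j) * r j) \<theta> (t j * z j)))
        \<longlonglongrightarrow> (\<integral>x. indicator {0<..} x * (cos (x * z0) * heis_density r0 (2 * x) / 2) \<partial>lborel)"
    and scaled_heat_series_limit_integrable:
      "integrable lborel (\<lambda>x. indicator {0<..} x * (cos (x * z0) * heis_density r0 (2 * x) / 2))"
proof -
  let ?m = "\<lambda>k x. majorant k * (indicator {0<..} x * exp (- real (2 * k + 1) * x))"
  have t': "0 < t j" "t j \<le> 1" for j using t(2)[of j] by auto
  have m: "integrable lborel (?m k)" "(\<integral>x. ?m k x \<partial>lborel) = majorant k / real (2 * k + 1)" for k
    using integral_majorant[of k] by (auto simp only: has_bochner_integral_iff)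
  have lim: "(\<lambda>j. scaled_term (t j) (r j) (z j) k x) \<longlonglongrightarrow> heis_term r0 z0 k x" for k x
    by (rule scaled_term_tendsto[OF t(1) t'(1) r z])
  have meas: "scaled_term (t j) (r j) (z j) k \<in> borel_measurable lborel" for j k
    by (rule scaled_heat_series(2)[OF t'])
  have hm: "heis_term r0 z0 k \<in> borel_measurable lborel" for k
    by (rule borel_measurable_LIMSEQ_real[OF lim meas])
  have hb: "\<bar>heis_term r0 z0 k x\<bar> \<le> ?m k x" for k x
    by (rule LIMSEQ_le_const2[OF tendsto_rabs[OF lim]]) (use abs_scaled_term_le[OF t'] in blast)
  have hi: "integrable lborel (heis_term r0 z0 k)" for k
    by (rule Bochner_Integration.integrable_bound[OF m(1) hm]) (intro AE_I2, unfold real_norm_def, rule order_trans[OF hb abs_ge_self])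
  have DC: "(\<lambda>j. \<integral>x. scaled_term (t j) (r j) (z j) k x \<partial>lborel) \<longlonglongrightarrow> (\<integral>x. heis_term r0 z0 k x \<partial>lborel)" for k
  proof (rule integral_dominated_convergence[OF hm meas m(1)[of k]])
    show "AE x in lborel. (\<lambda>j. scaled_term (t j) (r j) (z j) k x) \<longlonglongrightarrow> heis_term r0 z0 k x"
      by (intro AE_I2 lim)
    show "AE x in lborel. norm (scaled_term (t j) (r j) (z j) k x) \<le> ?m k x" for j
      unfolding real_norm_def by (intro AE_I2 abs_scaled_term_le t')
  qed
  have "(\<lambda>j. \<Sum>k. \<integral>x. scaled_term (t j) (r j) (z j) k x \<partial>lborel) \<longlonglongrightarrow> (\<Sum>k. \<integral>x. heis_term r0 z0 k x \<partial>lborel)"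
    by (rule conjunct2[OF conjunct2[OF tannerys_theorem[OF DC _ summable_majorant]]])
      (use scaled_heat_series(3)[OF t'] in \<open>auto intro!: always_eventually simp del: of_nat_add\<close>)
  then have L: "(\<lambda>j. (t j)\<^sup>2 * heat_series (t j) (cyl (sqrt (t j) * r j) \<theta> (t j * z j)))
       \<longlonglongrightarrow> (\<Sum>k. \<integral>x. heis_term r0 z0 k x \<partial>lborel)"
    unfolding scaled_heat_series(1)[OF t'] .
  have a: "AE x in lborel. summable (\<lambda>k. norm (heis_term r0 z0 k x))"
  proof (intro AE_I2)
    fix x :: real
    show "summable (\<lambda>k. norm (heis_term r0 z0 k x))"
    proof (cases "0 < x")
      case True
      have "summable (\<lambda>k. majorant k / real (2 * k + 1) * (1 / x))"
        by (intro summable_mult2 summable_majorant)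
      moreover have "norm (norm (heis_term r0 z0 k x)) \<le> majorant k / real (2 * k + 1) * (1 / x)" for k
      proof -
        let ?d = "real (2 * k + 1)"
        have inv: "exp (- y) \<le> 1 / y" if "0 < y" for y :: real
        proof -
          have "y \<le> exp y" using exp_ge_add_one_self[of y] by linarith
          then show ?thesis using that by (simp add: exp_minus field_simps)
        qed
        have "0 < ?d * x" using True by simp
        from inv[OF this] have "exp (- ?d * x) \<le> 1 / (?d * x)"
          unfolding mult_minus_left .
        then have "majorant k * exp (- ?d * x) \<le> majorant k * (1 / (?d * x))"
          by (rule mult_left_mono[OF _ majorant_nonneg])
        moreover have "majorant k * (1 / (?d * x)) = majorant k / ?d * (1 / x)" by simp
        moreover have "\<bar>heis_term r0 z0 k x\<bar> \<le> majorant k * exp (- ?d * x)"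
          using hb[of k x] True by (simp only: indicator_simps greaterThan_iff mult_1_left)
        ultimately show ?thesis unfolding real_norm_def abs_idempotent by linarith
      qed
      ultimately show ?thesis by (rule summable_comparison_test'[where N = 0])
    qed (simp add: heis_term_def)
  qed
  have b: "summable (\<lambda>k. \<integral>x. norm (heis_term r0 z0 k x) \<partial>lborel)"
  proof (rule summable_comparison_test'[OF summable_majorant, of 0])
    fix k
    have "(\<integral>x. norm (heis_term r0 z0 k x) \<partial>lborel) \<le> (\<integral>x. ?m k x \<partial>lborel)"
      using hb by (intro integral_mono integrable_norm hi m(1)) auto
    then show "norm (\<integral>x. norm (heis_term r0 z0 k x) \<partial>lborel) \<le> majorant k / real (2 * k + 1)"
      unfolding m(2) by (simp add: integral_nonneg_AE)
  qed
  have s: "(\<Sum>k. heis_term r0 z0 k x) = indicator {0<..} x * (cos (x * z0) * heis_density r0 (2 * x) / 2)" for x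
    using sum_heis_term[of r0 z0 x] by (simp add: sums_iff)
  show "integrable lborel (\<lambda>x. indicator {0<..} x * (cos (x * z0) * heis_density r0 (2 * x) / 2))"
    using integrable_suminf[OF hi a b] unfolding s .
  show "(\<lambda>j. (t j)\<^sup>2 * heat_series (t j) (cyl (sqrt (t j) * r j) \<theta> (t j * z j)))
        \<longlonglongrightarrow> (\<integral>x. indicator {0<..} x * (cos (x * z0) * heis_density r0 (2 * x) / 2) \<partial>lborel)"
    using L integral_suminf[OF hi a b] unfolding s by simp
qed

lemma integrable_heis_density:
  "integrable lborel (\<lambda>x. indicator {0<..} x * (cos (x * z) * heis_density r (2 * x) / 2))"
proof (rule scaled_heat_series_limit_integrable[OF LIMSEQ_inverse_real_of_nat _ tendsto_const tendsto_const])
  show "0 < inverse (real (Suc j)) \<and> inverse (real (Suc j)) \<le> 1" for j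
    by (simp add: inverse_le_1_iff del: of_nat_Suc)
qed

text \<open>The two half lines combine to a cosine because \<open>heis_density\<close> is even; the substitution
  \<open>\<xi> = 2 * x\<close> gives the remaining constant.\<close>

lemma heis_kernel_half_line:
  "2 * pi\<^sup>2 * heis_kernel 1 r z
    = of_real (\<integral>x. indicator {0<..} x * (cos (x * z) * heis_density r (2 * x) / 2) \<partial>lborel)"
proof -
  define V where "V z \<xi> = indicator {0<..} \<xi> *\<^sub>R (exp (\<i> * \<xi> * z / 2) * complex_of_real (heis_density r \<xi>))" for z \<xi> :: real
  have dm: "heis_density r \<in> borel_measurable borel"
  proof -
    have [measurable]: "(sinh :: real \<Rightarrow> real) \<in> borel_measurable borel" "(cosh :: real \<Rightarrow> real) \<in> borel_measurable borel"
      by (intro borel_measurable_continuous_onI continuous_intros)+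
    show ?thesis unfolding heis_density_def by measurable
  qed
  have "integrable lborel (\<lambda>x. 2 * (indicator {0<..} x * (cos (x * 0) * heis_density r (2 * x) / 2)))"
    by (intro integrable_mult_right integrable_heis_density)
  then have "integrable lborel (\<lambda>x. indicator {0<..} (0 + 2 * x) * heis_density r (0 + 2 * x))"
    by (simp add: indicator_def)
  then have di: "integrable lborel (\<lambda>\<xi>. indicator {0<..} \<xi> * heis_density r \<xi>)"
    using lborel_integrable_real_affine_iff[of 2 "\<lambda>\<xi>. indicator {0<..} \<xi> * heis_density r \<xi>" 0] by simp
  have Vi: "integrable lborel (V z)" for z
  proof (rule Bochner_Integration.integrable_bound[OF di])
    show "V z \<in> borel_measurable lborel"
      unfolding V_def using dm by (auto intro!: borel_measurable_scaleR borel_measurable_times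
          borel_measurable_continuous_onI[of "\<lambda>x :: real. exp (\<i> * x * z / 2)"] continuous_intros)
    have "cmod (exp (\<i> * \<xi> * z / 2)) = 1" for \<xi> :: real
      using norm_exp_i_times[of "\<xi> * z / 2"] by simp
    then show "AE \<xi> in lborel. norm (V z \<xi>) \<le> norm (indicator {0<..} \<xi> * heis_density r \<xi>)"
      by (intro AE_I2) (simp add: V_def norm_mult)
  qed
  have even: "heis_density r (- \<xi>) = heis_density r \<xi>" for \<xi>
    by (simp add: heis_density_def)
  have W: "exp (\<i> * \<xi> * z / 2) * complex_of_real (\<xi> / sinh (\<xi> * 1) *
           exp (- (r\<^sup>2 / 4) * \<xi> * (cosh (\<xi> * 1) / sinh (\<xi> * 1)))) = V z \<xi> + V (- z) (0 + - 1 * \<xi>)" for \<xi> :: real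
  proof -
    have "\<xi> = 0 \<Longrightarrow> heis_density r \<xi> = 0" by (simp add: heis_density_def)
    then have "exp (\<i> * \<xi> * z / 2) * complex_of_real (heis_density r \<xi>) = V z \<xi> + V (- z) (- \<xi>)"
      by (cases "\<xi> > 0"; cases "\<xi> < 0") (auto simp: V_def even)
    then show ?thesis by (simp add: heis_density_def)
  qed
  have Vr: "integrable lborel (\<lambda>\<xi>. V (- z) (0 + - 1 * \<xi>))"
    using lborel_integrable_real_affine[OF Vi[of "- z"], of "- 1" 0] by simp
  have "(\<integral>\<xi>. V (- z) \<xi> \<partial>lborel) = (\<integral>\<xi>. V (- z) (0 + - 1 * \<xi>) \<partial>lborel)"
    using lborel_integral_real_affine[of "- 1" "V (- z)" 0] by simp
  then have "(\<integral>\<xi>. V z \<xi> + V (- z) (0 + - 1 * \<xi>) \<partial>lborel) = (\<integral>\<xi>. V z \<xi> + V (- z) \<xi> \<partial>lborel)"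
    using Vi Vr by (simp only: Bochner_Integration.integral_add)
  also have "\<dots> = (\<integral>\<xi>. complex_of_real (2 * (indicator {0<..} \<xi> * (cos (\<xi> * z / 2) * heis_density r \<xi>))) \<partial>lborel)"
  proof (intro Bochner_Integration.integral_cong refl)
    fix \<xi> :: real
    have "exp (\<i> * \<xi> * z / 2) + exp (\<i> * \<xi> * (- z) / 2) = 2 * complex_of_real (cos (\<xi> * z / 2))"
      by (simp add: complex_eq_iff Re_exp Im_exp)
    then show "V z \<xi> + V (- z) \<xi> = complex_of_real (2 * (indicator {0<..} \<xi> * (cos (\<xi> * z / 2) * heis_density r \<xi>)))"
      unfolding V_def scaleR_add_right[symmetric] distrib_right[symmetric]
      by (simp add: scaleR_conv_of_real mult_ac)
  qed
  also have "\<dots> = of_real (\<integral>\<xi>. 2 * (indicator {0<..} \<xi> * (cos (\<xi> * z / 2) * heis_density r \<xi>)) \<partial>lborel)"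
    by (rule integral_complex_of_real)
  also have "(\<integral>\<xi>. 2 * (indicator {0<..} \<xi> * (cos (\<xi> * z / 2) * heis_density r \<xi>)) \<partial>lborel)
      = 2 * (\<integral>x. 2 * (indicator {0<..} (0 + 2 * x) * (cos ((0 + 2 * x) * z / 2) * heis_density r (0 + 2 * x))) \<partial>lborel)"
    using lborel_integral_real_affine[of 2 "\<lambda>\<xi>. 2 * (indicator {0<..} \<xi> * (cos (\<xi> * z / 2) * heis_density r \<xi>))" 0] by simp
  also have "(\<lambda>x. 2 * (indicator {0<..} (0 + 2 * x) * (cos ((0 + 2 * x) * z / 2) * heis_density r (0 + 2 * x))))
     = (\<lambda>x. 4 * (indicator {0<..} x * (cos (x * z) * heis_density r (2 * x) / 2)))"
    by (auto simp: fun_eq_iff indicator_def)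
  also have "(\<integral>x. 4 * (indicator {0<..} x * (cos (x * z) * heis_density r (2 * x) / 2)) \<partial>lborel)
     = 4 * (\<integral>x. indicator {0<..} x * (cos (x * z) * heis_density r (2 * x) / 2) \<partial>lborel)"
    by (rule Bochner_Integration.integral_mult_right_zero)
  finally have "(\<integral>\<xi>. V z \<xi> + V (- z) (0 + - 1 * \<xi>) \<partial>lborel)
     = of_real (8 * (\<integral>x. indicator {0<..} x * (cos (x * z) * heis_density r (2 * x) / 2) \<partial>lborel))"
    by simp
  then show ?thesis
    unfolding heis_kernel_def W by simp
qed

text \<open>Continuous convergence on a compact set is uniform: along a convergent subsequence of violating
  points both \<open>f\<close> and \<open>l\<close> approach \<open>l x0\<close>. Continuity of \<open>l\<close> follows from the hypothesis by
  approximating \<open>l\<close> at each point with a value of \<open>f\<close>.\<close>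

lemma uniform_limit_at_right_0_sequentially:
  fixes f :: "real \<Rightarrow> 'a::metric_space \<Rightarrow> 'b::metric_space"
  assumes K: "compact K"
    and lim: "\<And>t x x0. t \<longlonglongrightarrow> 0 \<Longrightarrow> (\<And>j. 0 < t j \<and> t j \<le> 1) \<Longrightarrow> (\<And>j. x j \<in> K) \<Longrightarrow> x0 \<in> K \<Longrightarrow>
        x \<longlonglongrightarrow> x0 \<Longrightarrow> (\<lambda>j. f (t j) (x j)) \<longlonglongrightarrow> l x0"
  shows "uniform_limit K f l (at_right 0)"
proof (rule ccontr)
  define h where "h j = inverse (real (Suc j))" for j
  have h: "h \<longlonglongrightarrow> 0" "0 < h j" "h j \<le> 1" for j
    unfolding h_def[abs_def] by (simp_all add: LIMSEQ_inverse_real_of_nat inverse_le_1_iff del: of_nat_Suc)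
  assume "\<not> uniform_limit K f l (at_right 0)"
  then obtain e where e: "0 < e" and ne: "\<not> (\<forall>\<^sub>F t in at_right 0. \<forall>x\<in>K. dist (f t x) (l x) < e)"
    unfolding uniform_limit_iff by blast
  have "\<exists>t x. 0 < t \<and> t < h j \<and> x \<in> K \<and> e \<le> dist (f t x) (l x)" for j
    using ne h(2)[of j] unfolding eventually_at_right_field by (metis not_less)
  then obtain t x where tx: "\<And>j. 0 < t j" "\<And>j. t j < h j" "\<And>j. x j \<in> K" "\<And>j. e \<le> dist (f (t j) (x j)) (l (x j))"
    by metis
  obtain x0 s where s: "x0 \<in> K" "strict_mono s" "(x \<circ> s) \<longlonglongrightarrow> x0"
    using K tx(3) unfolding compact_def by metis
  have "t \<longlonglongrightarrow> 0"
    by (rule tendsto_sandwich[OF _ _ tendsto_const h(1)]) (use tx(1,2) in \<open>auto intro!: always_eventually less_imp_le\<close>)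
  then have ts: "(t \<circ> s) \<longlonglongrightarrow> 0" by (rule LIMSEQ_subseq_LIMSEQ[OF _ s(2)])
  have "(\<lambda>j. f ((t \<circ> s) j) ((x \<circ> s) j)) \<longlonglongrightarrow> l x0"
    using tx(1,3) less_imp_le[OF order_less_le_trans[OF tx(2) h(3)]]
    by (intro lim[OF ts _ _ s(1) s(3)]) auto
  moreover have "(\<lambda>j. l ((x \<circ> s) j)) \<longlonglongrightarrow> l x0"
  proof -
    have "\<exists>\<tau>. 0 < \<tau> \<and> \<tau> \<le> h j \<and> dist (f \<tau> y) (l y) < h j" if "y \<in> K" for y j
    proof -
      have "(\<lambda>i. f (h i) y) \<longlonglongrightarrow> l y"
        using h that by (intro lim) auto
      then have "\<forall>\<^sub>F i in sequentially. dist (f (h i) y) (l y) < h j"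
        using h(2) by (rule tendstoD)
      moreover have "\<forall>\<^sub>F i in sequentially. h i < h j"
        by (rule order_tendstoD(2)[OF h(1) h(2)])
      ultimately have "\<forall>\<^sub>F i in sequentially. dist (f (h i) y) (l y) < h j \<and> h i < h j"
        by (rule eventually_conj)
      then obtain i where "dist (f (h i) y) (l y) < h j \<and> h i < h j"
        using eventually_happens'[OF sequentially_bot] by blast
      then show ?thesis using h(2) by (intro exI[of _ "h i"]) auto
    qed
    then have "\<exists>\<tau>. 0 < \<tau> \<and> \<tau> \<le> h j \<and> dist (f \<tau> ((x \<circ> s) j)) (l ((x \<circ> s) j)) < h j" for j
      using tx(3) by simp
    then obtain \<tau> where \<tau>: "\<And>j. 0 < \<tau> j" "\<And>j. \<tau> j \<le> h j" "\<And>j. dist (f (\<tau> j) ((x \<circ> s) j)) (l ((x \<circ> s) j)) < h j"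
      by metis
    have "\<tau> \<longlonglongrightarrow> 0"
      by (rule tendsto_sandwich[OF _ _ tendsto_const h(1)]) (use \<tau>(1,2) in \<open>auto intro!: always_eventually less_imp_le\<close>)
    then have 1: "(\<lambda>j. f (\<tau> j) ((x \<circ> s) j)) \<longlonglongrightarrow> l x0"
      using s tx(3) \<tau>(1) order_trans[OF \<tau>(2) h(3)] by (intro lim[OF _ _ _ s(1) s(3)]) auto
    have 2: "(\<lambda>j. dist (l ((x \<circ> s) j)) (f (\<tau> j) ((x \<circ> s) j))) \<longlonglongrightarrow> 0"
      by (rule tendsto_sandwich[OF _ _ tendsto_const h(1)])
        (use \<tau>(3) in \<open>auto intro!: always_eventually less_imp_le simp: dist_commute\<close>)
    have "(\<lambda>j. dist (l ((x \<circ> s) j)) (f (\<tau> j) ((x \<circ> s) j)) + dist (f (\<tau> j) ((x \<circ> s) j)) (l x0)) \<longlonglongrightarrow> 0 + 0"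
      using 1 by (intro tendsto_add 2) (simp add: tendsto_dist_iff[symmetric])
    then have 3: "(\<lambda>j. dist (l ((x \<circ> s) j)) (f (\<tau> j) ((x \<circ> s) j)) + dist (f (\<tau> j) ((x \<circ> s) j)) (l x0)) \<longlonglongrightarrow> 0" by simp
    have "(\<lambda>j. dist (l ((x \<circ> s) j)) (l x0)) \<longlonglongrightarrow> 0"
      by (rule tendsto_sandwich[OF always_eventually always_eventually tendsto_const 3]) (simp_all add: dist_triangle)
    then show ?thesis by (rule iffD2[OF tendsto_dist_iff])
  qed
  ultimately have "(\<lambda>j. dist (f ((t \<circ> s) j) ((x \<circ> s) j)) (l ((x \<circ> s) j))) \<longlonglongrightarrow> dist (l x0) (l x0)"
    by (intro tendsto_dist)
  then have "e \<le> dist (l x0) (l x0)"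
    by (rule LIMSEQ_le_const) (use tx(4) in auto)
  then show False using e by simp
qed

theorem proposition3p13:
  fixes p :: "real \<Rightarrow> su2 \<Rightarrow> real" and \<theta> :: real and K :: "(real \<times> real) set"
  assumes "is_heat_kernel p"
    and "compact K" and "K \<subseteq> {0..} \<times> UNIV"
  shows "uniform_limit K
           (\<lambda>t (r, z). complex_of_real (t\<^sup>2 * p t (cyl (sqrt t * r) \<theta> (t * z))))
           (\<lambda>(r, z). 2 * pi\<^sup>2 * heis_kernel 1 r z)
           (at_right 0)"
proof (rule uniform_limit_at_right_0_sequentially[OF assms(2)])
  fix t :: "nat \<Rightarrow> real" and x :: "nat \<Rightarrow> real \<times> real" and x0 :: "real \<times> real"
  assume t: "t \<longlonglongrightarrow> 0" "\<And>j. 0 < t j \<and> t j \<le> 1" and x: "x \<longlonglongrightarrow> x0"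
  define r z where "r j = fst (x j)" and "z j = snd (x j)" for j
  obtain r0 z0 where x0: "x0 = (r0, z0)" by (cases x0)
  have r: "r \<longlonglongrightarrow> r0" and z: "z \<longlonglongrightarrow> z0"
    using tendsto_fst[OF x] tendsto_snd[OF x] by (simp_all add: r_def[abs_def] z_def[abs_def] x0)
  have "(\<lambda>j. complex_of_real ((t j)\<^sup>2 * heat_series (t j) (cyl (sqrt (t j) * r j) \<theta> (t j * z j))))
      \<longlonglongrightarrow> of_real (\<integral>x. indicator {0<..} x * (cos (x * z0) * heis_density r0 (2 * x) / 2) \<partial>lborel)"
    by (intro tendsto_of_real scaled_heat_series_tendsto[OF t r z])
  also have "of_real (\<integral>x. indicator {0<..} x * (cos (x * z0) * heis_density r0 (2 * x) / 2) \<partial>lborel)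
      = 2 * pi\<^sup>2 * heis_kernel 1 r0 z0"
    by (rule heis_kernel_half_line[symmetric])
  finally show "(\<lambda>j. (case x j of (r, z) \<Rightarrow> complex_of_real ((t j)\<^sup>2 * p (t j) (cyl (sqrt (t j) * r) \<theta> (t j * z)))))
      \<longlonglongrightarrow> (case x0 of (r, z) \<Rightarrow> 2 * pi\<^sup>2 * heis_kernel 1 r z)"
    using heat_kernel_eq_heat_series[OF assms(1)] t(2)
    by (simp add: x0 r_def z_def case_prod_beta)
qed

end
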